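(* Let $x>0$ be fixed and, for each $n$, let $t=\frac{x}{n^{3/4}}$ and \[G_{t,n}=\sum_{i<j}1_{\{|P_i-P_j|\le t\}},\] where $P_1,\ldots,P_n$ are the points of the spherical ensemble $\mathcal{X}^{(n)}$. Then, as $n\to+\infty$, $G_{t,n}$ converges in distribution to the Poisson random variable with mean $\frac{x^4}{64}$.
   Context: Spherical ensemble. Let $\mathbb{S}^2=\{p\in\mathbb{R}^3:|p|=1\}$ and let $\nu$ be the surface area measure on $\mathbb{S}^2$ (total mass $4\pi$). Let $A_n,B_n$ be independent $n\times n$ random matrices with i.i.d. standard complex Gaussian entries, let $\lambda_1,\ldots,\lambda_n$ be the eigenvalues of $A_n^{-1}B_n$, let $g$ be the stereographic projection of $\mathbb{S}^2$ from the north pole onto the plane $\{(t_1,t_2,0)\}\cong\mathbb{C}$, and let $P_i=g^{-1}(\lambda_i)$. Equivalently, in uniform random order, $(P_1,\ldots,P_n)$ has joint density proportional to $\prod_{i<j}|p_i-p_j|^2$ with respect to $\nu^{\otimes n}$ on $(\mathbb{S}^2)^n$, where $|\cdot|$ is the Euclidean norm. The point process is $\mathcal{X}^{(n)}=\sum_{i=1}^n\delta_{P_i}$. *)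

theory Defs
  imports "HOL-Probability.Probability"
begin

abbreviation S2 :: "(real^3) set" where
  "S2 \<equiv> sphere 0 1"

definition sph_coord :: "real \<times> real \<Rightarrow> real^3" where
  "sph_coord = (\<lambda>(\<theta>, \<phi>). vector [sin \<theta> * cos \<phi>, sin \<theta> * sin \<phi>, cos \<theta>])"

text \<open>Surface area measure on the sphere. The area element of the parametrization by polar angle
  \<open>\<theta>\<close> and azimuth \<open>\<phi>\<close>, i.e. the norm of the cross product of its two partial derivatives,
  is \<open>sin \<theta> d\<theta> d\<phi>\<close>.\<close>

definition surface_measure :: "(real^3) measure" where
  "surface_measure =
     distr (density (restrict_space lborel ({0..pi} \<times> {0..<2 * pi})) (\<lambda>(\<theta>, \<phi>). ennreal (sin \<theta>)))
       (restrict_space borel S2) sph_coord"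

definition vandermonde_sq :: "nat \<Rightarrow> (nat \<Rightarrow> real^3) \<Rightarrow> real" where
  "vandermonde_sq n p = (\<Prod>j<n. \<Prod>i<j. (dist (p i) (p j))\<^sup>2)"

text \<open>The labelling of the points is arbitrary: only after applying an independent, uniformly
  distributed permutation \<open>\<sigma>\<close> of the indices is the vector of points required to have the
  joint density. The constant \<open>c\<close> is determined, since the left-hand side is a probability measure.\<close>

definition spherical_ensemble :: "nat \<Rightarrow> 'a measure \<Rightarrow> (nat \<Rightarrow> 'a \<Rightarrow> real^3) \<Rightarrow> bool" where
  "spherical_ensemble n M P \<longleftrightarrow>
     prob_space M \<and>
     (\<forall>i<n. P i \<in> M \<rightarrow>\<^sub>M restrict_space borel S2) \<and>
     (\<exists>c>0.
        distr (M \<Otimes>\<^sub>M uniform_count_measure {\<sigma>. \<sigma> permutes {..<n}})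
          (\<Pi>\<^sub>M i\<in>{..<n}. restrict_space borel S2)
          (\<lambda>(\<omega>, \<sigma>). \<lambda>i\<in>{..<n}. P (\<sigma> i) \<omega>)
        = density (\<Pi>\<^sub>M i\<in>{..<n}. surface_measure) (\<lambda>p. ennreal (c * vandermonde_sq n p)))"

definition close_pairs :: "nat \<Rightarrow> real \<Rightarrow> (nat \<Rightarrow> 'a \<Rightarrow> real^3) \<Rightarrow> 'a \<Rightarrow> real" where
  "close_pairs n t P \<omega> = (\<Sum>j<n. \<Sum>i<j. of_bool (dist (P i \<omega>) (P j \<omega>) \<le> t))"

lemma sph_coord_in_S2: "sph_coord z \<in> S2"
proof -
  have "(sin a * cos b)\<^sup>2 + (sin a * sin b)\<^sup>2 + (cos a)\<^sup>2 = 1" for a b :: real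
  proof -
    have "(sin a * cos b)\<^sup>2 + (sin a * sin b)\<^sup>2 = (sin a)\<^sup>2 * ((sin b)\<^sup>2 + (cos b)\<^sup>2)"
      by (simp only: power_mult_distrib distrib_left add.commute)
    then show ?thesis by simp
  qed
  then show ?thesis
    by (cases z) (simp add: sph_coord_def norm_vec_def L2_set_def sum_3 vector_3)
qed

lemma continuous_sph_coord: "continuous_on UNIV sph_coord"
proof -
  have "continuous_on UNIV (\<lambda>z. sph_coord z $ i)" for i
    using exhaust_3[of i]
    by (elim disjE; simp add: sph_coord_def case_prod_beta vector_3; intro continuous_intros)
  then show ?thesis
    by (subst continuous_on_componentwise) (auto simp: Basis_vec_def inner_axis)
qed

lemma measurable_sph_coord:
  "sph_coord \<in> restrict_space lborel A \<rightarrow>\<^sub>M restrict_space borel S2"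
  by (rule measurable_restrict_space2)
     (auto simp: sph_coord_in_S2[simplified] intro!: measurable_restrict_space1
        borel_measurable_continuous_onI continuous_sph_coord sph_coord_in_S2)

lemma sets_surface_measure [measurable_cong]: "sets surface_measure = sets (restrict_space borel S2)"
  by (simp add: surface_measure_def)

lemma emeasure_surface_measure_S2: "emeasure surface_measure S2 = 4 * pi"
proof -
  let ?R = "{0..pi} \<times> {0..<2 * pi}"
  let ?f = "\<lambda>(\<theta>, \<phi>). ennreal (sin \<theta>) :: ennreal"
  have R: "?R \<in> sets (lborel :: (real \<times> real) measure)"
    by (metis atLeastAtMost_borel atLeastLessThan_borel borel_Times sets_lborel)
  have f: "?f \<in> borel_measurable (borel :: (real \<times> real) measure)"
    unfolding case_prod_beta borel_prod[symmetric] by measurable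
  have fR: "?f \<in> borel_measurable (restrict_space lborel ?R)"
    using f by (intro measurable_restrict_space1) simp
  have "emeasure surface_measure S2
      = emeasure (density (restrict_space lborel ?R) ?f) (sph_coord -` S2 \<inter> ?R)"
    unfolding surface_measure_def
    by (subst emeasure_distr)
       (auto simp: space_restrict_space sets_restrict_space measurable_sph_coord)
  also have "sph_coord -` S2 \<inter> ?R = ?R"
    using sph_coord_in_S2 by blast
  also have "emeasure (density (restrict_space lborel ?R) ?f) ?R
      = (\<integral>\<^sup>+z. ?f z * indicator ?R z \<partial>restrict_space lborel ?R)"
    using R fR by (intro emeasure_density) (auto simp: sets_restrict_space)
  also have "\<dots> = (\<integral>\<^sup>+z. ?f z * indicator ?R z \<partial>lborel)"
    using R by (subst nn_integral_restrict_space)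
      (auto intro!: nn_integral_cong simp: indicator_def)
  also have "\<dots> = (\<integral>\<^sup>+z. (ennreal (sin (fst z)) * indicator {0..pi} (fst z)) * indicator {0..<2*pi} (snd z)
      \<partial>(lborel \<Otimes>\<^sub>M lborel))"
    by (subst lborel_prod) (auto intro!: nn_integral_cong simp: indicator_def split: prod.splits)
  also have "\<dots> = (\<integral>\<^sup>+a. \<integral>\<^sup>+b. (ennreal (sin a) * indicator {0..pi} a) * indicator {0..<2*pi} b
      \<partial>lborel \<partial>lborel)"
    by (subst lborel.nn_integral_fst[symmetric]) simp_all
  also have "\<dots> = (\<integral>\<^sup>+a. (ennreal (sin a) * indicator {0..pi} a) * ennreal (2 * pi) \<partial>lborel)"
    by (simp add: nn_integral_cmult_indicator)
  also have "\<dots> = (\<integral>\<^sup>+a. ennreal (sin a) * indicator {0..pi} a \<partial>lborel) * ennreal (2 * pi)"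
    by (subst nn_integral_multc) simp_all
  also have "(\<integral>\<^sup>+a. ennreal (sin a) * indicator {0..pi} a \<partial>lborel) = ennreal (- cos pi - (- cos 0))"
    by (rule nn_integral_FTC_Icc) (auto intro!: derivative_eq_intros sin_ge_zero)
  also have "ennreal (- cos pi - (- cos 0)) * ennreal (2 * pi) = ennreal (4 * pi)"
    by (subst ennreal_mult[symmetric]) simp_all
  finally show ?thesis .
qed

end

theory Submission
  imports Defs "Jordan_Normal_Form.Determinant" "HOL-Real_Asymp.Real_Asymp"
begin

text \<open>In the homogeneous (spinor) coordinates of the sphere, the density of the ensemble is a squared
  Vandermonde determinant in an orthonormal family of \<open>n\<close> functions, so its correlation functions are
  the determinants of the reproducing kernel \<open>K\<close>, with
  \<open>\<bar>K(p,q)\<bar>\<^sup>2 = (n / (4 * pi))\<^sup>2 * (1 - \<bar>p - q\<bar>\<^sup>2 / 4) ^ (n - 1)\<close>.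
  Fischer's inequality bounds the correlation function of \<open>k\<close> pairs by the product of the pair correlations,
  and off the diagonal the two are almost equal because \<open>K\<close> decays. Hence \<open>k\<close> disjoint
  close pairs behave as if independent, while clusters of three points are negligible. The number of
  isolated close pairs, which agrees with \<open>close_pairs\<close> with high probability, therefore has the
  factorial moments of the Poisson distribution in the limit, and Bonferroni's inequalities finish the proof.\<close>

section \<open>Gram determinants and Gram--Schmidt\<close>

text \<open>The radius is set by repulsion. For near points the two-point correlation is about
  \<open>(n / (4 * pi))^2 * n * dist^2 / 4\<close>, so the expected number of pairs within
  \<open>t\<close> grows like \<open>n^3 * t^4\<close>, and \<open>n powr (-3/4)\<close> is the
  scale where it stays bounded; integration gives \<open>x^4 / 32\<close> for ordered pairs, hence
  the mean \<open>x^4 / 64\<close>. The obstacle with factorial moments of all close pairs is that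
  several of them may share points. Isolated pairs never do, so k distinct ones form a matching on
  \<open>2 * k\<close> points, and only matchings have to be integrated. What is lost is charged to
  a third point within \<open>t\<close> of a chosen pair, at relative cost \<open>n * t^2\<close>,
  or to two chosen pairs coming close, at relative cost \<open>t^2\<close>. Fischer's inequality
  serves exactly where different pairs approach each other and decay of the kernel is of no help.
  The separation scale \<open>n powr (-1/4)\<close> is intermediate: it tends to 0, so few
  configurations violate it, while n times its square is still \<open>sqrt n\<close>, so kernel
  entries between different pairs decay faster than any power of n.\<close>

definition ip :: "nat \<Rightarrow> (nat \<Rightarrow> complex) \<Rightarrow> (nat \<Rightarrow> complex) \<Rightarrow> complex" where
  "ip n v w = (\<Sum>s<n. v s * cnj (w s))"

text \<open>The entries are a function on all pairs of indices, so rows can be scaled, permuted or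
  cut off without carrier conditions.\<close>

definition fdet :: "nat \<Rightarrow> (nat \<Rightarrow> nat \<Rightarrow> complex) \<Rightarrow> complex" where
  "fdet m A = det (mat m m (\<lambda>(i, j). A i j))"

definition gram :: "nat \<Rightarrow> nat \<Rightarrow> (nat \<Rightarrow> nat \<Rightarrow> complex) \<Rightarrow> complex" where
  "gram n m v = fdet m (\<lambda>i j. ip n (v i) (v j))"

lemma fdet_altdef:
  "fdet m A = (\<Sum>\<pi> | \<pi> permutes {..<m}. of_int (sign \<pi>) * (\<Prod>i<m. A i (\<pi> i)))"
proof -
  have "(\<Prod>i = 0..<m. mat m m (\<lambda>(i, j). A i j) $$ (i, \<pi> i)) = (\<Prod>i<m. A i (\<pi> i))"
    if "\<pi> permutes {..<m}" for \<pi>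
    using permutes_in_image[OF that] by (auto simp: atLeast0LessThan intro!: prod.cong)
  then show ?thesis
    unfolding fdet_def by (subst det_def'[of _ m]) (auto simp: atLeast0LessThan intro!: sum.cong)
qed

lemma fdet_cong: "(\<And>i j. i < m \<Longrightarrow> j < m \<Longrightarrow> A i j = B i j) \<Longrightarrow> fdet m A = fdet m B"
  unfolding fdet_def by (rule arg_cong[of _ _ det]) (auto intro!: eq_matI)

lemma ip_diff_left: "ip n (\<lambda>s. v s - v' s) w = ip n v w - ip n v' w"
  by (simp add: ip_def left_diff_distrib sum_subtractf)
lemma ip_scale_left: "ip n (\<lambda>s. c * v s) w = c * ip n v w"
  by (simp add: ip_def sum_distrib_left mult.assoc)
lemma ip_sum_left: "ip n (\<lambda>s. \<Sum>j\<in>J. f j s) w = (\<Sum>j\<in>J. ip n (f j) w)"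
  unfolding ip_def by (subst sum.swap) (simp add: sum_distrib_right)
lemma ip_cnj: "cnj (ip n v w) = ip n w v"
  by (simp add: ip_def mult.commute)
lemma ip_self: "ip n v v = of_real (\<Sum>s<n. (cmod (v s))\<^sup>2)"
  unfolding ip_def of_real_sum by (intro sum.cong refl) (metis complex_norm_square)
lemma ip_self_Re: "ip n v v = of_real (Re (ip n v v))" "Re (ip n v v) \<ge> 0"
  by (simp_all add: ip_self sum_nonneg)
lemma ip_self_eq_0: "ip n v v = 0 \<Longrightarrow> ip n w v = 0"
proof -
  assume "ip n v v = 0"
  then have "(\<Sum>s<n. (cmod (v s))\<^sup>2) = 0" unfolding ip_self using of_real_eq_0_iff by blast
  then have "\<forall>s<n. v s = 0" by (subst (asm) sum_nonneg_eq_0_iff) auto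
  then show ?thesis by (simp add: ip_def)
qed

fun gs :: "nat \<Rightarrow> (nat \<Rightarrow> nat \<Rightarrow> complex) \<Rightarrow> nat \<Rightarrow> nat \<Rightarrow> complex" where
  "gs n v i = (\<lambda>s. v i s - (\<Sum>j<i. ip n (v i) (gs n v j) / ip n (gs n v j) (gs n v j) * gs n v j s))"

declare gs.simps [simp del]

lemma gs_orth_less: "j < i \<Longrightarrow> ip n (gs n v i) (gs n v j) = 0"
proof (induction i arbitrary: j rule: less_induct)
  case (less i)
  let ?w = "gs n v"
  have *: "ip n (?w k) (?w j) = 0" if "k < i" "k \<noteq> j" for k
  proof (cases "k < j")
    case True
    then have "ip n (?w j) (?w k) = 0" using less by blast
    then show ?thesis by (metis ip_cnj complex_cnj_zero)
  next
    case False
    then show ?thesis using less that by auto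
  qed
  have "ip n (?w i) (?w j) = ip n (v i) (?w j) -
      (\<Sum>k<i. ip n (v i) (?w k) / ip n (?w k) (?w k) * ip n (?w k) (?w j))"
    by (subst gs.simps) (simp only: ip_diff_left ip_sum_left ip_scale_left)
  also have "(\<Sum>k<i. ip n (v i) (?w k) / ip n (?w k) (?w k) * ip n (?w k) (?w j)) =
     (\<Sum>k<i. if k = j then ip n (v i) (?w j) else 0)"
    using * ip_self_eq_0[of n "?w j" "v i"] by (intro sum.cong) auto
  also have "\<dots> = ip n (v i) (?w j)" using less.prems by simp
  finally show ?case by simp
qed

lemma gs_orth: "i \<noteq> j \<Longrightarrow> ip n (gs n v i) (gs n v j) = 0"
  by (metis gs_orth_less ip_cnj complex_cnj_zero linorder_neqE_nat)

definition gs_coeff :: "nat \<Rightarrow> (nat \<Rightarrow> nat \<Rightarrow> complex) \<Rightarrow> nat \<Rightarrow> nat \<Rightarrow> complex" where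
  "gs_coeff n v i j = (if j = i then 1 else if j < i then ip n (v i) (gs n v j) / ip n (gs n v j) (gs n v j) else 0)"

lemma gs_expand: "i < m \<Longrightarrow> v i = (\<lambda>s. \<Sum>j<m. gs_coeff n v i j * gs n v j s)"
proof
  fix s assume "i < m"
  have "(\<Sum>j<m. gs_coeff n v i j * gs n v j s) = (\<Sum>j<Suc i. gs_coeff n v i j * gs n v j s)"
    using \<open>i < m\<close> by (intro sum.mono_neutral_right) (auto simp: gs_coeff_def)
  also have "\<dots> = (\<Sum>j<i. ip n (v i) (gs n v j) / ip n (gs n v j) (gs n v j) * gs n v j s) + gs n v i s"
    by (simp add: gs_coeff_def)
  also have "\<dots> = v i s" by (subst (2) gs.simps) simp
  finally show "v i s = (\<Sum>j<m. gs_coeff n v i j * gs n v j s)" by simp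
qed

lemma ip_gs_expand:
  assumes "i < m" "j < m"
  shows "ip n (v i) (v j) =
    (\<Sum>k<m. gs_coeff n v i k * ip n (gs n v k) (gs n v k) * cnj (gs_coeff n v j k))"
proof -
  have 1: "ip n (v i) x = (\<Sum>k<m. gs_coeff n v i k * ip n (gs n v k) x)" if "i < m" for x i
    by (subst gs_expand[OF that]) (simp only: ip_sum_left ip_scale_left)
  have 2: "ip n (gs n v k) (v j) = cnj (gs_coeff n v j k) * ip n (gs n v k) (gs n v k)" if "k < m" for k
  proof -
    have "ip n (v j) (gs n v k) = (\<Sum>l<m. gs_coeff n v j l * ip n (gs n v l) (gs n v k))" by (rule 1[OF assms(2)])
    also have "\<dots> = (\<Sum>l<m. if l = k then gs_coeff n v j k * ip n (gs n v k) (gs n v k) else 0)"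
      using gs_orth by (intro sum.cong) auto
    also have "\<dots> = gs_coeff n v j k * ip n (gs n v k) (gs n v k)" using that by simp
    finally have "cnj (ip n (v j) (gs n v k)) = cnj (gs_coeff n v j k * ip n (gs n v k) (gs n v k))" by simp
    then show ?thesis by (simp add: ip_cnj)
  qed
  show ?thesis using 2 by (simp add: 1[OF assms(1)] mult_ac)
qed

text \<open>The Gram matrix factors as T D T*, with T the unit lower triangular matrix of
  Gram-Schmidt coefficients and D the diagonal matrix of squared residual lengths; \<open>U\<close>
  is T*.\<close>

lemma gram_eq_prod: "gram n m v = of_real (\<Prod>i<m. Re (ip n (gs n v i) (gs n v i)))"
proof -
  define T where "T = mat m m (\<lambda>(i, j). gs_coeff n v i j)"
  define D where "D = mat m m (\<lambda>(i, j). if i = j then ip n (gs n v i) (gs n v i) else 0)"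
  define U where "U = mat m m (\<lambda>(i, j). cnj (gs_coeff n v j i))"
  have [simp]: "T \<in> carrier_mat m m" "D \<in> carrier_mat m m" "U \<in> carrier_mat m m"
    by (auto simp: T_def D_def U_def)
  have TD: "T * D = mat m m (\<lambda>(i, j). gs_coeff n v i j * ip n (gs n v j) (gs n v j))"
    by (rule eq_matI) (auto simp: T_def D_def scalar_prod_def if_distrib if_distribR cong: if_cong)
  have "T * D * U = mat m m (\<lambda>(i, j). ip n (v i) (v j))"
    unfolding TD
    by (rule eq_matI) (auto simp: U_def scalar_prod_def atLeast0LessThan ip_gs_expand[symmetric])
  then have "gram n m v = det (T * D * U)" by (simp add: gram_def fdet_def)
  also have "\<dots> = det T * det D * det U"
    by (simp add: det_mult[of _ m] mult_carrier_mat[of _ m m])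
  also have "det T = 1"
    by (subst det_lower_triangular[of m]) (auto simp: T_def gs_coeff_def prod_list_diag_prod)
  also have "det U = 1"
    by (subst det_upper_triangular[of _ m]) (auto simp: U_def gs_coeff_def prod_list_diag_prod)
  also have "det D = (\<Prod>i<m. ip n (gs n v i) (gs n v i))"
    by (subst det_upper_triangular[of _ m]) (auto simp: D_def prod_list_diag_prod atLeast0LessThan)
  finally show ?thesis by (simp flip: ip_self_Re(1))
qed

lemma Re_gram: "Re (gram n m v) = (\<Prod>i<m. Re (ip n (gs n v i) (gs n v i)))"
  unfolding gram_eq_prod Re_complex_of_real ..

lemma gram_real: "gram n m v = of_real (Re (gram n m v))"
  unfolding Re_gram by (rule gram_eq_prod)

lemma gram_nonneg: "Re (gram n m v) \<ge> 0"
  unfolding Re_gram by (intro prod_nonneg ballI ip_self_Re)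

text \<open>Pythagoras for \<open>b = w + (b - w)\<close>.\<close>

lemma ip_le_of_orth:
  assumes "ip n w (\<lambda>s. b s - w s) = 0"
  shows "Re (ip n w w) \<le> Re (ip n b b)"
proof -
  have "ip n (\<lambda>s. b s - w s) w = 0" using assms by (metis ip_cnj complex_cnj_zero)
  moreover have "ip n b b = ip n (\<lambda>s. w s + (b s - w s)) (\<lambda>s. w s + (b s - w s))" by simp
  moreover have "\<dots> = ip n w w + cnj (ip n (\<lambda>s. b s - w s) w) + (ip n (\<lambda>s. b s - w s) w
     + ip n (\<lambda>s. b s - w s) (\<lambda>s. b s - w s))"
    unfolding ip_def complex_cnj_add distrib_left distrib_right sum.distrib by (simp add: ip_def mult_ac)
  ultimately show ?thesis using ip_self_Re(2)[of n "\<lambda>s. b s - w s"] by simp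
qed

lemma gs_orth_span: "j < i \<Longrightarrow> ip n (gs n v i) (v j) = 0"
proof -
  assume "j < i"
  have "ip n (v j) (gs n v i) = (\<Sum>k<i. gs_coeff n v j k * ip n (gs n v k) (gs n v i))"
    by (subst gs_expand[OF \<open>j < i\<close>]) (simp only: ip_sum_left ip_scale_left)
  also have "\<dots> = 0" using gs_orth by (intro sum.neutral) auto
  finally show ?thesis by (metis ip_cnj complex_cnj_zero)
qed

lemma ip_diff_right: "ip n w (\<lambda>s. v s - v' s) = ip n w v - ip n w v'"
  by (simp add: ip_def right_diff_distrib sum_subtractf)
lemma ip_scale_right: "ip n w (\<lambda>s. c * v s) = cnj c * ip n w v"
  by (simp add: ip_def sum_distrib_left mult_ac)
lemma ip_sum_right: "ip n w (\<lambda>s. \<Sum>j\<in>J. f j s) = (\<Sum>j\<in>J. ip n w (f j))"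
  unfolding ip_def by (subst sum.swap) (simp add: sum_distrib_left)

text \<open>What is subtracted from \<open>v i\<close> lies in the span of the earlier residuals, to
  which \<open>gs n v i\<close> is orthogonal.\<close>

lemma gs_self: "ip n (gs n v i) (\<lambda>s. v i s - gs n v i s) = 0"
proof -
  have "(\<lambda>s. v i s - gs n v i s) = (\<lambda>s. \<Sum>j<i. ip n (v i) (gs n v j) / ip n (gs n v j) (gs n v j) * gs n v j s)"
    by (subst gs.simps) simp
  then show ?thesis
    using gs_orth by (simp only: ip_sum_right ip_scale_right) (auto intro!: sum.neutral)
qed

text \<open>One Hadamard step: the new factor is the squared length of a residual of
  \<open>v m\<close>, and a residual is no longer than its vector.\<close>

lemma gram_Suc_le: "Re (gram n (Suc m) v) \<le> Re (gram n m v) * Re (ip n (v m) (v m))"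
  by (auto simp: Re_gram intro!: mult_left_mono prod_nonneg ip_self_Re ip_le_of_orth gs_self)

text \<open>The Gram--Schmidt vector of \<open>v (Suc m)\<close> is its residual against all earlier vectors, hence at most
  as long as its residual against \<open>v m\<close> alone.\<close>

lemma gs_pair_le:
  "Re (ip n (gs n v m) (gs n v m)) * Re (ip n (gs n v (Suc m)) (gs n v (Suc m)))
   \<le> Re (ip n (v m) (v m)) * Re (ip n (v (Suc m)) (v (Suc m))) - (cmod (ip n (v m) (v (Suc m))))\<^sup>2"
proof (cases "ip n (v m) (v m) = 0")
  \<comment> \<open>There is no direction to project on; both sides are 0.\<close>
  case True
  have "Re (ip n (gs n v m) (gs n v m)) \<le> Re (ip n (v m) (v m))" by (rule ip_le_of_orth[OF gs_self])
  then have "Re (ip n (gs n v m) (gs n v m)) = 0" using True ip_self_Re(2)[of n "gs n v m"] by simp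
  moreover have "ip n (v m) (v (Suc m)) = 0"
    using ip_self_eq_0[OF True] by (metis ip_cnj complex_cnj_zero)
  ultimately show ?thesis using True by simp
next
  case False
  define a where "a = v m"
  define b where "b = v (Suc m)"
  \<comment> \<open>With this coefficient, \<open>b - c * a\<close> is the residual of
    \<open>b\<close> against \<open>a\<close> alone.\<close>
  define c where "c = ip n b a / ip n a a"
  have a: "Re (ip n a a) > 0" using False ip_self_Re[of n a] unfolding a_def
    by (metis less_eq_real_def of_real_0)
  let ?w = "gs n v (Suc m)"
  \<comment> \<open>\<open>?w\<close> is orthogonal to \<open>b - ?w\<close> and to
    \<open>a\<close>, hence to \<open>(b - c * a) - ?w\<close>; so \<open>?w\<close> is a projection
    of that residual.\<close>
  have "ip n ?w (\<lambda>s. (b s - c * a s) - ?w s) = ip n ?w (\<lambda>s. (b s - ?w s) - c * a s)"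
    by (simp add: algebra_simps)
  also have "\<dots> = 0"
    using gs_self[of n v "Suc m"] gs_orth_span[of m "Suc m" n v]
    unfolding ip_diff_right[of n ?w "\<lambda>s. b s - ?w s"] ip_scale_right by (simp add: a_def b_def)
  finally have "Re (ip n ?w ?w) \<le> Re (ip n (\<lambda>s. b s - c * a s) (\<lambda>s. b s - c * a s))"
    by (rule ip_le_of_orth)
  also have "ip n (\<lambda>s. b s - c * a s) (\<lambda>s. b s - c * a s) = ip n b b - ip n b a * ip n a b / ip n a a"
    using False unfolding c_def a_def[symmetric] ip_diff_left ip_diff_right ip_scale_left ip_scale_right
    by (simp add: field_simps ip_cnj)
  also have "ip n b a * ip n a b = of_real ((cmod (ip n a b))\<^sup>2)"
    using complex_norm_square[of "ip n a b"] by (simp add: ip_cnj mult.commute)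
  also have "ip n a a = of_real (Re (ip n a a))" by (rule ip_self_Re)
  finally have w: "Re (ip n ?w ?w) \<le> Re (ip n b b) - (cmod (ip n a b))\<^sup>2 / Re (ip n a a)"
    by (simp add: Re_divide_of_real flip: of_real_divide)
  have "Re (ip n (gs n v m) (gs n v m)) * Re (ip n ?w ?w) \<le> Re (ip n a a) * Re (ip n ?w ?w)"
    unfolding a_def by (intro mult_right_mono ip_self_Re ip_le_of_orth gs_self)
  also have "\<dots> \<le> Re (ip n a a) * (Re (ip n b b) - (cmod (ip n a b))\<^sup>2 / Re (ip n a a))"
    using w a by (intro mult_left_mono) auto
  also have "\<dots> = Re (ip n a a) * Re (ip n b b) - (cmod (ip n a b))\<^sup>2"
    using a by (simp add: field_simps)
  finally show ?thesis by (simp add: a_def b_def)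
qed

lemma gram_Suc_Suc_le:
  "Re (gram n (Suc (Suc m)) v) \<le> Re (gram n m v) *
     (Re (ip n (v m) (v m)) * Re (ip n (v (Suc m)) (v (Suc m))) - (cmod (ip n (v m) (v (Suc m))))\<^sup>2)"
  using gs_pair_le[of n v m] by (auto simp: Re_gram mult.assoc intro!: mult_left_mono prod_nonneg ip_self_Re)

text \<open>Fischer's inequality for consecutive blocks of two: each factor on the right is the Gram
  determinant of one pair.\<close>

lemma gram_pairs_le:
  "Re (gram n (2 * k) v) \<le> (\<Prod>i<k. Re (ip n (v (2*i)) (v (2*i))) * Re (ip n (v (2*i+1)) (v (2*i+1)))
      - (cmod (ip n (v (2*i)) (v (2*i+1))))\<^sup>2)"
proof (induction k)
  case 0
  show ?case by (simp add: gram_eq_prod)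
next
  case (Suc k)
  have "0 \<le> Re (ip n (v (2*k)) (v (2*k))) * Re (ip n (v (2*k+1)) (v (2*k+1)))
      - (cmod (ip n (v (2*k)) (v (2*k+1))))\<^sup>2"
    using gs_pair_le[of n v "2*k"] mult_nonneg_nonneg[OF ip_self_Re(2)[of n "gs n v (2*k)"]
        ip_self_Re(2)[of n "gs n v (Suc (2*k))"]] by (simp del: mult_nonneg_nonneg)
  then show ?case
    using gram_Suc_Suc_le[of n "2*k" v] mult_right_mono[OF Suc.IH] by (auto intro: order_trans)
qed

section \<open>Determinants of matrices of functions\<close>

lemma fdet_row_scale: "fdet m (\<lambda>i j. c i * A i j) = (\<Prod>i<m. c i) * fdet m A"
  unfolding fdet_altdef by (simp add: prod.distrib sum_distrib_left mult_ac)

lemma fdet_eq_0_of_eq_cols: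
  assumes "i < m" "j < m" "i \<noteq> j" "\<And>k. k < m \<Longrightarrow> A k i = A k j"
  shows "fdet m A = 0"
  unfolding fdet_def
  by (rule det_identical_columns[of _ m i j]) (use assms in \<open>auto intro!: eq_vecI\<close>)

text \<open>Laplace expansion along a row with a single possibly nonzero entry; the index jump at
  \<open>c\<close> skips the deleted column.\<close>

lemma fdet_last_row:
  assumes "c \<le> n" "\<And>k. k \<le> n \<Longrightarrow> k \<noteq> c \<Longrightarrow> A n k = 0"
  shows "fdet (Suc n) A = (-1) ^ (n + c) * A n c * fdet n (\<lambda>i j. A i (if j < c then j else Suc j))"
proof -
  let ?M = "mat (Suc n) (Suc n) (\<lambda>(i, j). A i j)"
  have "fdet (Suc n) A = (\<Sum>j<Suc n. ?M $$ (n, j) * cofactor ?M n j)"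
    unfolding fdet_def by (rule laplace_expansion_row) auto
  also have "\<dots> = (\<Sum>j<Suc n. if j = c then A n c * cofactor ?M n c else 0)"
    using assms by (intro sum.cong) auto
  also have "\<dots> = A n c * cofactor ?M n c" using assms(1) by simp
  also have "mat_delete ?M n c = mat n n (\<lambda>(i, j). A i (if j < c then j else Suc j))"
    using assms(1) by (intro eq_matI) (auto simp: mat_delete_def)
  then have "cofactor ?M n c = (-1) ^ (n + c) * fdet n (\<lambda>i j. A i (if j < c then j else Suc j))"
    by (simp add: cofactor_def fdet_def)
  finally show ?thesis by simp
qed

text \<open>The homogeneous form stays valid when some \<open>u i\<close> is 0, which happens at the
  south pole, where the ratio \<open>w i / u i\<close> would be infinite.\<close>

lemma fdet_vandermonde:
  "fdet n (\<lambda>i k. u i ^ (n - 1 - k) * w i ^ k) = (\<Prod>j<n. \<Prod>i<j. u i * w j - u j * w i)"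
proof (induction n)
  case 0
  show ?case by (simp add: fdet_altdef)
next
  case (Suc n)
  let ?V = "\<lambda>i k. u i ^ (n - k) * w i ^ k"
  show ?case
  proof (cases "u n = 0")
    \<comment> \<open>The last row is 0 except for its final entry \<open>w n ^ n\<close>, and in
      the remaining minor row \<open>i\<close> has the common factor \<open>u i\<close>.\<close>
    case True
    have "fdet (Suc n) ?V = (-1) ^ (n + n) * ?V n n * fdet n (\<lambda>i j. ?V i (if j < n then j else Suc j))"
      using True by (intro fdet_last_row) auto
    also have "fdet n (\<lambda>i j. ?V i (if j < n then j else Suc j)) =
        fdet n (\<lambda>i j. u i * (u i ^ (n - 1 - j) * w i ^ j))"
    proof (rule fdet_cong)
      fix i j assume "j < n"
      then have "n - j = Suc (n - 1 - j)" by simp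
      then show "?V i (if j < n then j else Suc j) = u i * (u i ^ (n - 1 - j) * w i ^ j)"
        using \<open>j < n\<close> by simp
    qed
    also have "\<dots> = (\<Prod>i<n. u i) * (\<Prod>j<n. \<Prod>i<j. u i * w j - u j * w i)"
      unfolding fdet_row_scale Suc.IH ..
    finally show ?thesis using True
      by (simp add: prod.distrib mult_ac flip: power_add)
  next
    case False
    \<comment> \<open>Subtracting \<open>z\<close> times each column from its right neighbour, which
      is multiplication by \<open>U\<close>, clears the last row outside column 0 and produces the
      factor \<open>w i - z * u i\<close> in the other rows.\<close>
    define z where "z = w n / u n"
    define U where "U = mat (Suc n) (Suc n) (\<lambda>(i, j). if i = j then 1 else if j = Suc i then - z else 0)"
    define W where "W = (\<lambda>i k. case k of 0 \<Rightarrow> ?V i 0 | Suc k \<Rightarrow> ?V i (Suc k) - z * ?V i k)"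
    let ?M = "mat (Suc n) (Suc n) (\<lambda>(i, j). ?V i j)"
    have "?M * U = mat (Suc n) (Suc n) (\<lambda>(i, j). W i j)"
    proof (rule eq_matI)
      fix i j assume ij: "i < dim_row (mat (Suc n) (Suc n) (\<lambda>(i, j). W i j))"
        "j < dim_col (mat (Suc n) (Suc n) (\<lambda>(i, j). W i j))"
      have "(?M * U) $$ (i, j) = (\<Sum>k<Suc n. ?V i k * (if k = j then 1 else if j = Suc k then - z else 0))"
        using ij by (simp add: U_def scalar_prod_def atLeast0LessThan del: sum.lessThan_Suc)
      also have "\<dots> = (\<Sum>k<Suc n. if k = j then ?V i k else 0) + (\<Sum>k<Suc n. if j = Suc k then - z * ?V i k else 0)"
        unfolding sum.distrib[symmetric] by (intro sum.cong) auto
      also have "\<dots> = W i j"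
        using ij by (cases j) (auto simp: W_def simp del: sum.lessThan_Suc)
      finally show "(?M * U) $$ (i, j) = mat (Suc n) (Suc n) (\<lambda>(i, j). W i j) $$ (i, j)" using ij by simp
    qed (auto simp: U_def)
    moreover have "det U = 1"
      by (subst det_upper_triangular[of _ "Suc n"]) (auto simp: U_def prod_list_diag_prod)
    moreover have "det (?M * U) = det ?M * det U" by (rule det_mult[of _ "Suc n"]) (auto simp: U_def)
    ultimately have "fdet (Suc n) ?V = fdet (Suc n) W" by (simp add: fdet_def)
    also have "\<dots> = (-1) ^ (n + 0) * W n 0 * fdet n (\<lambda>i j. W i (if j < 0 then j else Suc j))"
    proof (rule fdet_last_row)
      fix k assume "k \<le> n" "k \<noteq> 0"
      then obtain l where l: "k = Suc l" "l < n" by (cases k) auto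
      then have "n - l = Suc (n - Suc l)" by simp
      then show "W n k = 0" using False l by (simp add: W_def z_def)
    qed auto
    also have "fdet n (\<lambda>i j. W i (if j < 0 then j else Suc j)) =
        fdet n (\<lambda>i j. (w i - z * u i) * (u i ^ (n - 1 - j) * w i ^ j))"
    proof (rule fdet_cong)
      fix i j assume "j < n"
      then have "n - j = Suc (n - Suc j)" by simp
      then show "W i (if j < 0 then j else Suc j) = (w i - z * u i) * (u i ^ (n - 1 - j) * w i ^ j)"
        by (simp add: W_def algebra_simps)
    qed
    also have "\<dots> = (\<Prod>i<n. w i - z * u i) * (\<Prod>j<n. \<Prod>i<j. u i * w j - u j * w i)"
      unfolding fdet_row_scale Suc.IH ..
    also have "(-1) ^ (n + 0) * W n 0 * ((\<Prod>i<n. w i - z * u i) * X) =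
        (\<Prod>i<n. u i * w n - u n * w i) * X" for X
    proof -
      \<comment> \<open>One factor \<open>- u n\<close> for each of the n remaining rows; it clears
        the denominator of \<open>z\<close>.\<close>
      have "(-1) ^ (n + 0) * W n 0 = (\<Prod>i<n. - u n)"
        by (simp add: W_def flip: power_mult_distrib)
      then have "(-1) ^ (n + 0) * W n 0 * (\<Prod>i<n. w i - z * u i) = (\<Prod>i<n. - u n * (w i - z * u i))"
        by (simp only: prod.distrib)
      also have "\<dots> = (\<Prod>i<n. u i * w n - u n * w i)"
        using False by (intro prod.cong) (auto simp: z_def field_simps)
      finally show ?thesis by (simp add: mult.assoc)
    qed
    finally show ?thesis by (simp add: mult_ac)
  qed
qed

lemma fdet_2: "fdet 2 A = A 0 0 * A 1 1 - A 0 1 * A 1 0"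
proof -
  let ?M = "mat 2 2 (\<lambda>(i, j). A i j)"
  have "fdet 2 A = (\<Sum>j<2. ?M $$ (0, j) * cofactor ?M 0 j)"
    unfolding fdet_def by (rule laplace_expansion_row) auto
  also have "\<dots> = A 0 0 * cofactor ?M 0 0 + A 0 1 * cofactor ?M 0 1"
    by (simp add: numeral_2_eq_2)
  also have "cofactor ?M 0 0 = A 1 1"
    unfolding cofactor_def by (subst det_single) (auto simp: mat_delete_def)
  also have "cofactor ?M 0 1 = - A 1 0"
    unfolding cofactor_def by (subst det_single) (auto simp: mat_delete_def)
  finally show ?thesis by simp
qed

lemma fdet_blocks:
  "fdet (2 * k) (\<lambda>i j. if i div 2 = j div 2 then A i j else 0) =
    (\<Prod>i<k. A (2*i) (2*i) * A (2*i+1) (2*i+1) - A (2*i) (2*i+1) * A (2*i+1) (2*i))"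
proof (induction k)
  case 0
  show ?case by (simp add: fdet_altdef)
next
  case (Suc k)
  let ?B = "\<lambda>i j. if i div 2 = j div 2 then A i j else 0"
  have "mat (2 * Suc k) (2 * Suc k) (\<lambda>(i, j). ?B i j) =
    four_block_mat (mat (2*k) (2*k) (\<lambda>(i, j). ?B i j)) (0\<^sub>m (2*k) 2) (0\<^sub>m 2 (2*k))
     (mat 2 2 (\<lambda>(i, j). A (2*k+i) (2*k+j)))" (is "_ = ?F")
  proof (rule eq_matI)
    fix i j assume "i < dim_row ?F" "j < dim_col ?F"
    then have "i < 2*k \<or> i = 2*k \<or> i = 2*k+1" "j < 2*k \<or> j = 2*k \<or> j = 2*k+1" by auto
    then show "mat (2 * Suc k) (2 * Suc k) (\<lambda>(i, j). ?B i j) $$ (i, j) = ?F $$ (i, j)"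
      by (elim disjE) auto
  qed auto
  then have "fdet (2 * Suc k) ?B = det (four_block_mat (mat (2*k) (2*k) (\<lambda>(i, j). ?B i j)) (0\<^sub>m (2*k) 2) (0\<^sub>m 2 (2*k))
     (mat 2 2 (\<lambda>(i, j). A (2*k+i) (2*k+j))))" by (simp only: fdet_def)
  also have "\<dots> = fdet (2*k) ?B * fdet 2 (\<lambda>i j. A (2*k+i) (2*k+j))"
    unfolding fdet_def by (rule det_four_block_mat_upper_right_zero) auto
  also have "fdet 2 (\<lambda>i j. A (2*k+i) (2*k+j)) = A (2*k) (2*k) * A (2*k+1) (2*k+1) - A (2*k) (2*k+1) * A (2*k+1) (2*k)"
    by (simp add: fdet_2)
  finally show ?case using Suc.IH by simp
qed

text \<open>Expand over permutations. One that preserves the labels \<open>b\<close> contributes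
  equally to both determinants; any other contributes 0 to the block determinant and has at least
  one small factor in the full one.\<close>

lemma norm_fdet_diff_le:
  assumes A: "\<And>i j. i < m \<Longrightarrow> j < m \<Longrightarrow> cmod (A i j) \<le> c"
    and eps: "\<And>i j. i < m \<Longrightarrow> j < m \<Longrightarrow> b i \<noteq> b j \<Longrightarrow> cmod (A i j) \<le> c * \<epsilon>"
    and "c \<ge> 0" "0 \<le> \<epsilon>"
  shows "cmod (fdet m A - fdet m (\<lambda>i j. if b i = b j then A i j else 0)) \<le> fact m * (c ^ m * \<epsilon>)"
proof -
  let ?B = "\<lambda>i j. if b i = b j then A i j else 0"
  have 1: "cmod ((\<Prod>i<m. A i (\<pi> i)) - (\<Prod>i<m. ?B i (\<pi> i))) \<le> c ^ m * \<epsilon>" if \<pi>: "\<pi> permutes {..<m}" for \<pi>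
  proof (cases "\<exists>i<m. b i \<noteq> b (\<pi> i)")
    case True
    then obtain i0 where i0: "i0 < m" "b i0 \<noteq> b (\<pi> i0)" by auto
    have \<pi>m: "\<pi> i < m" if "i < m" for i using permutes_in_image[OF \<pi>, of i] that by simp
    have "(\<Prod>i<m. ?B i (\<pi> i)) = 0" using i0 by (intro prod_zero) auto
    moreover have "cmod (\<Prod>i<m. A i (\<pi> i)) = cmod (A i0 (\<pi> i0)) * (\<Prod>i\<in>{..<m} - {i0}. cmod (A i (\<pi> i)))"
      unfolding prod_norm[symmetric] using i0 by (intro prod.remove) auto
    moreover have "\<dots> \<le> c * \<epsilon> * (\<Prod>i\<in>{..<m} - {i0}. c)"
      using i0 \<pi>m assms by (intro mult_mono prod_mono eps prod_nonneg mult_nonneg_nonneg) auto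
    moreover have "c * \<epsilon> * (\<Prod>i\<in>{..<m} - {i0}. c) = c ^ m * \<epsilon>"
      using i0 by (cases m) (auto simp: card_Diff_subset)
    ultimately show ?thesis by (simp del: prod_zero_iff prod_constant)
  next
    case False
    then have "(\<Prod>i<m. A i (\<pi> i)) = (\<Prod>i<m. ?B i (\<pi> i))" by (intro prod.cong) auto
    then show ?thesis using assms by simp
  qed
  have "fdet m A - fdet m ?B =
     (\<Sum>\<pi> | \<pi> permutes {..<m}. of_int (sign \<pi>) * ((\<Prod>i<m. A i (\<pi> i)) - (\<Prod>i<m. ?B i (\<pi> i))))"
    unfolding fdet_altdef by (simp add: sum_subtractf right_diff_distrib)
  also have "cmod \<dots> \<le> (\<Sum>\<pi> | \<pi> permutes {..<m}. c ^ m * \<epsilon>)"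
    using 1 by (intro sum_norm_le) (auto simp: norm_mult sign_def)
  also have "\<dots> = fact m * (c ^ m * \<epsilon>)"
    by (simp add: card_permutations[of "{..<m}" m])
  finally show ?thesis .
qed

section \<open>Permutations with prescribed values and the sum behind the correlation
  functions\<close>

lemma extend_inj_to_permutation:
  fixes s :: "nat \<Rightarrow> nat"
  assumes "inj_on s {..<m}" "s ` {..<m} \<subseteq> {..<n}"
  obtains \<sigma> where "\<sigma> permutes {..<n}" "\<And>i. i < m \<Longrightarrow> \<sigma> i = s i"
proof -
  have mn: "m \<le> n" using card_inj_on_le[OF assms finite_lessThan] by simp
  have "card ({..<n} - s ` {..<m}) = card {m..<n}"
    using assms by (subst card_Diff_subset) (auto simp: card_image)
  then obtain g where g: "bij_betw g {m..<n} ({..<n} - s ` {..<m})"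
    by (metis finite_same_card_bij finite_atLeastLessThan finite_Diff finite_lessThan)
  define \<sigma> where "\<sigma> i = (if i < m then s i else if i < n then g i else i)" for i
  have "bij_betw \<sigma> ({..<m} \<union> {m..<n}) (s ` {..<m} \<union> ({..<n} - s ` {..<m}))"
  proof (rule bij_betw_combine)
    show "bij_betw \<sigma> {..<m} (s ` {..<m})"
      using assms(1) by (subst bij_betw_cong[where g = s]) (auto simp: \<sigma>_def inj_on_imp_bij_betw)
    show "bij_betw \<sigma> {m..<n} ({..<n} - s ` {..<m})"
      using g by (subst bij_betw_cong[where g = g]) (auto simp: \<sigma>_def)
  qed auto
  moreover have "{..<m} \<union> {m..<n} = {..<n}" using mn by auto
  moreover have "s ` {..<m} \<union> ({..<n} - s ` {..<m}) = {..<n}" using assms(2) by auto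
  ultimately have "bij_betw \<sigma> {..<n} {..<n}" by simp
  then have "\<sigma> permutes {..<n}" using mn by (intro bij_imp_permutes) (auto simp: \<sigma>_def)
  then show ?thesis using that[of \<sigma>] by (auto simp: \<sigma>_def)
qed

text \<open>This set is the left coset of \<sigma> modulo the permutations of
  \<open>A\<close>.\<close>

lemma permutations_agreeing_outside:
  assumes "A \<subseteq> S" "\<sigma> permutes S"
  shows "{\<tau>. \<tau> permutes S \<and> (\<forall>i\<in>S - A. \<tau> i = \<sigma> i)} = (\<lambda>\<pi>. \<sigma> \<circ> \<pi>) ` {\<pi>. \<pi> permutes A}"
proof (intro equalityI subsetI)
  fix \<tau> assume "\<tau> \<in> {\<tau>. \<tau> permutes S \<and> (\<forall>i\<in>S - A. \<tau> i = \<sigma> i)}"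
  then have \<tau>: "\<tau> permutes S" "\<And>i. i \<in> S - A \<Longrightarrow> \<tau> i = \<sigma> i" by auto
  have "(inv_into UNIV \<sigma> \<circ> \<tau>) permutes S" by (rule permutes_compose[OF \<tau>(1) permutes_inv[OF assms(2)]])
  moreover have "(inv_into UNIV \<sigma> \<circ> \<tau>) i = i" if "i \<in> S - A" for i
    using \<tau>(2)[OF that] permutes_inverses(2)[OF assms(2), of i] by (simp only: o_apply)
  ultimately have "(inv_into UNIV \<sigma> \<circ> \<tau>) permutes A" by (rule permutes_superset) auto
  moreover have "\<tau> = \<sigma> \<circ> (inv_into UNIV \<sigma> \<circ> \<tau>)" using permutes_inverses(1)[OF assms(2)] by auto
  ultimately show "\<tau> \<in> (\<lambda>\<pi>. \<sigma> \<circ> \<pi>) ` {\<pi>. \<pi> permutes A}" by blast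
next
  fix \<tau> assume "\<tau> \<in> (\<lambda>\<pi>. \<sigma> \<circ> \<pi>) ` {\<pi>. \<pi> permutes A}"
  then obtain \<pi> where \<pi>: "\<tau> = \<sigma> \<circ> \<pi>" "\<pi> permutes A" by auto
  have "\<tau> permutes S"
    unfolding \<pi>(1) by (rule permutes_compose[OF permutes_subset[OF \<pi>(2) assms(1)] assms(2)])
  moreover have "\<tau> i = \<sigma> i" if "i \<notin> A" for i
    using permutes_not_in[OF \<pi>(2) that] by (simp add: \<pi>(1))
  ultimately show "\<tau> \<in> {\<tau>. \<tau> permutes S \<and> (\<forall>i\<in>S - A. \<tau> i = \<sigma> i)}" by auto
qed

lemma inj_comp_permutation: "\<sigma> permutes S \<Longrightarrow> inj_on (\<lambda>\<pi>. \<sigma> \<circ> \<pi>) A"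
  by (rule inj_onI) (metis comp_assoc permutes_inv_o(2) id_comp)

text \<open>Every injective choice of the first m values extends to a permutation in
  \<open>fact (n - m)\<close> ways, and \<open>f\<close> sees only those values.\<close>

lemma sum_over_permutations_head:
  fixes f :: "(nat \<Rightarrow> nat) \<Rightarrow> complex"
  assumes "m \<le> n" and f: "\<And>s s'. (\<And>i. i < m \<Longrightarrow> s i = s' i) \<Longrightarrow> f s = f s'"
  shows "(\<Sum>\<sigma> | \<sigma> permutes {..<n}. f \<sigma>) =
     fact (n - m) * (\<Sum>s | s \<in> {..<m} \<rightarrow>\<^sub>E {..<n} \<and> inj_on s {..<m}. f s)"
proof -
  let ?T = "{s. s \<in> {..<m} \<rightarrow>\<^sub>E {..<n} \<and> inj_on s {..<m}}"
  have "(\<Sum>\<sigma> | \<sigma> permutes {..<n}. f \<sigma>) =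
     (\<Sum>s\<in>?T. \<Sum>\<sigma>\<in>{\<sigma>\<in>{\<sigma>. \<sigma> permutes {..<n}}. restrict \<sigma> {..<m} = s}. f \<sigma>)"
  proof (rule sum.group[symmetric])
    show "(\<lambda>\<sigma>. restrict \<sigma> {..<m}) ` {\<sigma>. \<sigma> permutes {..<n}} \<subseteq> ?T"
    proof (rule image_subsetI)
      fix \<sigma> :: "nat \<Rightarrow> nat" assume "\<sigma> \<in> {\<sigma>. \<sigma> permutes {..<n}}"
      then have \<sigma>: "\<sigma> permutes {..<n}" by simp
      have "\<sigma> i < n" if "i < m" for i
        using permutes_in_image[OF \<sigma>, of i] assms(1) that by simp
      moreover have "inj_on \<sigma> {..<m}" by (rule permutes_inj_on[OF \<sigma>])
      ultimately show "restrict \<sigma> {..<m} \<in> ?T" by (auto simp: inj_on_restrict_eq)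
    qed
    show "finite ?T" by (rule finite_subset[of _ "{..<m} \<rightarrow>\<^sub>E {..<n}"]) (auto intro: finite_PiE)
  qed (simp add: finite_permutations)
  also have "\<dots> = (\<Sum>s\<in>?T. fact (n - m) * f s)"
  proof (intro sum.cong refl)
    fix s assume s: "s \<in> ?T"
    then have "inj_on s {..<m}" "s ` {..<m} \<subseteq> {..<n}" by auto
    then obtain \<sigma>\<^sub>0 where \<sigma>\<^sub>0: "\<sigma>\<^sub>0 permutes {..<n}" "\<And>i. i < m \<Longrightarrow> \<sigma>\<^sub>0 i = s i"
      using extend_inj_to_permutation[of s m n] by blast
    have eq: "{\<sigma>\<in>{\<sigma>. \<sigma> permutes {..<n}}. restrict \<sigma> {..<m} = s} = {\<sigma>. \<sigma> permutes {..<n} \<and> (\<forall>i<m. \<sigma> i = \<sigma>\<^sub>0 i)}"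
    proof -
      have "restrict \<sigma> {..<m} = s \<longleftrightarrow> (\<forall>i<m. \<sigma> i = \<sigma>\<^sub>0 i)" for \<sigma>
      proof
        assume "restrict \<sigma> {..<m} = s"
        then show "\<forall>i<m. \<sigma> i = \<sigma>\<^sub>0 i" using \<sigma>\<^sub>0(2) by auto
      next
        assume "\<forall>i<m. \<sigma> i = \<sigma>\<^sub>0 i"
        then show "restrict \<sigma> {..<m} = s"
          using s \<sigma>\<^sub>0(2) by (intro extensionalityI[of _ "{..<m}"]) (auto simp: PiE_iff)
      qed
      then show ?thesis by auto
    qed
    have diff_head: "{..<n} - {m..<n} = {..<m}" and sub: "{m..<n} \<subseteq> {..<n}" using assms(1) by auto
    have same_head: "{\<sigma>. \<sigma> permutes {..<n} \<and> (\<forall>i<m. \<sigma> i = \<sigma>\<^sub>0 i)} = (\<lambda>\<pi>. \<sigma>\<^sub>0 \<circ> \<pi>) ` {\<pi>. \<pi> permutes {m..<n}}"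
      using permutations_agreeing_outside[OF sub \<sigma>\<^sub>0(1)]
      by (simp add: diff_head Ball_def)
    have "card {\<sigma>. \<sigma> permutes {..<n} \<and> (\<forall>i<m. \<sigma> i = \<sigma>\<^sub>0 i)} = fact (n - m)"
      unfolding same_head
      by (subst card_image[OF inj_comp_permutation[OF \<sigma>\<^sub>0(1)]]) (simp add: card_permutations)
    moreover have "f \<sigma> = f s" if "\<sigma> \<in> {\<sigma>. \<sigma> permutes {..<n} \<and> (\<forall>i<m. \<sigma> i = \<sigma>\<^sub>0 i)}" for \<sigma>
      using that \<sigma>\<^sub>0(2) by (intro f) auto
    ultimately show "(\<Sum>\<sigma>\<in>{\<sigma>\<in>{\<sigma>. \<sigma> permutes {..<n}}. restrict \<sigma> {..<m} = s}. f \<sigma>) = fact (n - m) * f s"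
      unfolding eq by simp
  qed
  finally show ?thesis by (simp add: sum_distrib_left)
qed

text \<open>After integrating out the coordinates \<open>i \<ge> m\<close>, orthonormality leaves the permutations agreeing there;
  non-injective index maps may be added back as they contribute \<open>0\<close> by antisymmetry.\<close>

lemma gaudin_sum:
  fixes e :: "nat \<Rightarrow> nat \<Rightarrow> complex"
  assumes "m \<le> n"
  shows "(\<Sum>\<sigma> | \<sigma> permutes {..<n}. \<Sum>\<tau> | \<tau> permutes {..<n} \<and> (\<forall>i\<in>{m..<n}. \<sigma> i = \<tau> i).
      of_int (sign \<sigma>) * of_int (sign \<tau>) * (\<Prod>i<m. e (\<sigma> i) i * cnj (e (\<tau> i) i))) =
    fact (n - m) * fdet m (\<lambda>i j. \<Sum>s<n. e s i * cnj (e s j))"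
proof -
  \<comment> \<open>The inner sum after the substitution
    \<open>\<tau> = \<sigma> \<circ> \<pi>\<close> with \<pi> moving only the first m indices; the
    sign of \<sigma> then occurs twice and cancels.\<close>
  define \<Theta> where "\<Theta> s = (\<Sum>\<pi> | \<pi> permutes {..<m}. of_int (sign \<pi>) * (\<Prod>i<m. e (s i) i * cnj (e (s (\<pi> i)) i)))"
    for s :: "nat \<Rightarrow> nat"
  have perm_lt: "\<pi> i < m" if "\<pi> permutes {..<m}" "i < m" for \<pi> i
    using permutes_in_image[OF that(1), of i] that(2) by simp
  have "(\<Sum>\<sigma> | \<sigma> permutes {..<n}. \<Sum>\<tau> | \<tau> permutes {..<n} \<and> (\<forall>i\<in>{m..<n}. \<sigma> i = \<tau> i).
      of_int (sign \<sigma>) * of_int (sign \<tau>) * (\<Prod>i<m. e (\<sigma> i) i * cnj (e (\<tau> i) i))) =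
     (\<Sum>\<sigma> | \<sigma> permutes {..<n}. \<Theta> \<sigma>)"
  proof (intro sum.cong refl)
    fix \<sigma> assume "\<sigma> \<in> {\<sigma>. \<sigma> permutes {..<n}}"
    then have \<sigma>: "\<sigma> permutes {..<n}" by simp
    have diff_tail: "{..<n} - {..<m} = {m..<n}" by auto
    have same_tail: "{\<tau>. \<tau> permutes {..<n} \<and> (\<forall>i\<in>{m..<n}. \<sigma> i = \<tau> i)} = (\<lambda>\<pi>. \<sigma> \<circ> \<pi>) ` {\<pi>. \<pi> permutes {..<m}}"
      using permutations_agreeing_outside[of "{..<m}" "{..<n}", OF _ \<sigma>] assms
      by (simp only: diff_tail lessThan_subset_iff eq_commute[of "\<sigma> _"])
    have "of_int (sign \<sigma>) * of_int (sign (\<sigma> \<circ> \<pi>)) = (of_int (sign \<pi>) :: complex)"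
      if "\<pi> permutes {..<m}" for \<pi>
    proof -
      have "sign (\<sigma> \<circ> \<pi>) = sign \<sigma> * sign \<pi>"
        using \<sigma> that by (intro sign_compose permutes_imp_permutation[of "{..<n}"] permutes_imp_permutation[of "{..<m}"]) auto
      then show ?thesis by (simp add: sign_def)
    qed
    then show "(\<Sum>\<tau> | \<tau> permutes {..<n} \<and> (\<forall>i\<in>{m..<n}. \<sigma> i = \<tau> i).
      of_int (sign \<sigma>) * of_int (sign \<tau>) * (\<Prod>i<m. e (\<sigma> i) i * cnj (e (\<tau> i) i))) = \<Theta> \<sigma>"
      unfolding same_tail \<Theta>_def
      by (subst sum.reindex[OF inj_comp_permutation[OF \<sigma>]]) (auto intro!: sum.cong)
  qed
  also have "\<dots> = fact (n - m) * (\<Sum>s | s \<in> {..<m} \<rightarrow>\<^sub>E {..<n} \<and> inj_on s {..<m}. \<Theta> s)"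
  proof (rule sum_over_permutations_head[OF assms])
    fix s s' :: "nat \<Rightarrow> nat" assume "\<And>i. i < m \<Longrightarrow> s i = s' i"
    then have "(\<Prod>i<m. e (s i) i * cnj (e (s (\<pi> i)) i)) = (\<Prod>i<m. e (s' i) i * cnj (e (s' (\<pi> i)) i))"
      if "\<pi> permutes {..<m}" for \<pi> using perm_lt[OF that] by (intro prod.cong) auto
    then show "\<Theta> s = \<Theta> s'" unfolding \<Theta>_def by (intro sum.cong) auto
  qed
  also have "(\<Sum>s | s \<in> {..<m} \<rightarrow>\<^sub>E {..<n} \<and> inj_on s {..<m}. \<Theta> s) = (\<Sum>s\<in>{..<m} \<rightarrow>\<^sub>E {..<n}. \<Theta> s)"
  proof (intro sum.mono_neutral_left ballI)
    show "finite ({..<m} \<rightarrow>\<^sub>E {..<n})" by (auto intro: finite_PiE)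
    fix s assume "s \<in> ({..<m} \<rightarrow>\<^sub>E {..<n}) - {s. s \<in> {..<m} \<rightarrow>\<^sub>E {..<n} \<and> inj_on s {..<m}}"
    then obtain i j where "i < m" "j < m" "i \<noteq> j" "s i = s j" by (auto simp: inj_on_def)
    then have "fdet m (\<lambda>i j. cnj (e (s j) i)) = 0" by (intro fdet_eq_0_of_eq_cols[of i m j]) auto
    moreover have "\<Theta> s = (\<Prod>i<m. e (s i) i) * fdet m (\<lambda>i j. cnj (e (s j) i))"
      unfolding \<Theta>_def fdet_altdef by (simp add: prod.distrib sum_distrib_left mult_ac)
    ultimately show "\<Theta> s = 0" by simp
  qed auto
  also have "(\<Sum>s\<in>{..<m} \<rightarrow>\<^sub>E {..<n}. \<Theta> s) = (\<Sum>\<pi> | \<pi> permutes {..<m}. of_int (sign \<pi>) *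
     (\<Sum>s\<in>{..<m} \<rightarrow>\<^sub>E {..<n}. \<Prod>i<m. e (s i) i * cnj (e (s (\<pi> i)) i)))"
    unfolding \<Theta>_def by (subst sum.swap) (simp add: sum_distrib_left)
  \<comment> \<open>Reindexing the conjugated factors by the inverse makes the factor at
    \<open>i\<close> depend on \<open>s\<close> through \<open>s i\<close> only, so the sum over all
    maps \<open>s\<close> becomes a product of sums.\<close>
  also have "\<dots> = (\<Sum>\<pi> | \<pi> permutes {..<m}. of_int (sign (inv_into UNIV \<pi>)) * (\<Prod>i<m. \<Sum>s<n. e s i * cnj (e s (inv_into UNIV \<pi> i))))"
  proof (intro sum.cong refl)
    fix \<pi> assume "\<pi> \<in> {\<pi>. \<pi> permutes {..<m}}"
    then have \<pi>: "\<pi> permutes {..<m}" by simp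
    have "(\<Prod>i<m. e (s i) i * cnj (e (s (\<pi> i)) i)) = (\<Prod>i<m. e (s i) i * cnj (e (s i) (inv_into UNIV \<pi> i)))" for s
    proof -
      have "(\<Prod>i<m. cnj (e (s i) (inv_into UNIV \<pi> i))) = (\<Prod>i<m. cnj (e (s (\<pi> i)) i))"
        by (subst prod.permute[OF \<pi>]) (simp add: permutes_inverses(2)[OF \<pi>] o_def)
      then show ?thesis by (simp only: prod.distrib)
    qed
    moreover have "sign (inv_into UNIV \<pi>) = sign \<pi>"
      using \<pi> by (intro sign_inverse permutes_imp_permutation[of "{..<m}"]) auto
    ultimately show "of_int (sign \<pi>) * (\<Sum>s\<in>{..<m} \<rightarrow>\<^sub>E {..<n}. \<Prod>i<m. e (s i) i * cnj (e (s (\<pi> i)) i)) =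
      of_int (sign (inv_into UNIV \<pi>)) * (\<Prod>i<m. \<Sum>s<n. e s i * cnj (e s (inv_into UNIV \<pi> i)))"
      by (subst prod_sum_PiE) auto
  qed
  also have "\<dots> = fdet m (\<lambda>i j. \<Sum>s<n. e s i * cnj (e s j))"
    unfolding fdet_altdef by (rule sum_permutations_inverse[symmetric])
  finally show ?thesis .
qed

section \<open>Spinor coordinates and the reproducing kernel\<close>

text \<open>Homogeneous coordinates \<open>(cos (\<theta>/2), sin (\<theta>/2) * cis \<phi>)\<close> of the stereographic projection;
  the second is set to \<open>1\<close> at the south pole, so that the identities below hold at every point.\<close>

definition sp1 :: "real^3 \<Rightarrow> complex" where
  "sp1 p = of_real (sqrt ((1 + vec_nth p 3) / 2))"

definition sp2 :: "real^3 \<Rightarrow> complex" where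
  "sp2 p = (if vec_nth p 3 = -1 then 1 else Complex (vec_nth p 1) (vec_nth p 2) / of_real (sqrt (2 * (1 + vec_nth p 3))))"

lemma S2_iff: "p \<in> S2 \<longleftrightarrow> (vec_nth p 1)\<^sup>2 + (vec_nth p 2)\<^sup>2 + (vec_nth p 3)\<^sup>2 = 1"
  by (simp add: norm_vec_def L2_set_def sum_3)

lemma S2_coord_bound: "p \<in> S2 \<Longrightarrow> \<bar>vec_nth p i\<bar> \<le> 1"
  using component_le_norm_cart[of p i] by simp

lemma dist_sq_S2:
  assumes "p \<in> S2" "q \<in> S2"
  shows "(dist p q)\<^sup>2 = 2 - 2 * (vec_nth p 1 * vec_nth q 1 + vec_nth p 2 * vec_nth q 2 + vec_nth p 3 * vec_nth q 3)"
proof -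
  have "(dist p q)\<^sup>2 = (vec_nth p 1 - vec_nth q 1)\<^sup>2 + (vec_nth p 2 - vec_nth q 2)\<^sup>2 + (vec_nth p 3 - vec_nth q 3)\<^sup>2"
    by (simp add: dist_norm norm_vec_def L2_set_def sum_3)
  then show ?thesis using assms unfolding S2_iff by (simp add: power2_diff)
qed

lemma sp1_norm: "p \<in> S2 \<Longrightarrow> (cmod (sp1 p))\<^sup>2 = (1 + vec_nth p 3) / 2"
  using S2_coord_bound[of p 3] by (simp add: sp1_def)

lemma sp2_norm:
  assumes "p \<in> S2"
  shows "(cmod (sp2 p))\<^sup>2 = (1 - vec_nth p 3) / 2"
proof (cases "vec_nth p 3 = -1")
  case False
  then have z: "1 + vec_nth p 3 > 0" using S2_coord_bound[OF assms, of 3] by linarith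
  have "(vec_nth p 1)\<^sup>2 + (vec_nth p 2)\<^sup>2 = (1 - vec_nth p 3) * (1 + vec_nth p 3)"
    using assms unfolding S2_iff by (simp add: algebra_simps power2_eq_square)
  then have "(cmod (sp2 p))\<^sup>2 = (1 - vec_nth p 3) * (1 + vec_nth p 3) / (2 * (1 + vec_nth p 3))"
    using False z by (simp add: sp2_def norm_divide power_divide cmod_power2)
  also have "\<dots> = (1 - vec_nth p 3) / 2"
    by (rule nonzero_mult_divide_mult_cancel_right) (use z in simp)
  finally show ?thesis .
qed (simp add: sp2_def)

text \<open>The squared overlap of two unit spinors is (1 + p . q) / 2, and on the sphere the
  squared distance is 2 - 2 p . q.\<close>

lemma spinor_inner:
  assumes p: "p \<in> S2" and q: "q \<in> S2"
  shows "(cmod (sp1 p * cnj (sp1 q) + sp2 p * cnj (sp2 q)))\<^sup>2 = 1 - (dist p q)\<^sup>2 / 4"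
proof (cases "vec_nth p 3 = -1 \<or> vec_nth q 3 = -1")
  case True
  \<comment> \<open>At the south pole \<open>sp1\<close> is 0 and \<open>sp2\<close> is 1, so the
    overlap reduces to \<open>sp2 p\<close>; the other pole case follows by conjugation.\<close>
  have *: "(cmod (sp1 p * cnj (sp1 q) + sp2 p * cnj (sp2 q)))\<^sup>2 = 1 - (dist p q)\<^sup>2 / 4"
    if p: "p \<in> S2" and q: "q \<in> S2" and z: "vec_nth q 3 = -1" for p q
  proof -
    have "(vec_nth q 1)\<^sup>2 + (vec_nth q 2)\<^sup>2 = 0" using q z unfolding S2_iff by simp
    then have "vec_nth q 1 = 0" "vec_nth q 2 = 0" by (simp_all add: sum_power2_eq_zero_iff)
    then show ?thesis using z sp2_norm[OF p] unfolding dist_sq_S2[OF p q]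
      by (simp add: sp1_def sp2_def[of q] field_simps)
  qed
  from True show ?thesis
  proof
    assume "vec_nth p 3 = -1"
    from *[OF q p this] have "(cmod (cnj (sp1 q * cnj (sp1 p) + sp2 q * cnj (sp2 p))))\<^sup>2 = 1 - (dist p q)\<^sup>2 / 4"
      by (simp add: dist_commute del: complex_cnj_add complex_cnj_mult)
    then show ?thesis by (simp add: mult.commute)
  qed (use *[OF p q] in auto)
next
  case False
  \<comment> \<open>In terms of \<open>a\<close>, the spinor of \<open>p\<close> is (sqrt(a/2), (x +
    iy)/sqrt(2a)), so only the root of \<open>a * b\<close> survives in the overlap.\<close>
  define a b where "a = 1 + vec_nth p 3" and "b = 1 + vec_nth q 3"
  define x y x' y' where "x = vec_nth p 1" and "y = vec_nth p 2" and "x' = vec_nth q 1" and "y' = vec_nth q 2"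
  have ab: "a > 0" "b > 0"
    using S2_coord_bound[OF p, of 3] S2_coord_bound[OF q, of 3] False by (auto simp: a_def b_def abs_le_iff)
  have sq: "x\<^sup>2 + y\<^sup>2 = a * (2 - a)" "x'\<^sup>2 + y'\<^sup>2 = b * (2 - b)"
    using p q unfolding S2_iff a_def b_def x_def y_def x'_def y'_def by (simp_all add: algebra_simps power2_eq_square)
  let ?r = "sqrt (a * b)"
  have r: "?r > 0" "?r * ?r = a * b" using ab by simp_all
  have eq: "sp1 p * cnj (sp1 q) + sp2 p * cnj (sp2 q) =
      of_real (?r / 2) + Complex x y * cnj (Complex x' y') / of_real (2 * ?r)"
  proof -
    have 2: "sqrt (2 * a) * sqrt (2 * b) = 2 * ?r" by (simp add: real_sqrt_mult)
    have "sp1 p * cnj (sp1 q) = of_real (sqrt (a / 2) * sqrt (b / 2))" by (simp add: sp1_def a_def b_def)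
    also have "sqrt (a / 2) * sqrt (b / 2) = ?r / 2"
      by (simp add: real_sqrt_divide real_sqrt_mult)
    finally have 3: "sp1 p * cnj (sp1 q) = of_real (?r / 2)" .
    have "sp2 p * cnj (sp2 q) = Complex x y * cnj (Complex x' y') / of_real (sqrt (2 * a) * sqrt (2 * b))"
      using False by (simp add: sp2_def a_def b_def x_def y_def x'_def y'_def)
    then show ?thesis unfolding 2 3 by simp
  qed
  have "of_real (?r / 2) + Complex x y * cnj (Complex x' y') / of_real (2 * ?r) =
     Complex (a * b + (x * x' + y * y')) (y * x' - x * y') / of_real (2 * ?r)"
  proof -
    have "?r / 2 + X / (2 * ?r) = (a * b + X) / (2 * ?r)" for X
    proof -
      have "r / 2 + X / (2 * r) = (c + X) / (2 * r)" if "r > 0" "r * r = c" for r c :: real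
        using that by (auto simp: field_simps)
      then show ?thesis using r by blast
    qed
    then show ?thesis by (simp add: complex_eq_iff add_divide_distrib)
  qed
  also have "(cmod \<dots>)\<^sup>2 = ((a * b + (x * x' + y * y'))\<^sup>2 + (y * x' - x * y')\<^sup>2) / (4 * (a * b))"
    using ab by (simp add: norm_divide power_divide cmod_power2 power_mult_distrib)
  also have "(a * b + (x * x' + y * y'))\<^sup>2 + (y * x' - x * y')\<^sup>2 =
      (a * b)\<^sup>2 + 2 * (a * b) * (x * x' + y * y') + (x\<^sup>2 + y\<^sup>2) * (x'\<^sup>2 + y'\<^sup>2)"
    by (simp add: power2_eq_square algebra_simps)
  also have "\<dots> = (4 * (a * b)) * (1 - (2 - 2 * (x * x' + y * y' + (a - 1) * (b - 1))) / 4)"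
    unfolding sq by (simp add: power2_eq_square field_simps)
  also have "\<dots> / (4 * (a * b)) = 1 - (2 - 2 * (x * x' + y * y' + (a - 1) * (b - 1))) / 4"
    using ab by simp
  finally show ?thesis unfolding eq dist_sq_S2[OF p q] by (simp add: a_def b_def x_def y_def x'_def y'_def)
qed

text \<open>Lagrange's identity for unit spinors: squared overlap and squared 2x2 determinant add up
  to 1.\<close>

lemma spinor_cross:
  assumes p: "p \<in> S2" and q: "q \<in> S2"
  shows "(cmod (sp1 p * sp2 q - sp1 q * sp2 p))\<^sup>2 = (dist p q)\<^sup>2 / 4"
proof -
  have lagrange: "(cmod (a * cnj c + b * cnj d))\<^sup>2 + (cmod (a * d - c * b))\<^sup>2 =
     ((cmod a)\<^sup>2 + (cmod b)\<^sup>2) * ((cmod c)\<^sup>2 + (cmod d)\<^sup>2)" for a b c d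
    unfolding cmod_power2 by (simp add: power2_eq_square algebra_simps)
  have 1: "(cmod (sp1 p))\<^sup>2 + (cmod (sp2 p))\<^sup>2 = 1" if "p \<in> S2" for p
    using that by (simp add: sp1_norm sp2_norm field_simps)
  show ?thesis
    using lagrange[of "sp1 p" "sp1 q" "sp2 p" "sp2 q"] spinor_inner[OF p q] 1[OF p] 1[OF q] by simp
qed

text \<open>Monomials of degree \<open>n - 1\<close> in the spinor. The constant is the reciprocal
  of their norm, a Beta integral; binomial weights also make the kernel a power of the
  overlap.\<close>

definition basis_fun :: "nat \<Rightarrow> nat \<Rightarrow> real^3 \<Rightarrow> complex" where
  "basis_fun n k p = of_real (sqrt (n * ((n - 1) choose k) / (4 * pi))) * (sp1 p ^ (n - 1 - k) * sp2 p ^ k)"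

definition ker :: "nat \<Rightarrow> real^3 \<Rightarrow> real^3 \<Rightarrow> complex" where
  "ker n p q = (\<Sum>k<n. basis_fun n k p * cnj (basis_fun n k q))"

lemma ker_ip: "ker n p q = ip n (\<lambda>k. basis_fun n k p) (\<lambda>k. basis_fun n k q)"
  unfolding ker_def ip_def ..

text \<open>The binomial theorem, with the squared normalizing constants as binomial
  coefficients.\<close>

lemma ker_eq:
  assumes "n \<ge> 1"
  shows "ker n p q = of_real (n / (4 * pi)) * (sp1 p * cnj (sp1 q) + sp2 p * cnj (sp2 q)) ^ (n - 1)"
proof -
  have lt: "{..<n} = {..n - 1}" using assms by auto
  have "basis_fun n k p * cnj (basis_fun n k q) = of_real (n / (4 * pi)) *
    (of_nat ((n - 1) choose k) * (sp2 p * cnj (sp2 q)) ^ k * (sp1 p * cnj (sp1 q)) ^ (n - 1 - k))" for k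
  proof -
    define r where "r = sqrt (n * ((n - 1) choose k) / (4 * pi))"
    have "r * r = n * ((n - 1) choose k) / (4 * pi)" by (simp add: r_def)
    then have r: "of_real r * of_real r = (of_real (n / (4 * pi)) * of_nat ((n - 1) choose k) :: complex)"
      unfolding of_real_mult[symmetric] by simp
    have "basis_fun n k p * cnj (basis_fun n k q) = (of_real r * of_real r) *
        ((sp2 p * cnj (sp2 q)) ^ k * (sp1 p * cnj (sp1 q)) ^ (n - 1 - k))"
      unfolding basis_fun_def r_def[symmetric] by (simp add: power_mult_distrib mult_ac)
    then show ?thesis unfolding r by (simp only: mult.assoc)
  qed
  then show ?thesis
    using binomial_ring[of "sp2 p * cnj (sp2 q)" "sp1 p * cnj (sp1 q)" "n - 1"]
    unfolding ker_def lt by (simp only: sum_distrib_left add.commute[of "sp2 p * cnj (sp2 q)"])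
qed

lemma ker_norm_sq:
  assumes "n \<ge> 1" "p \<in> S2" "q \<in> S2"
  shows "(cmod (ker n p q))\<^sup>2 = (n / (4 * pi))\<^sup>2 * (1 - (dist p q)\<^sup>2 / 4) ^ (n - 1)"
proof -
  let ?z = "sp1 p * cnj (sp1 q) + sp2 p * cnj (sp2 q)"
  have "cmod (ker n p q) = n / (4 * pi) * cmod ?z ^ (n - 1)"
    using assms(1) by (simp only: ker_eq norm_mult norm_power norm_of_real) simp
  then have "(cmod (ker n p q))\<^sup>2 = (n / (4 * pi))\<^sup>2 * ((cmod ?z)\<^sup>2) ^ (n - 1)"
    by (simp only: power_mult_distrib power_commutes flip: power_mult) (simp add: mult.commute)
  then show ?thesis using assms by (simp only: spinor_inner)
qed

lemma ker_self:
  assumes "n \<ge> 1" "p \<in> S2"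
  shows "ker n p p = of_real (n / (4 * pi))"
proof -
  have "sp1 p * cnj (sp1 p) + sp2 p * cnj (sp2 p) = of_real ((cmod (sp1 p))\<^sup>2 + (cmod (sp2 p))\<^sup>2)"
    by (simp only: complex_norm_square of_real_add)
  also have "\<dots> = 1" using assms by (simp add: sp1_norm sp2_norm field_simps)
  finally show ?thesis using assms by (simp add: ker_eq)
qed

lemma dist_S2_le: "p \<in> S2 \<Longrightarrow> q \<in> S2 \<Longrightarrow> (dist p q)\<^sup>2 / 4 \<le> 1"
  using spinor_inner[of p q] zero_le_power2[of "cmod (sp1 p * cnj (sp1 q) + sp2 p * cnj (sp2 q))"] by linarith

text \<open>The factor between the squared determinant of the basis functions and \<^const>\<open>vandermonde_sq\<close>:
  the normalization of the basis, times \<open>1/4\<close> for each pair because of \<open>spinor_cross\<close>.\<close>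

definition vdm_const :: "nat \<Rightarrow> real" where
  "vdm_const n = (\<Prod>k<n. n * ((n - 1) choose k) / (4 * pi)) * (\<Prod>j<n. \<Prod>i<j. 1 / 4)"

lemma vdm_const_pos: "vdm_const n > 0"
  unfolding vdm_const_def by (intro mult_pos_pos prod_pos) auto

text \<open>Column constants factor out of the determinant, and what remains is the homogeneous
  Vandermonde determinant, whose factors have squared modulus a quarter of the squared
  distance.\<close>

lemma vandermonde_sq_eq:
  assumes "\<And>i. i < n \<Longrightarrow> x i \<in> S2"
  shows "(cmod (fdet n (\<lambda>i k. basis_fun n k (x i))))\<^sup>2 = vdm_const n * vandermonde_sq n x"
proof -
  define c where "c k = (of_real (sqrt (n * ((n - 1) choose k) / (4 * pi))) :: complex)" for k
  have "fdet n (\<lambda>i k. basis_fun n k (x i)) = (\<Prod>k<n. c k) * fdet n (\<lambda>i k. sp1 (x i) ^ (n - 1 - k) * sp2 (x i) ^ k)"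
  proof -
    have "(\<Prod>i<n. c (\<pi> i)) = (\<Prod>k<n. c k)" if "\<pi> permutes {..<n}" for \<pi>
      by (subst (2) prod.permute[OF that]) (simp add: o_def)
    then show ?thesis
      unfolding fdet_altdef basis_fun_def c_def[symmetric] prod.distrib sum_distrib_left
      by (intro sum.cong refl) simp
  qed
  also have "\<dots> = (\<Prod>k<n. c k) * (\<Prod>j<n. \<Prod>i<j. sp1 (x i) * sp2 (x j) - sp1 (x j) * sp2 (x i))"
    by (simp only: fdet_vandermonde)
  also have "(cmod \<dots>)\<^sup>2 = (\<Prod>k<n. (cmod (c k))\<^sup>2) *
      (\<Prod>j<n. \<Prod>i<j. (cmod (sp1 (x i) * sp2 (x j) - sp1 (x j) * sp2 (x i)))\<^sup>2)"
    by (simp only: norm_mult power_mult_distrib prod_power_distrib prod_norm[symmetric])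
  also have "(\<Prod>k<n. (cmod (c k))\<^sup>2) = (\<Prod>k<n. n * ((n - 1) choose k) / (4 * pi))"
    by (intro prod.cong) (auto simp: c_def)
  also have "(\<Prod>j<n. \<Prod>i<j. (cmod (sp1 (x i) * sp2 (x j) - sp1 (x j) * sp2 (x i)))\<^sup>2) =
      (\<Prod>j<n. \<Prod>i<j. 1 / 4 * (dist (x i) (x j))\<^sup>2)"
    using assms by (intro prod.cong refl) (simp add: spinor_cross)
  finally show ?thesis
    by (simp only: vdm_const_def vandermonde_sq_def prod.distrib mult.assoc)
qed

section \<open>Measurability and uniform bounds of the basis functions\<close>

lemma borel_measurable_vec_nth: "(\<lambda>p. vec_nth p i) \<in> borel_measurable (borel :: (real^3) measure)"
  by (intro borel_measurable_continuous_onI continuous_intros)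

lemma measurable_sp1 [measurable]: "sp1 \<in> borel_measurable borel"
  unfolding sp1_def using borel_measurable_vec_nth[measurable] by measurable

lemma measurable_sp2 [measurable]: "sp2 \<in> borel_measurable borel"
proof -
  have "Complex (vec_nth p 1) (vec_nth p 2) = of_real (vec_nth p 1) + \<i> * of_real (vec_nth p 2)" for p :: "real^3"
    by (simp add: complex_eq_iff)
  then have *: "sp2 = (\<lambda>p. if vec_nth p 3 = -1 then 1 else (of_real (vec_nth p 1) + \<i> * of_real (vec_nth p 2))
      / of_real (sqrt (2 * (1 + vec_nth p 3))))"
    by (simp add: sp2_def fun_eq_iff)
  show ?thesis unfolding * using borel_measurable_vec_nth[measurable] by measurable
qed

lemma measurable_basis_fun [measurable]: "basis_fun n k \<in> borel_measurable borel"
  unfolding basis_fun_def by measurable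

lemma sp_le_1:
  assumes "p \<in> S2"
  shows "cmod (sp1 p) \<le> 1" "cmod (sp2 p) \<le> 1"
proof -
  have "(cmod (sp1 p))\<^sup>2 \<le> 1\<^sup>2" "(cmod (sp2 p))\<^sup>2 \<le> 1\<^sup>2"
    using S2_coord_bound[OF assms, of 3] sp1_norm[OF assms] sp2_norm[OF assms] by (auto simp: abs_le_iff)
  then show "cmod (sp1 p) \<le> 1" "cmod (sp2 p) \<le> 1" by (simp_all only: power2_le_imp_le zero_le_one)
qed

lemma basis_fun_bound:
  assumes "p \<in> S2"
  shows "cmod (basis_fun n k p) \<le> sqrt (n * ((n - 1) choose k) / (4 * pi))"
proof -
  have "cmod (sp1 p) ^ (n - 1 - k) * cmod (sp2 p) ^ k \<le> 1 * 1"
    using sp_le_1[OF assms] by (intro mult_mono power_le_one) auto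
  then show ?thesis
    by (simp add: basis_fun_def norm_mult norm_power mult_left_le)
qed

section \<open>Orthonormality\<close>

lemma borel_measurable_cnj [measurable (raw)]:
  "f \<in> borel_measurable M \<Longrightarrow> (\<lambda>x. cnj (f x)) \<in> borel_measurable M"
  by (rule borel_measurable_continuous_on[where f = cnj]) (intro continuous_intros)

lemma space_surface_measure [simp]: "space surface_measure = S2"
  using sets_eq_imp_space_eq[OF sets_surface_measure] by (simp add: space_restrict_space)

interpretation surface: finite_measure surface_measure
  by standard (simp add: emeasure_surface_measure_S2)

lemma integral_surface:
  fixes F :: "real^3 \<Rightarrow> complex"
  assumes F: "F \<in> borel_measurable borel"
  shows "(\<integral>p. F p \<partial>surface_measure) =
    (\<integral>z. indicator ({0..pi} \<times> {0..<2*pi}) z *\<^sub>R (sin (fst z) *\<^sub>R F (sph_coord z)) \<partial>lborel)"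
proof -
  let ?R = "{0..pi} \<times> {0..<2 * pi}"
  have R: "?R \<in> sets (lborel :: (real \<times> real) measure)"
    by (metis atLeastAtMost_borel atLeastLessThan_borel borel_Times sets_lborel)
  have sc: "sph_coord \<in> borel_measurable borel"
    by (rule borel_measurable_continuous_onI[OF continuous_sph_coord])
  have Fs: "(\<lambda>z. F (sph_coord z)) \<in> borel_measurable borel" using sc F by measurable
  have F': "F \<in> borel_measurable (restrict_space borel S2)" by (rule measurable_restrict_space1[OF F])
  have "(\<integral>p. F p \<partial>surface_measure) =
    (\<integral>z. F (sph_coord z) \<partial>density (restrict_space lborel ?R) (\<lambda>(\<theta>, \<phi>). ennreal (sin \<theta>)))"
    unfolding surface_measure_def
    by (rule integral_distr) (use measurable_sph_coord F' in \<open>auto\<close>)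
  also have "(\<lambda>(\<theta>, \<phi>). ennreal (sin \<theta>)) = (\<lambda>z. ennreal (sin (fst z)))" by auto
  also have "(\<integral>z. F (sph_coord z) \<partial>density (restrict_space lborel ?R) (\<lambda>z. ennreal (sin (fst z)))) =
     (\<integral>z. sin (fst z) *\<^sub>R F (sph_coord z) \<partial>restrict_space lborel ?R)"
  proof (rule integral_density)
    show "(\<lambda>z. F (sph_coord z)) \<in> borel_measurable (restrict_space lborel ?R)"
      using Fs by (intro measurable_restrict_space1) simp
    show "(\<lambda>z. sin (fst z)) \<in> borel_measurable (restrict_space lborel ?R)"
      unfolding borel_prod[symmetric] by (intro measurable_restrict_space1) (simp add: borel_prod borel_measurable_continuous_onI continuous_intros)
    show "AE z in restrict_space lborel ?R. 0 \<le> sin (fst z)"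
      by (intro AE_I2) (auto simp: space_restrict_space intro: sin_ge_zero)
  qed
  also have "\<dots> = (\<integral>z. indicator ?R z *\<^sub>R (sin (fst z) *\<^sub>R F (sph_coord z)) \<partial>lborel)"
    using R by (subst integral_restrict_space) auto
  finally show ?thesis .
qed

lemma DERIV_half_angle_power:
  fixes \<theta> :: real
  shows "((\<lambda>\<theta>. sin (\<theta> / 2) ^ Suc m) has_real_derivative (Suc m / 2) * (sin (\<theta> / 2) ^ m * cos (\<theta> / 2))) (at \<theta> within S)"
    and "((\<lambda>\<theta>. cos (\<theta> / 2) ^ Suc m) has_real_derivative - (Suc m / 2) * (cos (\<theta> / 2) ^ m * sin (\<theta> / 2))) (at \<theta> within S)"
proof -
  have s: "((\<lambda>\<theta>. sin (\<theta> / 2)) has_real_derivative cos (\<theta> / 2) / 2) (at \<theta> within S)"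
    and c: "((\<lambda>\<theta>. cos (\<theta> / 2)) has_real_derivative - sin (\<theta> / 2) / 2) (at \<theta> within S)"
    by (auto intro!: derivative_eq_intros)
  show "((\<lambda>\<theta>. sin (\<theta> / 2) ^ Suc m) has_real_derivative (Suc m / 2) * (sin (\<theta> / 2) ^ m * cos (\<theta> / 2))) (at \<theta> within S)"
    by (rule DERIV_cong[OF DERIV_power[OF s]]) (simp add: mult_ac del: power_Suc)
  show "((\<lambda>\<theta>. cos (\<theta> / 2) ^ Suc m) has_real_derivative - (Suc m / 2) * (cos (\<theta> / 2) ^ m * sin (\<theta> / 2))) (at \<theta> within S)"
    by (rule DERIV_cong[OF DERIV_power[OF c]]) (simp add: mult_ac del: power_Suc)
qed

text \<open>Beta integral in the variable \<open>sin\<^sup>2 (\<theta>/2)\<close>.\<close>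

lemma polar_integral:
  "((\<lambda>\<theta>. 2 * cos (\<theta> / 2) ^ (2 * a + 1) * sin (\<theta> / 2) ^ (2 * k + 1))
     has_integral (2 * fact a * fact k / fact (a + k + 1) :: real)) {0..pi}"
proof (induction a arbitrary: k)
  case 0
  have "((\<lambda>\<theta>. Suc (2 * k + 1) / 2 * (sin (\<theta> / 2) ^ (2 * k + 1) * cos (\<theta> / 2))) has_integral
      sin (pi / 2) ^ Suc (2 * k + 1) - sin (0 / 2) ^ Suc (2 * k + 1)) {0..pi}"
    by (intro fundamental_theorem_of_calculus pi_ge_zero
        DERIV_half_angle_power[unfolded has_real_derivative_iff_has_vector_derivative])
  from has_integral_mult_right[OF this, of "2 / (k + 1)"] show ?case
    by (simp add: mult_ac)
next
  case (Suc a)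
  let ?c = "\<lambda>\<theta>::real. cos (\<theta> / 2)" and ?s = "\<lambda>\<theta>::real. sin (\<theta> / 2)"
  \<comment> \<open>Integration by parts: the product of the two powers vanishes at both endpoints,
    so the integral for \<open>(Suc a, k)\<close> is \<open>(a + 1) / (k + 1)\<close> times the one
    for \<open>(a, Suc k)\<close>.\<close>
  have "((\<lambda>\<theta>. - (Suc (2 * a + 1) / 2) * (?c \<theta> ^ (2 * a + 1) * ?s \<theta>) * ?s \<theta> ^ Suc (2 * k + 1)
       + (Suc (2 * k + 1) / 2) * (?s \<theta> ^ (2 * k + 1) * ?c \<theta>) * ?c \<theta> ^ Suc (2 * a + 1))
    has_integral ?c pi ^ Suc (2 * a + 1) * ?s pi ^ Suc (2 * k + 1) - ?c 0 ^ Suc (2 * a + 1) * ?s 0 ^ Suc (2 * k + 1)) {0..pi}"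
    by (intro fundamental_theorem_of_calculus pi_ge_zero
        DERIV_mult[OF DERIV_half_angle_power(2,1), unfolded has_real_derivative_iff_has_vector_derivative])
  then have "((\<lambda>\<theta>. (k + 1) * (?c \<theta> ^ (2 * Suc a + 1) * ?s \<theta> ^ (2 * k + 1)) - (a + 1) * (?c \<theta> ^ (2 * a + 1) * ?s \<theta> ^ (2 * Suc k + 1)))
    has_integral 0) {0..pi}"
    by (rule has_integral_eq_rhs[OF has_integral_eq, rotated]) (auto simp: field_simps)
  from has_integral_add[OF this has_integral_mult_right[OF Suc.IH[of "Suc k"], of "(a + 1) / 2"]]
  have "((\<lambda>\<theta>. (k + 1) * (?c \<theta> ^ (2 * Suc a + 1) * ?s \<theta> ^ (2 * k + 1)))
    has_integral (a + 1) / 2 * (2 * fact a * fact (Suc k) / fact (a + Suc k + 1))) {0..pi}"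
    by (rule has_integral_eq_rhs[OF has_integral_eq, rotated]) (auto simp: field_simps)
  from has_integral_mult_right[OF this, of "2 / (k + 1)"]
  have "((\<lambda>\<theta>. 2 * ?c \<theta> ^ (2 * Suc a + 1) * ?s \<theta> ^ (2 * k + 1))
    has_integral 2 / (k + 1) * ((a + 1) / 2 * (2 * fact a * fact (Suc k) / fact (a + Suc k + 1)))) {0..pi}"
    by (rule has_integral_eq[rotated]) auto
  also have "2 / (k + 1) * ((a + 1) / 2 * (2 * fact a * fact (Suc k) / fact (a + Suc k + 1))) =
     (2 * fact (Suc a) * fact k / fact (Suc a + k + 1) :: real)"
  proof -
    have "2 / K * (A / 2 * (2 * u * (K * v) / X)) = 2 * (A * u) * v / X" if "K \<noteq> 0" for K A u v X :: real
      using that by simp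
    from this[of "real (Suc k)" "real (Suc a)" "fact a" "fact k" "fact (a + Suc k + 1)"] show ?thesis
      by (simp del: of_nat_Suc add: fact_Suc[of k] fact_Suc[of a])
  qed
  finally show ?case .
qed

lemma integral_cis:
  fixes m :: int
  assumes "m \<noteq> 0"
  shows "(\<integral>\<phi>. indicator {0..2*pi} \<phi> *\<^sub>R cis (m * \<phi>) \<partial>lborel) = 0"
proof -
  have "(\<integral>\<phi>. indicator {0..2*pi} \<phi> *\<^sub>R cis (m * \<phi>) \<partial>lborel) =
     cis (m * (2*pi)) / (\<i> * m) - cis (m * 0) / (\<i> * m)"
  proof (subst integral_FTC_Icc[where F = "\<lambda>x. cis (m * x) / (\<i> * of_int m)"])
    fix x :: real
    have "((\<lambda>z. exp (\<i> * of_int m * z) / (\<i> * of_int m)) has_field_derivative exp (\<i> * of_int m * of_real x)) (at (of_real x))"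
      using assms by (auto intro!: derivative_eq_intros)
    from has_vector_derivative_real_field[OF this]
    show "((\<lambda>x. cis (m * x) / (\<i> * of_int m)) has_vector_derivative cis (m * x)) (at x within {0..2*pi})"
      by (simp add: cis_conv_exp mult.assoc)
  qed (auto intro!: continuous_intros simp: cis_conv_exp)
  also have "cis (m * (2*pi)) = 1"
    by (metis cis_multiple_2pi Ints_of_int mult.commute)
  finally show ?thesis by simp
qed

lemma integral_lborel_prod:
  fixes f g :: "real \<Rightarrow> complex"
  assumes f: "integrable lborel f" and g: "integrable lborel g"
  shows "(\<integral>z. f (fst z) * g (snd z) \<partial>(lborel :: (real \<times> real) measure)) = (\<integral>x. f x \<partial>lborel) * (\<integral>x. g x \<partial>lborel)"
proof -
  have "integrable (lborel \<Otimes>\<^sub>M lborel) (\<lambda>z. f (fst z) * g (snd z))"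
  proof (rule lborel_pair.Fubini_integrable)
    show "(\<lambda>z. f (fst z) * g (snd z)) \<in> borel_measurable (lborel \<Otimes>\<^sub>M lborel)"
      using f g by measurable
    show "integrable lborel (\<lambda>x. \<integral>y. norm (f (fst (x, y)) * g (snd (x, y))) \<partial>lborel)"
      using f by (simp add: norm_mult)
    show "AE x in lborel. integrable lborel (\<lambda>y. f (fst (x, y)) * g (snd (x, y)))"
      using g by simp
  qed
  from lborel_pair.integral_fst'[OF this] show ?thesis
    unfolding lborel_prod by simp
qed

text \<open>The angle \<open>pi\<close> is excluded because \<open>sp2\<close> is 1 at the south
  pole, while the right-hand side there would still depend on \<phi>.\<close>

lemma sp_sph_coord:
  assumes "0 \<le> \<theta>" "\<theta> < pi"
  shows "sp1 (sph_coord (\<theta>, \<phi>)) = of_real (cos (\<theta> / 2))" "sp2 (sph_coord (\<theta>, \<phi>)) = of_real (sin (\<theta> / 2)) * cis \<phi>"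
proof -
  have c: "cos (\<theta> / 2) > 0" using assms by (intro cos_gt_zero_pi) auto
  have cos: "cos \<theta> = 2 * (cos (\<theta> / 2))\<^sup>2 - 1" using cos_double_cos[of "\<theta> / 2"] by simp
  have sin: "sin \<theta> = 2 * sin (\<theta> / 2) * cos (\<theta> / 2)" using sin_double[of "\<theta> / 2"] by simp
  have r: "sqrt (2 * (1 + cos \<theta>)) = 2 * cos (\<theta> / 2)"
    unfolding cos using c by (intro real_sqrt_unique) (auto simp: power2_eq_square)
  show "sp1 (sph_coord (\<theta>, \<phi>)) = of_real (cos (\<theta> / 2))"
    unfolding sp1_def sph_coord_def using c by (simp add: vector_3 cos)
  have "cos \<theta> \<noteq> -1" unfolding cos using c by simp
  then show "sp2 (sph_coord (\<theta>, \<phi>)) = of_real (sin (\<theta> / 2)) * cis \<phi>"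
    unfolding sp2_def sph_coord_def case_prod_conv vector_3 r using c by (simp add: sin complex_eq_iff)
qed

text \<open>Variables separate in spherical coordinates: the azimuth gives orthogonality, and for
  \<open>j = k\<close> the Beta integral over the polar angle gives the norm.\<close>

lemma basis_fun_orthonormal:
  assumes "j < n" "k < n"
  shows "(\<integral>p. basis_fun n j p * cnj (basis_fun n k p) \<partial>surface_measure) = (if j = k then 1 else 0)"
proof -
  define C where "C i = sqrt (n * ((n - 1) choose i) / (4 * pi))" for i
  define m where "m = int j - int k"
  define f where "f \<theta> = indicator {0..pi} \<theta> *\<^sub>R (of_real (C j * C k * (sin \<theta> * cos (\<theta> / 2) ^ (n - 1 - j) * sin (\<theta> / 2) ^ j
      * cos (\<theta> / 2) ^ (n - 1 - k) * sin (\<theta> / 2) ^ k)) :: complex)" for \<theta>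
  define g where "g \<phi> = indicator {0..2*pi} \<phi> *\<^sub>R cis (of_int m * \<phi>)" for \<phi>
  have f: "integrable lborel f"
    unfolding f_def set_integrable_def[symmetric]
    by (intro borel_integrable_atLeastAtMost' continuous_intros) simp_all
  have g: "integrable lborel g"
    unfolding g_def set_integrable_def[symmetric]
    by (intro borel_integrable_atLeastAtMost' continuous_intros)
  have meas: "(\<lambda>p. basis_fun n j p * cnj (basis_fun n k p)) \<in> borel_measurable borel" by measurable
  have "(\<integral>p. basis_fun n j p * cnj (basis_fun n k p) \<partial>surface_measure) =
     (\<integral>z. indicator ({0..pi} \<times> {0..<2*pi}) z *\<^sub>R (sin (fst z) *\<^sub>R
        (basis_fun n j (sph_coord z) * cnj (basis_fun n k (sph_coord z)))) \<partial>lborel)"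
    by (rule integral_surface[OF meas])
  also have "\<dots> = (\<integral>z. indicator ({0..pi} \<times> {0..<2*pi}) z *\<^sub>R (f (fst z) * g (snd z)) \<partial>lborel)"
  proof (rule Bochner_Integration.integral_cong[OF refl])
    fix z :: "real \<times> real"
    obtain \<theta> \<phi> where z: "z = (\<theta>, \<phi>)" by force
    show "indicator ({0..pi} \<times> {0..<2*pi}) z *\<^sub>R (sin (fst z) *\<^sub>R
        (basis_fun n j (sph_coord z) * cnj (basis_fun n k (sph_coord z)))) =
      indicator ({0..pi} \<times> {0..<2*pi}) z *\<^sub>R (f (fst z) * g (snd z))"
    \<comment> \<open>At the polar angle \<open>pi\<close> both sides vanish through the area factor
      \<open>sin\<close>, so the convention at the south pole does no harm.\<close>
    proof (cases "z \<in> {0..pi} \<times> {0..<2*pi} \<and> \<theta> \<noteq> pi")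
      case True
      then have t: "0 \<le> \<theta>" "\<theta> < pi" "0 \<le> \<phi>" "\<phi> < 2 * pi" using z by auto
      have "cis \<phi> ^ j * cnj (cis \<phi> ^ k) = cis (of_int m * \<phi>)"
        by (simp only: Complex.DeMoivre) (simp add: cis_cnj cis_mult m_def algebra_simps)
      then show ?thesis using t z
        unfolding basis_fun_def z sp_sph_coord[OF t(1,2)] C_def[symmetric]
        by (simp add: f_def g_def power_mult_distrib scaleR_conv_of_real mult_ac)
    qed (auto simp: z f_def)
  qed
  also have "\<dots> = (\<integral>z. f (fst z) * g (snd z) \<partial>(lborel :: (real \<times> real) measure))"
  proof (rule integral_cong_AE)
    \<comment> \<open>The half-open azimuth interval is replaced by the closed one used in
      \<open>g\<close>; they differ on this null line.\<close>
    have N: "{z :: real \<times> real. snd z = 2 * pi} \<in> null_sets lborel"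
    proof -
      have "UNIV \<times> {2 * pi} \<in> null_sets (lborel \<Otimes>\<^sub>M lborel :: (real \<times> real) measure)"
        by (intro null_setsI) (simp_all add: lborel.emeasure_pair_measure_Times)
      moreover have "{z :: real \<times> real. snd z = 2 * pi} = UNIV \<times> {2 * pi}" by auto
      ultimately show ?thesis by (simp add: lborel_prod)
    qed
    have fg: "(\<lambda>z. f (fst z) * g (snd z)) \<in> borel_measurable (lborel \<Otimes>\<^sub>M lborel)"
      using f g by measurable
    then show fg': "(\<lambda>z. f (fst z) * g (snd z)) \<in> borel_measurable lborel" by (simp add: lborel_prod)
    have R: "{0..pi} \<times> {0..<2 * pi} \<in> sets (lborel :: (real \<times> real) measure)"
      by (metis atLeastAtMost_borel atLeastLessThan_borel borel_Times sets_lborel)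
    show "(\<lambda>z. indicator ({0..pi} \<times> {0..<2*pi}) z *\<^sub>R (f (fst z) * g (snd z))) \<in> borel_measurable lborel"
      using R fg' by (intro borel_measurable_scaleR borel_measurable_indicator)
    show "AE z in lborel. indicator ({0..pi} \<times> {0..<2*pi}) z *\<^sub>R (f (fst z) * g (snd z)) = f (fst z) * g (snd z)"
      by (rule AE_I'[OF N]) (auto simp: f_def g_def indicator_def)
  qed
  also have "\<dots> = (\<integral>x. f x \<partial>lborel) * (\<integral>x. g x \<partial>lborel)"
    by (rule integral_lborel_prod[OF f g])
  also have "\<dots> = (if j = k then 1 else 0)"
  proof (cases "j = k")
    case False
    then have "(\<integral>x. g x \<partial>lborel) = 0" unfolding g_def by (intro integral_cis) (simp add: m_def)
    then show ?thesis using False by simp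
  next
    case True
    have gi: "(\<integral>x. g x \<partial>lborel) = 2 * pi"
      by (simp add: g_def m_def True scaleR_conv_of_real)
    define h where "h \<theta> = C k * C k * (2 * cos (\<theta> / 2) ^ (2 * (n - 1 - k) + 1) * sin (\<theta> / 2) ^ (2 * k + 1))" for \<theta>
    have h: "(h has_integral C k * C k * (2 * fact (n - 1 - k) * fact k / fact n)) {0..pi}"
      unfolding h_def using has_integral_mult_right[OF polar_integral[of "n - 1 - k" k], of "C k * C k"] assms by simp
    have "f \<theta> = of_real (indicator {0..pi} \<theta> *\<^sub>R h \<theta>)" for \<theta>
    proof -
      have "sin \<theta> = 2 * sin (\<theta> / 2) * cos (\<theta> / 2)" using sin_double[of "\<theta> / 2"] by simp
      then show ?thesis unfolding f_def h_def True
        by (simp add: power_mult power2_eq_square power_mult_distrib scaleR_conv_of_real mult_ac)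
    qed
    then have "(\<integral>x. f x \<partial>lborel) = of_real (\<integral>x. indicator {0..pi} x *\<^sub>R h x \<partial>lborel)"
      by (simp only: integral_complex_of_real)
    also have "(\<integral>x. indicator {0..pi} x *\<^sub>R h x \<partial>lborel) = integral {0..pi} h"
    proof -
      have "set_integrable lborel {0..pi} h"
        unfolding h_def by (intro borel_integrable_atLeastAtMost' continuous_intros) simp_all
      from set_borel_integral_eq_integral(2)[OF this] show ?thesis by (simp add: set_lebesgue_integral_def)
    qed
    also have "\<dots> = C k * C k * (2 * fact (n - 1 - k) * fact k / fact n)"
      using h by (rule integral_unique)
    also have "C k * C k = n * (fact (n - 1) / (fact k * fact (n - 1 - k))) / (4 * pi)"
      using assms by (simp add: C_def binomial_fact)
    also have "\<dots> * (2 * fact (n - 1 - k) * fact k / fact n) = 1 / (2 * pi)"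
      using assms fact_reduce[of n, where 'a = real] by (simp add: field_simps)
    finally show ?thesis using True gi by simp
  qed
  finally show ?thesis .
qed

section \<open>Distances on the sphere\<close>

lemma borel_measurable_surface:
  "f \<in> borel \<rightarrow>\<^sub>M N \<Longrightarrow> f \<in> surface_measure \<rightarrow>\<^sub>M N"
  unfolding measurable_cong_sets[OF sets_surface_measure refl] by (rule measurable_restrict_space1)

lemma surface_integrableI:
  fixes f :: "real^3 \<Rightarrow> 'b::{banach, second_countable_topology}"
  assumes "f \<in> borel_measurable borel" "\<And>p. p \<in> S2 \<Longrightarrow> norm (f p) \<le> B"
  shows "integrable surface_measure f"
  using assms by (intro surface.integrable_const_bound[where B = B] AE_I2 borel_measurable_surface) auto

text \<open>On the unit interval all moments are at most 1, so both characteristic functions lie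
  within \<open>2 * \<bar>t\<bar> ^ n / fact n\<close> of the same Taylor polynomial.\<close>

lemma real_distribution_moments_unique:
  assumes M: "real_distribution M" "AE x in M. x \<in> {0..1}"
    and N: "real_distribution N" "AE x in N. x \<in> {0..1}"
    and eq: "\<And>k. (\<integral>x. x ^ k \<partial>M) = (\<integral>x. x ^ k \<partial>N)"
  shows "M = N"
proof (rule Levy_uniqueness[OF M(1) N(1)], rule ext)
  fix t :: real
  have bound: "integrable M (\<lambda>x. x ^ k) \<and> (\<integral>x. \<bar>x\<bar> ^ k \<partial>M) \<le> 1"
    if "real_distribution M" "AE x in M. x \<in> {0..1}" for M :: "real measure" and k
  proof -
    interpret real_distribution M by fact
    have AE: "AE x in M. \<bar>x\<bar> ^ k \<le> 1" using that(2) by eventually_elim (auto intro: power_le_one)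
    have 1: "integrable M (\<lambda>x. x ^ k)"
      by (rule integrable_const_bound[where B = 1]) (use AE in \<open>auto simp: power_abs\<close>)
    have "(\<integral>x. \<bar>x\<bar> ^ k \<partial>M) \<le> (\<integral>x. 1 \<partial>M)"
      using integrable_abs[OF 1] AE by (intro integral_mono_AE) (auto simp: power_abs)
    then show ?thesis using 1 prob_space by simp
  qed
  have le: "cmod (char M t - char N t) \<le> 4 * (inverse (fact n) * \<bar>t\<bar> ^ n)" for n
  proof -
    define S where "S = (\<Sum>k\<le>n. ((\<i> * t)^k / fact k) * (\<integral>x. x ^ k \<partial>M))"
    have *: "cmod (char M t - (\<Sum>k\<le>n. ((\<i> * t)^k / fact k) * (\<integral>x. x ^ k \<partial>M))) \<le> 2 * (inverse (fact n) * \<bar>t\<bar> ^ n)"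
      if "real_distribution M" "AE x in M. x \<in> {0..1}" for M
    proof -
      have "2 * \<bar>t\<bar> ^ n / fact n * (\<integral>x. \<bar>x\<bar> ^ n \<partial>M) \<le> 2 * \<bar>t\<bar> ^ n / fact n * 1"
        using bound[OF that, of n] by (intro mult_left_mono) auto
      then show ?thesis
        using real_distribution.char_approx1[OF that(1), of n t] bound[OF that] by (simp add: field_simps)
    qed
    have "cmod (char M t - S) \<le> 2 * (inverse (fact n) * \<bar>t\<bar> ^ n)" unfolding S_def by (rule *[OF M])
    moreover have "cmod (char N t - S) \<le> 2 * (inverse (fact n) * \<bar>t\<bar> ^ n)" unfolding S_def eq by (rule *[OF N])
    ultimately show ?thesis using norm_triangle_ineq4[of "char M t - S" "char N t - S"] by simp
  qed
  have "(\<lambda>n. 4 * (inverse (fact n) * \<bar>t\<bar> ^ n)) \<longlonglongrightarrow> 4 * 0"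
    by (intro tendsto_intros summable_LIMSEQ_zero summable_exp)
  then have "(\<lambda>n. 4 * (inverse (fact n) * \<bar>t\<bar> ^ n)) \<longlonglongrightarrow> 0" by simp
  then have "cmod (char M t - char N t) \<le> 0" by (rule LIMSEQ_le_const) (use le in blast)
  then show "char M t = char N t" by simp
qed

text \<open>Take \<open>n = k + 1\<close>. By orthonormality the integral of the squared modulus of
  \<open>ker n p q\<close> over \<open>q\<close> is \<open>ker n p p\<close>, and that integrand is
  a constant times the required power.\<close>

lemma dist_moment:
  assumes p: "p \<in> S2"
  shows "(\<integral>q. (1 - (dist p q)\<^sup>2 / 4) ^ k \<partial>surface_measure) = 4 * pi / (k + 1)"
proof -
  define n where "n = Suc k"
  have int: "integrable surface_measure (\<lambda>q. basis_fun n i q * cnj (basis_fun n j q))" for i j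
  proof (rule surface_integrableI)
    fix q assume "q \<in> S2"
    from basis_fun_bound[OF this, of n i] basis_fun_bound[OF this, of n j]
    show "cmod (basis_fun n i q * cnj (basis_fun n j q)) \<le>
      sqrt (n * ((n - 1) choose i) / (4 * pi)) * sqrt (n * ((n - 1) choose j) / (4 * pi))"
      unfolding norm_mult complex_mod_cnj by (intro mult_mono) auto
  qed measurable
  have "complex_of_real (\<integral>q. (cmod (ker n p q))\<^sup>2 \<partial>surface_measure) = (\<integral>q. cnj (ker n p q) * ker n p q \<partial>surface_measure)"
  proof -
    have "(\<lambda>q. complex_of_real ((cmod (ker n p q))\<^sup>2)) = (\<lambda>q. cnj (ker n p q) * ker n p q)"
      by (simp only: complex_norm_square mult.commute)
    then show ?thesis by (simp only: integral_complex_of_real[symmetric])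
  qed
  also have "(\<lambda>q. cnj (ker n p q) * ker n p q) =
    (\<lambda>q. \<Sum>i<n. \<Sum>j<n. cnj (basis_fun n i p) * basis_fun n j p * (basis_fun n i q * cnj (basis_fun n j q)))"
    by (simp add: ker_def sum_product mult_ac)
  also have "(\<integral>q. (\<Sum>i<n. \<Sum>j<n. cnj (basis_fun n i p) * basis_fun n j p * (basis_fun n i q * cnj (basis_fun n j q))) \<partial>surface_measure)
    = (\<Sum>i<n. \<Sum>j<n. cnj (basis_fun n i p) * basis_fun n j p * (\<integral>q. basis_fun n i q * cnj (basis_fun n j q) \<partial>surface_measure))"
    using int by simp
  also have "\<dots> = (\<Sum>i<n. \<Sum>j<n. if j = i then cnj (basis_fun n i p) * basis_fun n i p else 0)"
    by (intro sum.cong refl) (auto simp: basis_fun_orthonormal)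
  also have "\<dots> = ker n p p" by (simp add: ker_def mult.commute)
  also have "\<dots> = of_real (n / (4 * pi))" using p by (intro ker_self) (auto simp: n_def)
  finally have "(\<integral>q. (cmod (ker n p q))\<^sup>2 \<partial>surface_measure) = n / (4 * pi)" by (simp only: of_real_eq_iff)
  also have "(\<integral>q. (cmod (ker n p q))\<^sup>2 \<partial>surface_measure) =
      (\<integral>q. (n / (4 * pi))\<^sup>2 * (1 - (dist p q)\<^sup>2 / 4) ^ k \<partial>surface_measure)"
    by (rule Bochner_Integration.integral_cong[OF refl]) (use p in \<open>simp add: ker_norm_sq n_def\<close>)
  also have "\<dots> = (n / (4 * pi))\<^sup>2 * (\<integral>q. (1 - (dist p q)\<^sup>2 / 4) ^ k \<partial>surface_measure)" by simp
  finally have *: "(n / (4 * pi))\<^sup>2 * (\<integral>q. (1 - (dist p q)\<^sup>2 / 4) ^ k \<partial>surface_measure) = n / (4 * pi)" .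
  have "I = 1 / a" if "a\<^sup>2 * I = a" "a \<noteq> 0" for I a :: real
    using that by (simp add: power2_eq_square field_simps)
  from this[OF *] show ?thesis by (simp add: n_def)
qed

text \<open>Archimedes' hat-box theorem: the reproducing property of \<^const>\<open>ker\<close> yields all moments of the
  squared overlap, so no rotation invariance of the surface measure has to be established.\<close>

lemma nn_integral_dist:
  assumes p: "p \<in> S2" and G: "G \<in> borel_measurable borel"
  shows "(\<integral>\<^sup>+q. G (1 - (dist p q)\<^sup>2 / 4) \<partial>surface_measure) = ennreal (4 * pi) * (\<integral>\<^sup>+v. G v * indicator {0..1} v \<partial>lborel)"
proof -
  define X where "X q = 1 - (dist p q)\<^sup>2 / 4" for q
  have X[measurable]: "X \<in> borel_measurable borel" unfolding X_def by measurable
  have XS[measurable]: "X \<in> borel_measurable surface_measure" by (rule borel_measurable_surface[OF X])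
  have X01: "X q \<in> {0..1}" if "q \<in> S2" for q
    using dist_S2_le[OF p that] by (simp add: X_def)
  \<comment> \<open>\<open>M\<close> is the law of the squared overlap of \<open>p\<close> with a
    uniform point of the sphere and \<open>N\<close> is the uniform law on the unit interval; both
    have moments \<open>1 / (k + 1)\<close>.\<close>
  define D where "D = density surface_measure (\<lambda>_. ennreal (1 / (4 * pi)))"
  define M where "M = distr D borel X"
  define N where "N = density lborel (\<lambda>v. indicator {0..1::real} v :: ennreal)"
  have sD: "sets D = sets surface_measure" "space D = S2" by (simp_all add: D_def)
  have XD[measurable]: "X \<in> borel_measurable D" using XS sD by (simp cong: measurable_cong_sets)
  have "emeasure D (space D) = (\<integral>\<^sup>+q. ennreal (1 / (4 * pi)) * indicator S2 q \<partial>surface_measure)"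
    unfolding sD unfolding D_def using sets.top[of surface_measure] by (subst emeasure_density) auto
  also have "\<dots> = ennreal (1 / (4 * pi)) * ennreal (4 * pi)"
    using sets.top[of surface_measure] by (subst nn_integral_cmult_indicator) (auto simp: emeasure_surface_measure_S2)
  also have "\<dots> = 1" by (simp flip: ennreal_mult)
  finally have "prob_space D" by (rule prob_spaceI)
  then have "prob_space M" unfolding M_def by (rule prob_space.prob_space_distr) measurable
  then have rM: "real_distribution M" unfolding real_distribution_def real_distribution_axioms_def by (simp add: M_def)
  have "prob_space N" by (rule prob_spaceI) (simp add: N_def emeasure_density)
  then have rN: "real_distribution N" unfolding real_distribution_def real_distribution_axioms_def by (simp add: N_def)
  have "M = N"
  proof (rule real_distribution_moments_unique[OF rM _ rN])
    show "AE x in M. x \<in> {0..1}" unfolding M_def using X01 by (subst AE_distr_iff) (auto simp: sD)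
    show "AE x in N. x \<in> {0..1}" unfolding N_def by (subst AE_density) (auto simp: indicator_def)
    fix k
    have "(\<integral>x. x ^ k \<partial>M) = (\<integral>q. X q ^ k \<partial>D)" unfolding M_def by (subst integral_distr) auto
    also have "\<dots> = (\<integral>q. (1 / (4 * pi)) *\<^sub>R X q ^ k \<partial>surface_measure)" unfolding D_def
      by (rule integral_density) auto
    also have "\<dots> = 1 / (k + 1)" using dist_moment[OF p, of k] by (simp add: X_def)
    also have "\<dots> = (\<integral>x. indicator {0..1} x *\<^sub>R x ^ k \<partial>lborel)"
    proof -
      have "(\<integral>x. indicator {0..1} x *\<^sub>R x ^ k \<partial>lborel) = 1 ^ Suc k / Suc k - 0 ^ Suc k / Suc k"
      proof (rule integral_FTC_Icc)
        fix x :: real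
        have "((\<lambda>x. x ^ Suc k / Suc k) has_real_derivative x ^ k) (at x within {0..1})"
          using DERIV_cdivide[OF DERIV_pow[of "Suc k" x "{0..1}"], of "real (Suc k)"] by simp
        then show "((\<lambda>x. x ^ Suc k / Suc k) has_vector_derivative x ^ k) (at x within {0..1})"
          by (simp only: has_real_derivative_iff_has_vector_derivative)
      qed (auto intro!: continuous_intros)
      then show ?thesis by simp
    qed
    also have "\<dots> = (\<integral>x. x ^ k \<partial>N)"
    proof -
      have "N = density lborel (\<lambda>v. ennreal (indicator {0..1::real} v))" by (simp add: N_def ennreal_indicator)
      then show ?thesis by (simp only:) (subst integral_density; simp)
    qed
    finally show "(\<integral>x. x ^ k \<partial>M) = (\<integral>x. x ^ k \<partial>N)" .
  qed
  have "ennreal (1 / (4 * pi)) * (\<integral>\<^sup>+q. G (X q) \<partial>surface_measure) = (\<integral>\<^sup>+q. G (X q) \<partial>D)"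
    unfolding D_def using G by (subst nn_integral_density) (auto simp: nn_integral_cmult)
  also have "\<dots> = (\<integral>\<^sup>+v. G v \<partial>M)" unfolding M_def using G by (subst nn_integral_distr) auto
  also have "\<dots> = (\<integral>\<^sup>+v. indicator {0..1} v * G v \<partial>lborel)" unfolding \<open>M = N\<close> N_def using G
    by (subst nn_integral_density) auto
  finally have "ennreal (4 * pi) * (ennreal (1 / (4 * pi)) * (\<integral>\<^sup>+q. G (X q) \<partial>surface_measure)) =
      ennreal (4 * pi) * (\<integral>\<^sup>+v. indicator {0..1} v * G v \<partial>lborel)" by simp
  then show ?thesis by (simp add: X_def mult.commute flip: mult.assoc ennreal_mult)
qed

text \<open>The cap is the set where the squared overlap is at least \<open>1 - a\<close>, an
  interval of length \<open>a\<close>.\<close>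

lemma cap_measure:
  assumes p: "p \<in> S2" and "0 \<le> a" "a \<le> 1"
  shows "(\<integral>\<^sup>+q. indicator {q. (dist p q)\<^sup>2 / 4 \<le> a} q \<partial>surface_measure) = ennreal (4 * pi * a)"
proof -
  have "(\<integral>\<^sup>+q. indicator {q. (dist p q)\<^sup>2 / 4 \<le> a} q \<partial>surface_measure) =
     (\<integral>\<^sup>+q. (indicator {1 - a..} :: real \<Rightarrow> ennreal) (1 - (dist p q)\<^sup>2 / 4) \<partial>surface_measure)"
    by (intro nn_integral_cong) (auto simp: indicator_def)
  also have "\<dots> = ennreal (4 * pi) * (\<integral>\<^sup>+v. indicator {1 - a..} v * indicator {0..1} v \<partial>(lborel :: real measure))"
    by (rule nn_integral_dist[OF p]) auto
  also have "(\<integral>\<^sup>+v. indicator {1 - a..} v * indicator {0..1} v \<partial>(lborel :: real measure)) =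
      (\<integral>\<^sup>+v. indicator {1 - a..1} v \<partial>(lborel :: real measure))"
    using assms by (intro nn_integral_cong) (auto simp: indicator_def)
  also have "\<dots> = ennreal a" using assms by simp
  finally show ?thesis using assms by (simp add: ennreal_mult)
qed

text \<open>The two-point correlation function: the 2x2 determinant of \<open>ker\<close>, written
  out by \<open>ker_self\<close> and \<open>ker_norm_sq\<close>. It vanishes on the diagonal, which
  expresses repulsion.\<close>

definition rho2 :: "nat \<Rightarrow> real^3 \<Rightarrow> real^3 \<Rightarrow> real" where
  "rho2 n p q = (n / (4 * pi))\<^sup>2 * (1 - (1 - (dist p q)\<^sup>2 / 4) ^ (n - 1))"

text \<open>The integral of \<open>rho2\<close> over all pairs of points at distance at most \<open>2 * sqrt a\<close>.\<close>

definition pair_mass :: "nat \<Rightarrow> real \<Rightarrow> real" where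
  "pair_mass n a = real n ^ 2 * a - n + n * (1 - a) ^ n"

text \<open>By the hat-box theorem the integral is one-dimensional and the same for every
  \<open>p\<close>; integrating over \<open>p\<close> as well restores the factor
  \<open>4 * pi\<close>.\<close>

lemma rho2_cap:
  assumes p: "p \<in> S2" and a: "0 \<le> a" "a \<le> 1" and n: "n \<ge> 1"
  shows "(\<integral>\<^sup>+q. indicator {q. (dist p q)\<^sup>2 / 4 \<le> a} q * ennreal (rho2 n p q) \<partial>surface_measure)
      = ennreal (pair_mass n a / (4 * pi))"
proof -
  let ?c = "(n / (4 * pi))\<^sup>2"
  have "(\<integral>\<^sup>+q. indicator {q. (dist p q)\<^sup>2 / 4 \<le> a} q * ennreal (rho2 n p q) \<partial>surface_measure) =
     (\<integral>\<^sup>+q. (\<lambda>v. indicator {1 - a..} v * ennreal (?c * (1 - v ^ (n - 1)))) (1 - (dist p q)\<^sup>2 / 4) \<partial>surface_measure)"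
    by (intro nn_integral_cong) (auto simp: indicator_def rho2_def)
  also have "\<dots> = ennreal (4 * pi) * (\<integral>\<^sup>+v. indicator {1 - a..} v * ennreal (?c * (1 - v ^ (n - 1))) * indicator {0..1} v \<partial>lborel)"
    by (rule nn_integral_dist[OF p]) auto
  also have "(\<integral>\<^sup>+v. indicator {1 - a..} v * ennreal (?c * (1 - v ^ (n - 1))) * indicator {0..1} v \<partial>lborel) =
     (\<integral>\<^sup>+v. ennreal (?c * (1 - v ^ (n - 1))) * indicator {1 - a..1} v \<partial>lborel)"
    using a by (intro nn_integral_cong) (auto simp: indicator_def)
  also have "\<dots> = ennreal (?c * (1 - 1 ^ n / n) - ?c * ((1 - a) - (1 - a) ^ n / n))"
  proof (rule nn_integral_FTC_Icc[where F = "\<lambda>x. ?c * (x - x ^ n / n)"])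
    fix x :: real assume "x \<in> {1 - a..1}"
    then have x: "1 - a \<le> x" "x \<le> 1" by auto
    show "((\<lambda>x. ?c * (x - x ^ n / n)) has_real_derivative ?c * (1 - x ^ (n - 1))) (at x)"
      using n by (auto intro!: derivative_eq_intros)
    show "0 \<le> ?c * (1 - x ^ (n - 1))" using x a by (auto intro!: mult_nonneg_nonneg power_le_one)
  qed (use a in auto)
  also have "?c * (1 - 1 ^ n / n) - ?c * ((1 - a) - (1 - a) ^ n / n) = pair_mass n a / (4 * pi) / (4 * pi)"
    using n by (simp add: pair_mass_def field_simps power2_eq_square)
  also have "ennreal (4 * pi) * ennreal (pair_mass n a / (4 * pi) / (4 * pi)) = ennreal (pair_mass n a / (4 * pi))"
    by (subst ennreal_mult'[symmetric]) auto
  finally show ?thesis .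
qed

section \<open>Correlation functions\<close>

interpretation surface_prod: product_sigma_finite "\<lambda>_ :: nat. surface_measure"
  by standard

abbreviation sphere_prod :: "nat \<Rightarrow> (nat \<Rightarrow> real^3) measure" where
  "sphere_prod n \<equiv> PiM {..<n} (\<lambda>_. surface_measure)"

lemma space_sphere_prod_D: "x \<in> space (PiM I (\<lambda>_. surface_measure)) \<Longrightarrow> i \<in> I \<Longrightarrow> x i \<in> S2"
  by (auto simp: space_PiM PiE_iff)

lemma finite_measure_sphere_prod: "finite I \<Longrightarrow> finite_measure (PiM I (\<lambda>_ :: nat. surface_measure))"
proof (rule finite_measureI)
  assume "finite I"
  have "emeasure (PiM I (\<lambda>_. surface_measure)) (space (PiM I (\<lambda>_. surface_measure))) = (\<Prod>i\<in>I. emeasure surface_measure S2)"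
    unfolding space_PiM using sets.top[of surface_measure] \<open>finite I\<close>
    by (subst surface_prod.emeasure_PiM) auto
  also have "\<dots> \<noteq> \<infinity>" by (simp add: emeasure_surface_measure_S2 ennreal_power)
  finally show "emeasure (PiM I (\<lambda>_. surface_measure)) (space (PiM I (\<lambda>_. surface_measure))) \<noteq> \<infinity>" .
qed

lemma measure_sphere_prod: "measure (sphere_prod n) (space (sphere_prod n)) = (4 * pi) ^ n"
proof -
  have "emeasure (sphere_prod n) (space (sphere_prod n)) = (\<Prod>i<n. emeasure surface_measure S2)"
    unfolding space_PiM using sets.top[of surface_measure]
    by (subst surface_prod.emeasure_PiM) auto
  then show ?thesis by (simp add: emeasure_surface_measure_S2 measure_def ennreal_power)
qed

lemma sphere_prod_integrableI:
  fixes f :: "(nat \<Rightarrow> real^3) \<Rightarrow> 'b::{banach, second_countable_topology}"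
  assumes "finite I" "f \<in> borel_measurable (PiM I (\<lambda>_. surface_measure))"
    "\<And>x. x \<in> space (PiM I (\<lambda>_. surface_measure)) \<Longrightarrow> norm (f x) \<le> B"
  shows "integrable (PiM I (\<lambda>_. surface_measure)) f"
proof -
  interpret finite_measure "PiM I (\<lambda>_. surface_measure)" by (rule finite_measure_sphere_prod) fact
  show ?thesis using assms by (intro integrable_const_bound[where B = B] AE_I2) auto
qed

lemma measurable_component_comp:
  assumes "i \<in> I" "f \<in> borel \<rightarrow>\<^sub>M N"
  shows "(\<lambda>x. f (x i)) \<in> PiM I (\<lambda>_. surface_measure) \<rightarrow>\<^sub>M N"
  using measurable_compose[OF measurable_component_singleton[OF assms(1)] borel_measurable_surface[OF assms(2)]] .

text \<open>Fubini, with the coordinates from m on integrated out one by one since \<open>h\<close>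
  ignores them. Both integrability statements are later needed to exchange integrals with sums over
  permutations.\<close>

lemma integral_head_times_prod:
  fixes b :: "nat \<Rightarrow> real^3 \<Rightarrow> complex" and h :: "(nat \<Rightarrow> real^3) \<Rightarrow> complex"
  assumes mn: "m \<le> n" and h: "h \<in> borel_measurable (sphere_prod m)"
    and hB: "\<And>y. y \<in> space (sphere_prod m) \<Longrightarrow> cmod (h y) \<le> B"
    and b: "\<And>i. b i \<in> borel_measurable borel" and bC: "\<And>i p. i < n \<Longrightarrow> p \<in> S2 \<Longrightarrow> cmod (b i p) \<le> C i"
  shows "integrable (sphere_prod n) (\<lambda>x. h (restrict x {..<m}) * (\<Prod>i<n. b i (x i)))"
    and "(\<integral>x. h (restrict x {..<m}) * (\<Prod>i<n. b i (x i)) \<partial>sphere_prod n) =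
      (\<integral>y. h y * (\<Prod>i<m. b i (y i)) \<partial>sphere_prod m) * (\<Prod>i\<in>{m..<n}. \<integral>p. b i p \<partial>surface_measure)"
    and "integrable (sphere_prod m) (\<lambda>y. h y * (\<Prod>i<m. b i (y i)))"
proof -
  have r: "(\<lambda>x. restrict x {..<m}) \<in> sphere_prod n \<rightarrow>\<^sub>M sphere_prod m"
    using mn by (intro measurable_restrict_subset) auto
  have hb: "cmod (h y * (\<Prod>i<k. b i (x i))) \<le> B * (\<Prod>i<k. C i)"
    if "y \<in> space (sphere_prod m)" "x \<in> space (sphere_prod k)" "k \<le> n" for x y k
  proof -
    have "0 \<le> B" using hB[OF that(1)] norm_ge_zero order_trans by blast
    moreover have "cmod (b i (x i)) \<le> C i" if "i < k" for i
      using bC[of i "x i"] space_sphere_prod_D[OF \<open>x \<in> _\<close>, of i] that \<open>k \<le> n\<close> by auto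
    then have "(\<Prod>i<k. cmod (b i (x i))) \<le> (\<Prod>i<k. C i)" by (intro prod_mono) auto
    ultimately show ?thesis unfolding norm_mult prod_norm[symmetric] using hB[OF that(1)]
      by (intro mult_mono prod_nonneg) auto
  qed
  have meas: "(\<lambda>x. \<Prod>i<k. b i (x i)) \<in> borel_measurable (sphere_prod k)" for k
    using b by (intro borel_measurable_prod measurable_component_comp) auto
  show int: "integrable (sphere_prod n) (\<lambda>x. h (restrict x {..<m}) * (\<Prod>i<n. b i (x i)))"
  proof (rule sphere_prod_integrableI)
    show "(\<lambda>x. h (restrict x {..<m}) * (\<Prod>i<n. b i (x i))) \<in> borel_measurable (sphere_prod n)"
      by (intro borel_measurable_times measurable_compose[OF r h] meas)
    show "cmod (h (restrict x {..<m}) * (\<Prod>i<n. b i (x i))) \<le> B * (\<Prod>i<n. C i)"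
      if "x \<in> space (sphere_prod n)" for x
      by (rule hb[OF measurable_space[OF r that] that]) simp
  qed simp
  show int': "integrable (sphere_prod m) (\<lambda>y. h y * (\<Prod>i<m. b i (y i)))"
    by (rule sphere_prod_integrableI) (use hb[OF _ _ mn] h meas in auto)
  have un: "{..<m} \<union> {m..<n} = {..<n}" using mn by auto
  have "(\<integral>x. h (restrict x {..<m}) * (\<Prod>i<n. b i (x i)) \<partial>sphere_prod n) =
    (\<integral>y. \<integral>z. h (restrict (merge {..<m} {m..<n} (y, z)) {..<m}) * (\<Prod>i<n. b i (merge {..<m} {m..<n} (y, z) i))
      \<partial>PiM {m..<n} (\<lambda>_. surface_measure) \<partial>sphere_prod m)"
    by (rule surface_prod.product_integral_fold[of "{..<m}" "{m..<n}", unfolded un, OF _ _ _ int]) auto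
  also have "\<dots> = (\<integral>y. h y * (\<Prod>i<m. b i (y i)) * (\<Prod>i\<in>{m..<n}. \<integral>p. b i p \<partial>surface_measure) \<partial>sphere_prod m)"
  proof (rule Bochner_Integration.integral_cong[OF refl])
    fix y assume y: "y \<in> space (sphere_prod m)"
    have 1: "restrict (merge {..<m} {m..<n} (y, z)) {..<m} = y" for z
      using y by (subst restrict_merge) (auto simp: space_PiM PiE_iff extensional_restrict)
    have 2: "(\<Prod>i<n. b i (merge {..<m} {m..<n} (y, z) i)) = (\<Prod>i<m. b i (y i)) * (\<Prod>i\<in>{m..<n}. b i (z i))" for z
      unfolding un[symmetric] by (subst prod.union_disjoint) (auto simp: merge_def intro!: prod.cong arg_cong2[where f = "(*)"])
    have "(\<integral>z. (\<Prod>i\<in>{m..<n}. b i (z i)) \<partial>PiM {m..<n} (\<lambda>_. surface_measure)) = (\<Prod>i\<in>{m..<n}. \<integral>p. b i p \<partial>surface_measure)"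
      using b bC by (intro surface_prod.product_integral_prod surface_integrableI) auto
    then show "(\<integral>z. h (restrict (merge {..<m} {m..<n} (y, z)) {..<m}) * (\<Prod>i<n. b i (merge {..<m} {m..<n} (y, z) i))
      \<partial>PiM {m..<n} (\<lambda>_. surface_measure)) = h y * (\<Prod>i<m. b i (y i)) * (\<Prod>i\<in>{m..<n}. \<integral>p. b i p \<partial>surface_measure)"
      unfolding 1 2 by (simp flip: mult.assoc)
  qed
  also have "\<dots> = (\<integral>y. h y * (\<Prod>i<m. b i (y i)) \<partial>sphere_prod m) * (\<Prod>i\<in>{m..<n}. \<integral>p. b i p \<partial>surface_measure)"
    by simp
  finally show "(\<integral>x. h (restrict x {..<m}) * (\<Prod>i<n. b i (x i)) \<partial>sphere_prod n) =
      (\<integral>y. h y * (\<Prod>i<m. b i (y i)) \<partial>sphere_prod m) * (\<Prod>i\<in>{m..<n}. \<integral>p. b i p \<partial>surface_measure)" .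
qed

text \<open>The m-point correlation function. The matrix is a Gram matrix, so its determinant is
  real and \<open>Re\<close> loses nothing, see \<open>of_real_ker_det\<close>.\<close>

definition ker_det :: "nat \<Rightarrow> nat \<Rightarrow> (nat \<Rightarrow> real^3) \<Rightarrow> real" where
  "ker_det n m y = Re (fdet m (\<lambda>i j. ker n (y i) (y j)))"

lemma fdet_ker_gram: "fdet m (\<lambda>i j. ker n (y i) (y j)) = gram n m (\<lambda>i k. basis_fun n k (y i))"
  by (simp add: gram_def ker_ip)

lemma of_real_ker_det: "complex_of_real (ker_det n m y) = fdet m (\<lambda>i j. ker n (y i) (y j))"
  unfolding ker_det_def fdet_ker_gram by (rule gram_real[symmetric])

lemma ker_det_nonneg: "ker_det n m y \<ge> 0"
  unfolding ker_det_def fdet_ker_gram by (rule gram_nonneg)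

definition slater :: "nat \<Rightarrow> (nat \<Rightarrow> real^3) \<Rightarrow> complex" where
  "slater n x = fdet n (\<lambda>i k. basis_fun n k (x i))"

lemma slater_norm_sq:
  "complex_of_real ((cmod (slater n x))\<^sup>2) = (\<Sum>\<sigma> | \<sigma> permutes {..<n}. \<Sum>\<tau> | \<tau> permutes {..<n}.
     of_int (sign \<sigma>) * of_int (sign \<tau>) * (\<Prod>i<n. basis_fun n (\<sigma> i) (x i) * cnj (basis_fun n (\<tau> i) (x i))))"
  unfolding complex_norm_square slater_def fdet_altdef
  by (simp add: sum_product prod.distrib mult_ac)

lemma basis_prod_bound:
  "p \<in> S2 \<Longrightarrow> cmod (basis_fun n i p * cnj (basis_fun n j p)) \<le>
      sqrt (n * ((n - 1) choose i) / (4 * pi)) * sqrt (n * ((n - 1) choose j) / (4 * pi))"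
  using basis_fun_bound[of p n i] basis_fun_bound[of p n j]
  unfolding norm_mult complex_mod_cnj by (intro mult_mono) auto

lemma measurable_ker_det [measurable]: "ker_det n m \<in> borel_measurable (sphere_prod m)"
proof -
  have "(\<lambda>y. fdet m (\<lambda>i j. ker n (y i) (y j))) \<in> borel_measurable (sphere_prod m)"
    unfolding fdet_altdef ker_def
    by (intro borel_measurable_sum borel_measurable_prod borel_measurable_times borel_measurable_const
        borel_measurable_cnj measurable_component_comp measurable_basis_fun) (auto dest: permutes_in_image)
  then show ?thesis unfolding ker_det_def[abs_def] by measurable
qed

lemma measurable_slater [measurable]: "slater n \<in> borel_measurable (sphere_prod n)"
  unfolding slater_def[abs_def] fdet_altdef
  by (intro borel_measurable_sum borel_measurable_prod borel_measurable_times borel_measurable_const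
        borel_measurable_cnj measurable_component_comp measurable_basis_fun) (auto dest: permutes_in_image)

text \<open>The squared modulus is a double sum over permutations of products in the separate
  points. Orthonormality in the points from m on keeps only pairs of permutations agreeing there,
  and \<open>gaudin_sum\<close> evaluates the rest.\<close>

lemma integral_slater:
  fixes h :: "(nat \<Rightarrow> real^3) \<Rightarrow> real"
  assumes mn: "m \<le> n" and h: "h \<in> borel_measurable (sphere_prod m)"
    and hB: "\<And>y. y \<in> space (sphere_prod m) \<Longrightarrow> \<bar>h y\<bar> \<le> B"
  shows "(\<integral>x. h (restrict x {..<m}) * (cmod (slater n x))\<^sup>2 \<partial>sphere_prod n) =
    fact (n - m) * (\<integral>y. h y * ker_det n m y \<partial>sphere_prod m)"
proof -
  define hc where "hc y = complex_of_real (h y)" for y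
  have hc: "hc \<in> borel_measurable (sphere_prod m)" unfolding hc_def using h by measurable
  have hcB: "\<And>y. y \<in> space (sphere_prod m) \<Longrightarrow> cmod (hc y) \<le> B" using hB by (simp add: hc_def)
  define b where "b \<sigma> \<tau> i p = basis_fun n (\<sigma> i) p * cnj (basis_fun n (\<tau> i) p)" for \<sigma> \<tau> :: "nat \<Rightarrow> nat" and i p
  have bm: "\<And>i. b \<sigma> \<tau> i \<in> borel_measurable borel" for \<sigma> \<tau> unfolding b_def by measurable
  have bC: "cmod (b \<sigma> \<tau> i p) \<le> sqrt (n * ((n - 1) choose \<sigma> i) / (4 * pi)) * sqrt (n * ((n - 1) choose \<tau> i) / (4 * pi))"
    if "i < n" "p \<in> S2" for \<sigma> \<tau> i p
    unfolding b_def by (rule basis_prod_bound) fact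
  have head: "integrable (sphere_prod n) (\<lambda>x. hc (restrict x {..<m}) * (\<Prod>i<n. b \<sigma> \<tau> i (x i)))"
    "(\<integral>x. hc (restrict x {..<m}) * (\<Prod>i<n. b \<sigma> \<tau> i (x i)) \<partial>sphere_prod n) =
      (\<integral>y. hc y * (\<Prod>i<m. b \<sigma> \<tau> i (y i)) \<partial>sphere_prod m) * (\<Prod>i\<in>{m..<n}. \<integral>p. b \<sigma> \<tau> i p \<partial>surface_measure)"
    "integrable (sphere_prod m) (\<lambda>y. hc y * (\<Prod>i<m. b \<sigma> \<tau> i (y i)))" for \<sigma> \<tau>
    by (rule integral_head_times_prod(1)[OF mn hc hcB bm bC], assumption+,
        rule integral_head_times_prod(2)[OF mn hc hcB bm bC], assumption+,
        rule integral_head_times_prod(3)[OF mn hc hcB bm bC], assumption+)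
  define c where "c \<sigma> \<tau> = (of_int (sign \<sigma>) * of_int (sign \<tau>) :: complex)" for \<sigma> \<tau> :: "nat \<Rightarrow> nat"
  let ?P = "{\<sigma>. \<sigma> permutes {..<n}}"
  have finP: "finite ?P" by (simp add: finite_permutations)
  have delta: "(\<Prod>i\<in>{m..<n}. \<integral>p. b \<sigma> \<tau> i p \<partial>surface_measure) = (if \<forall>i\<in>{m..<n}. \<sigma> i = \<tau> i then 1 else 0)"
    if "\<sigma> \<in> ?P" "\<tau> \<in> ?P" for \<sigma> \<tau>
  proof -
    have lt: "\<sigma> i < n" "\<tau> i < n" if "i < n" for i
      using permutes_in_image[of \<sigma> "{..<n}" i] permutes_in_image[of \<tau> "{..<n}" i] \<open>\<sigma> \<in> ?P\<close> \<open>\<tau> \<in> ?P\<close> that by auto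
    have "(\<Prod>i\<in>{m..<n}. \<integral>p. b \<sigma> \<tau> i p \<partial>surface_measure) = (\<Prod>i\<in>{m..<n}. if \<sigma> i = \<tau> i then 1 else 0)"
      unfolding b_def using lt by (intro prod.cong refl basis_fun_orthonormal) auto
    then show ?thesis by (auto intro: prod.neutral)
  qed
  have "complex_of_real (\<integral>x. h (restrict x {..<m}) * (cmod (slater n x))\<^sup>2 \<partial>sphere_prod n) =
    (\<integral>x. (\<Sum>\<sigma>\<in>?P. \<Sum>\<tau>\<in>?P. c \<sigma> \<tau> * (hc (restrict x {..<m}) * (\<Prod>i<n. b \<sigma> \<tau> i (x i)))) \<partial>sphere_prod n)"
    unfolding integral_complex_of_real[symmetric] of_real_mult slater_norm_sq c_def b_def
    by (simp add: hc_def sum_distrib_left mult_ac)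
  also have "\<dots> = (\<Sum>\<sigma>\<in>?P. \<Sum>\<tau>\<in>?P. c \<sigma> \<tau> * (\<integral>x. hc (restrict x {..<m}) * (\<Prod>i<n. b \<sigma> \<tau> i (x i)) \<partial>sphere_prod n))"
    using head(1) by (simp add: integrable_mult_right integral_sum)
  also have "\<dots> = (\<Sum>\<sigma>\<in>?P. \<Sum>\<tau>\<in>?P. if \<forall>i\<in>{m..<n}. \<sigma> i = \<tau> i then
      c \<sigma> \<tau> * (\<integral>y. hc y * (\<Prod>i<m. b \<sigma> \<tau> i (y i)) \<partial>sphere_prod m) else 0)"
  proof (intro sum.cong refl)
    fix \<sigma> \<tau> assume st: "\<sigma> \<in> ?P" "\<tau> \<in> ?P"
    show "c \<sigma> \<tau> * (\<integral>x. hc (restrict x {..<m}) * (\<Prod>i<n. b \<sigma> \<tau> i (x i)) \<partial>sphere_prod n) =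
       (if \<forall>i\<in>{m..<n}. \<sigma> i = \<tau> i then c \<sigma> \<tau> * (\<integral>y. hc y * (\<Prod>i<m. b \<sigma> \<tau> i (y i)) \<partial>sphere_prod m) else 0)"
      unfolding head(2) delta[OF st] by simp
  qed
  also have "\<dots> = (\<Sum>\<sigma>\<in>?P. \<Sum>\<tau> | \<tau> permutes {..<n} \<and> (\<forall>i\<in>{m..<n}. \<sigma> i = \<tau> i).
      c \<sigma> \<tau> * (\<integral>y. hc y * (\<Prod>i<m. b \<sigma> \<tau> i (y i)) \<partial>sphere_prod m))"
    by (intro sum.cong[OF refl]) (simp add: sum.inter_filter[OF finP, symmetric])
  also have "\<dots> = (\<integral>y. (\<Sum>\<sigma>\<in>?P. \<Sum>\<tau> | \<tau> permutes {..<n} \<and> (\<forall>i\<in>{m..<n}. \<sigma> i = \<tau> i).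
      c \<sigma> \<tau> * (hc y * (\<Prod>i<m. b \<sigma> \<tau> i (y i)))) \<partial>sphere_prod m)"
    using head(3) by (simp add: integrable_mult_right integral_sum)
  also have "\<dots> = (\<integral>y. hc y * (fact (n - m) * complex_of_real (ker_det n m y)) \<partial>sphere_prod m)"
  proof (rule Bochner_Integration.integral_cong[OF refl])
    fix y
    show "(\<Sum>\<sigma>\<in>?P. \<Sum>\<tau> | \<tau> permutes {..<n} \<and> (\<forall>i\<in>{m..<n}. \<sigma> i = \<tau> i).
      c \<sigma> \<tau> * (hc y * (\<Prod>i<m. b \<sigma> \<tau> i (y i)))) = hc y * (fact (n - m) * complex_of_real (ker_det n m y))"
      unfolding of_real_ker_det ker_def
      using gaudin_sum[OF mn, of "\<lambda>s i. basis_fun n s (y i)", symmetric]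
      by (simp add: sum_distrib_left b_def c_def mult_ac)
  qed
  also have "\<dots> = complex_of_real (fact (n - m) * (\<integral>y. h y * ker_det n m y \<partial>sphere_prod m))"
    unfolding of_real_mult integral_complex_of_real[symmetric] by (simp add: hc_def mult_ac flip: integral_mult_right_zero)
  finally show ?thesis by (simp only: of_real_eq_iff)
qed


section \<open>The ensemble as a law on the product space, and its exchangeability\<close>

lemma fdet_permute_rows:
  assumes "\<sigma> permutes {..<n}"
  shows "fdet n (\<lambda>i k. A (\<sigma> i) k) = of_int (sign \<sigma>) * fdet n A"
proof -
  have "fdet n (\<lambda>i k. A (\<sigma> i) k) =
    (\<Sum>\<pi> | \<pi> permutes {..<n}. of_int (sign (\<pi> \<circ> \<sigma>)) * (\<Prod>i<n. A (\<sigma> i) ((\<pi> \<circ> \<sigma>) i)))"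
    unfolding fdet_altdef by (subst sum_permutations_compose_right[OF assms]) (rule refl)
  also have "\<dots> = (\<Sum>\<pi> | \<pi> permutes {..<n}. of_int (sign \<sigma>) * (of_int (sign \<pi>) * (\<Prod>i<n. A i (\<pi> i))))"
  proof (intro sum.cong refl)
    fix \<pi> assume "\<pi> \<in> {\<pi>. \<pi> permutes {..<n}}"
    then have "sign (\<pi> \<circ> \<sigma>) = sign \<pi> * sign \<sigma>"
      using assms by (intro sign_compose permutes_imp_permutation[of "{..<n}"]) auto
    moreover have "(\<Prod>i<n. A (\<sigma> i) ((\<pi> \<circ> \<sigma>) i)) = (\<Prod>i<n. A i (\<pi> i))"
      by (subst (2) prod.permute[OF assms]) (simp add: o_def)
    ultimately show "of_int (sign (\<pi> \<circ> \<sigma>)) * (\<Prod>i<n. A (\<sigma> i) ((\<pi> \<circ> \<sigma>) i)) =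
      of_int (sign \<sigma>) * (of_int (sign \<pi>) * (\<Prod>i<n. A i (\<pi> i)))" by simp
  qed
  finally show ?thesis by (simp add: fdet_altdef sum_distrib_left)
qed

lemma distr_sphere_prod_permute:
  assumes \<sigma>: "\<sigma> permutes {..<n}"
  shows "distr (sphere_prod n) (sphere_prod n) (\<lambda>x. \<lambda>i\<in>{..<n}. x (\<sigma> i)) = sphere_prod n"
proof (rule surface_prod.PiM_eqI)
  have lt: "\<sigma> i < n" if "i < n" for i using permutes_in_image[OF \<sigma>, of i] that by simp
  have meas: "(\<lambda>x. \<lambda>i\<in>{..<n}. x (\<sigma> i)) \<in> sphere_prod n \<rightarrow>\<^sub>M sphere_prod n"
    using lt by (intro measurable_restrict measurable_component_singleton) auto
  fix A assume A: "\<And>i. i \<in> {..<n} \<Longrightarrow> A i \<in> sets surface_measure"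
  have inv: "inv_into UNIV \<sigma> i < n" if "i < n" for i
    using permutes_in_image[OF permutes_inv[OF \<sigma>], of i] that by simp
  have "emeasure (distr (sphere_prod n) (sphere_prod n) (\<lambda>x. \<lambda>i\<in>{..<n}. x (\<sigma> i))) (Pi\<^sub>E {..<n} A) =
    emeasure (sphere_prod n) ((\<lambda>x. \<lambda>i\<in>{..<n}. x (\<sigma> i)) -` (Pi\<^sub>E {..<n} A) \<inter> space (sphere_prod n))"
    using A by (intro emeasure_distr[OF meas] sets_PiM_I_finite) auto
  also have "(\<lambda>x. \<lambda>i\<in>{..<n}. x (\<sigma> i)) -` (Pi\<^sub>E {..<n} A) \<inter> space (sphere_prod n) = Pi\<^sub>E {..<n} (\<lambda>i. A (inv_into UNIV \<sigma> i))"
  proof (intro equalityI subsetI)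
    fix x assume x: "x \<in> (\<lambda>x. \<lambda>i\<in>{..<n}. x (\<sigma> i)) -` (Pi\<^sub>E {..<n} A) \<inter> space (sphere_prod n)"
    have "x i \<in> A (inv_into UNIV \<sigma> i)" if "i < n" for i
    proof -
      have "(\<lambda>i\<in>{..<n}. x (\<sigma> i)) (inv_into UNIV \<sigma> i) \<in> A (inv_into UNIV \<sigma> i)"
        using x inv[OF that] by (auto simp: PiE_iff)
      then show ?thesis using inv[OF that] by (simp add: permutes_inverses(1)[OF \<sigma>])
    qed
    then show "x \<in> Pi\<^sub>E {..<n} (\<lambda>i. A (inv_into UNIV \<sigma> i))" using x by (auto simp: space_PiM PiE_iff)
  next
    fix x assume x: "x \<in> Pi\<^sub>E {..<n} (\<lambda>i. A (inv_into UNIV \<sigma> i))"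
    have "x (\<sigma> i) \<in> A i" if "i < n" for i
      using x lt[OF that] permutes_inverses(2)[OF \<sigma>, of i] by (auto simp: PiE_iff dest!: bspec[of _ _ "\<sigma> i"])
    moreover have "x \<in> space (sphere_prod n)"
      using x A[THEN sets.sets_into_space] inv by (fastforce simp: space_PiM PiE_iff)
    ultimately show "x \<in> (\<lambda>x. \<lambda>i\<in>{..<n}. x (\<sigma> i)) -` (Pi\<^sub>E {..<n} A) \<inter> space (sphere_prod n)" by auto
  qed
  also have "emeasure (sphere_prod n) (Pi\<^sub>E {..<n} (\<lambda>i. A (inv_into UNIV \<sigma> i))) =
      (\<Prod>i<n. emeasure surface_measure (A (inv_into UNIV \<sigma> i)))"
    using A inv by (intro surface_prod.emeasure_PiM) auto
  also have "\<dots> = (\<Prod>i<n. emeasure surface_measure (A i))"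
    by (subst (2) prod.permute[OF permutes_inv[OF \<sigma>]]) (simp add: o_def)
  finally show "emeasure (distr (sphere_prod n) (sphere_prod n) (\<lambda>x. \<lambda>i\<in>{..<n}. x (\<sigma> i))) (Pi\<^sub>E {..<n} A) =
    (\<Prod>i<n. emeasure surface_measure (A i))" .
qed (auto simp: sets_distr)

text \<open>A canonical model in which the points are the coordinates; all estimates are made here
  and transferred to arbitrary realizations at the end. The integral of the squared determinant is
  \<open>fact n\<close>.\<close>

definition ensemble :: "nat \<Rightarrow> (nat \<Rightarrow> real^3) measure" where
  "ensemble n = density (sphere_prod n) (\<lambda>x. ennreal ((cmod (slater n x))\<^sup>2 / fact n))"

lemma sets_ensemble [simp, measurable_cong]: "sets (ensemble n) = sets (sphere_prod n)"
  and space_ensemble [simp]: "space (ensemble n) = space (sphere_prod n)"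
  by (simp_all add: ensemble_def)

lemma integral_ensemble:
  fixes f :: "(nat \<Rightarrow> real^3) \<Rightarrow> real"
  assumes "f \<in> borel_measurable (sphere_prod n)"
  shows "(\<integral>x. f x \<partial>ensemble n) = (\<integral>x. f x * (cmod (slater n x))\<^sup>2 \<partial>sphere_prod n) / fact n"
proof -
  have "(\<integral>x. f x \<partial>ensemble n) = (\<integral>x. ((cmod (slater n x))\<^sup>2 / fact n) *\<^sub>R f x \<partial>sphere_prod n)"
    unfolding ensemble_def using assms by (intro integral_density) auto
  also have "\<dots> = (\<integral>x. f x * (cmod (slater n x))\<^sup>2 / fact n \<partial>sphere_prod n)"
    by (simp add: mult.commute)
  finally show ?thesis by simp
qed

text \<open>The product measure is invariant under relabelling, and the determinant changes only by
  a sign.\<close>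

lemma integral_ensemble_permute:
  fixes f :: "(nat \<Rightarrow> real^3) \<Rightarrow> real"
  assumes f: "f \<in> borel_measurable (sphere_prod n)" and \<sigma>: "\<sigma> permutes {..<n}"
  shows "(\<integral>x. f (\<lambda>i\<in>{..<n}. x (\<sigma> i)) \<partial>ensemble n) = (\<integral>x. f x \<partial>ensemble n)"
proof -
  let ?r = "\<lambda>x. \<lambda>i\<in>{..<n}. x (\<sigma> i)"
  have lt: "\<sigma> i < n" if "i < n" for i using permutes_in_image[OF \<sigma>, of i] that by simp
  have meas: "?r \<in> sphere_prod n \<rightarrow>\<^sub>M sphere_prod n"
    using lt by (intro measurable_restrict measurable_component_singleton) auto
  have sl: "cmod (slater n (?r x)) = cmod (slater n x)" for x
  proof -
    have "slater n (?r x) = fdet n (\<lambda>i k. basis_fun n k (x (\<sigma> i)))"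
      unfolding slater_def by (rule fdet_cong) auto
    also have "\<dots> = of_int (sign \<sigma>) * slater n x"
      unfolding slater_def by (rule fdet_permute_rows[OF \<sigma>])
    finally show ?thesis by (simp add: norm_mult sign_def)
  qed
  have "(\<integral>x. f x * (cmod (slater n x))\<^sup>2 \<partial>sphere_prod n) =
     (\<integral>x. f x * (cmod (slater n x))\<^sup>2 \<partial>distr (sphere_prod n) (sphere_prod n) ?r)"
    by (simp only: distr_sphere_prod_permute[OF \<sigma>])
  also have "\<dots> = (\<integral>x. f (?r x) * (cmod (slater n (?r x)))\<^sup>2 \<partial>sphere_prod n)"
    by (intro integral_distr[OF meas] borel_measurable_times f borel_measurable_power
        measurable_compose[OF measurable_slater borel_measurable_norm])
  finally show ?thesis
    using integral_ensemble[OF f] integral_ensemble[OF measurable_compose[OF meas f]] by (simp add: sl)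
qed

lemma prob_space_ensemble: "prob_space (ensemble n)"
proof (rule prob_spaceI)
  have int: "integrable (sphere_prod n) (\<lambda>x. (cmod (slater n x))\<^sup>2)"
  proof (rule sphere_prod_integrableI)
    fix x assume x: "x \<in> space (sphere_prod n)"
    define B where "B = (\<Sum>\<sigma> | \<sigma> permutes {..<n}. \<Prod>i<n. sqrt (n * ((n - 1) choose (\<sigma> i)) / (4 * pi)))"
    have "cmod (slater n x) \<le> B"
      unfolding slater_def fdet_altdef B_def
    proof (rule sum_norm_le)
      fix \<sigma> assume "\<sigma> \<in> {\<sigma>. \<sigma> permutes {..<n}}"
      have "(\<Prod>i<n. cmod (basis_fun n (\<sigma> i) (x i))) \<le> (\<Prod>i<n. sqrt (n * ((n - 1) choose (\<sigma> i)) / (4 * pi)))"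
        using space_sphere_prod_D[OF x] by (intro prod_mono conjI basis_fun_bound) auto
      then show "cmod (of_int (sign \<sigma>) * (\<Prod>i<n. basis_fun n (\<sigma> i) (x i))) \<le> (\<Prod>i<n. sqrt (n * ((n - 1) choose (\<sigma> i)) / (4 * pi)))"
        by (simp add: norm_mult sign_def prod_norm[symmetric])
    qed
    then show "norm ((cmod (slater n x))\<^sup>2) \<le> B\<^sup>2" by (simp add: power_mono)
  qed auto
  have "emeasure (ensemble n) (space (ensemble n)) = (\<integral>\<^sup>+x. ennreal ((cmod (slater n x))\<^sup>2 / fact n) \<partial>sphere_prod n)"
    unfolding space_ensemble unfolding ensemble_def
    by (subst emeasure_density) (auto intro!: nn_integral_cong simp: indicator_def)
  also have "\<dots> = ennreal (\<integral>x. (cmod (slater n x))\<^sup>2 / fact n \<partial>sphere_prod n)"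
    using int by (intro nn_integral_eq_integral) auto
  also have "(\<integral>x. (cmod (slater n x))\<^sup>2 / fact n \<partial>sphere_prod n) = (\<integral>x. 1 * (cmod (slater n x))\<^sup>2 \<partial>sphere_prod n) / fact n"
    by simp
  \<comment> \<open>The case of no observed points: the empty determinant is 1, which leaves the
    normalization \<open>fact n\<close>.\<close>
  also have "(\<integral>x. 1 * (cmod (slater n x))\<^sup>2 \<partial>sphere_prod n) = fact (n - 0) * (\<integral>y. 1 * ker_det n 0 y \<partial>sphere_prod 0)"
    by (rule integral_slater[where B = 1 and h = "\<lambda>_. 1"]) auto
  also have "(\<integral>y. 1 * ker_det n 0 y \<partial>sphere_prod 0) = 1"
    using measure_sphere_prod[of 0] by (simp add: ker_det_def fdet_altdef)
  finally show "emeasure (ensemble n) (space (ensemble n)) = 1" by simp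
qed

text \<open>By exchangeability the selected points may be taken to be the first m; the factor is the
  reciprocal number of ordered m-tuples of distinct labels.\<close>

lemma integral_ensemble_subfamily:
  fixes h :: "(nat \<Rightarrow> real^3) \<Rightarrow> real"
  assumes s: "inj_on s {..<m}" "s ` {..<m} \<subseteq> {..<n}"
    and h: "h \<in> borel_measurable (sphere_prod m)"
    and hB: "\<And>y. y \<in> space (sphere_prod m) \<Longrightarrow> \<bar>h y\<bar> \<le> B"
  shows "(\<integral>x. h (\<lambda>i\<in>{..<m}. x (s i)) \<partial>ensemble n) =
    fact (n - m) / fact n * (\<integral>y. h y * ker_det n m y \<partial>sphere_prod m)"
proof -
  have mn: "m \<le> n" using card_inj_on_le[OF s finite_lessThan] by simp
  obtain \<sigma> where \<sigma>: "\<sigma> permutes {..<n}" "\<And>i. i < m \<Longrightarrow> \<sigma> i = s i"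
    using extend_inj_to_permutation[OF s] by blast
  have r: "(\<lambda>x. restrict x {..<m}) \<in> sphere_prod n \<rightarrow>\<^sub>M sphere_prod m"
    using mn by (intro measurable_restrict_subset) auto
  have hr: "(\<lambda>x. h (restrict x {..<m})) \<in> borel_measurable (sphere_prod n)"
    by (rule measurable_compose[OF r h])
  have "(\<lambda>i\<in>{..<m}. x (s i)) = restrict (\<lambda>i\<in>{..<n}. x (\<sigma> i)) {..<m}" for x :: "nat \<Rightarrow> real^3"
    using mn \<sigma>(2) by (auto simp: restrict_def)
  then have "(\<integral>x. h (\<lambda>i\<in>{..<m}. x (s i)) \<partial>ensemble n) =
      (\<integral>x. h (restrict (\<lambda>i\<in>{..<n}. x (\<sigma> i)) {..<m}) \<partial>ensemble n)" by simp
  also have "\<dots> = (\<integral>x. h (restrict x {..<m}) \<partial>ensemble n)"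
    by (rule integral_ensemble_permute[OF hr \<sigma>(1)])
  also have "\<dots> = fact (n - m) * (\<integral>y. h y * ker_det n m y \<partial>sphere_prod m) / fact n"
    using integral_ensemble[OF hr] integral_slater[OF mn h hB] by simp
  finally show ?thesis by simp
qed

section \<open>Estimates for the correlation of close pairs\<close>

text \<open>Each point \<open>j\<close> interacts with a single earlier point \<open>par j\<close>; the convention \<open>par j = j\<close> marks a
  factor depending on point \<open>j\<close> alone.\<close>

lemma nn_integral_sphere_prod_tree:
  fixes f :: "nat \<Rightarrow> real^3 \<Rightarrow> real^3 \<Rightarrow> ennreal"
  assumes par: "\<And>j. j < m \<Longrightarrow> par j \<le> j"
    and meas: "\<And>j. j < m \<Longrightarrow> (\<lambda>z. f j (fst z) (snd z)) \<in> borel_measurable (borel \<Otimes>\<^sub>M borel)"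
    and C1: "\<And>j p. j < m \<Longrightarrow> par j < j \<Longrightarrow> p \<in> S2 \<Longrightarrow> (\<integral>\<^sup>+q. f j p q \<partial>surface_measure) = C j"
    and C2: "\<And>j. j < m \<Longrightarrow> par j = j \<Longrightarrow> (\<integral>\<^sup>+q. f j q q \<partial>surface_measure) = C j"
  shows "(\<integral>\<^sup>+x. (\<Prod>j<m. f j (x (par j)) (x j)) \<partial>sphere_prod m) = (\<Prod>j<m. C j)"
  using assms
proof (induction m)
  case 0
  show ?case
    using surface_prod.emeasure_PiM[of "{}" "\<lambda>_. S2"] by (simp add: space_PiM)
next
  case (Suc m)
  have fm: "(\<lambda>x. f j (x (par j)) (x j)) \<in> borel_measurable (sphere_prod k)" if "j < k" "j < Suc m" for j k
  proof -
    have "(\<lambda>x. (x (par j), x j)) \<in> sphere_prod k \<rightarrow>\<^sub>M borel \<Otimes>\<^sub>M borel"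
      using that Suc.prems(1)[of j] by (intro measurable_Pair measurable_component_comp[where f = "\<lambda>p. p"]) auto
    from measurable_compose[OF this Suc.prems(2)[of j]] that show ?thesis by simp
  qed
  have ins: "{..<Suc m} = insert m {..<m}" by auto
  \<comment> \<open>The last point is a leaf: since \<open>par j \<le> j\<close>, no earlier factor
    involves it, and integrating it gives \<open>C m\<close> whatever its parent is.\<close>
  have "(\<integral>\<^sup>+x. (\<Prod>j<Suc m. f j (x (par j)) (x j)) \<partial>sphere_prod (Suc m)) =
    (\<integral>\<^sup>+x. \<integral>\<^sup>+y. (\<Prod>j<Suc m. f j ((x(m := y)) (par j)) ((x(m := y)) j)) \<partial>surface_measure \<partial>sphere_prod m)"
    using fm unfolding ins
    by (intro surface_prod.product_nn_integral_insert borel_measurable_prod_ennreal) (auto simp flip: ins)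
  also have "\<dots> = (\<integral>\<^sup>+x. (\<Prod>j<m. f j (x (par j)) (x j)) * C m \<partial>sphere_prod m)"
  proof (rule nn_integral_cong)
    fix x assume x: "x \<in> space (sphere_prod m)"
    have "(\<Prod>j<Suc m. f j ((x(m := y)) (par j)) ((x(m := y)) j)) =
        (\<Prod>j<m. f j (x (par j)) (x j)) * f m ((x(m := y)) (par m)) y" for y
    proof -
      have "(\<Prod>j<m. f j ((x(m := y)) (par j)) ((x(m := y)) j)) = (\<Prod>j<m. f j (x (par j)) (x j))"
      proof (intro prod.cong refl)
        fix j assume "j \<in> {..<m}"
        then have "par j \<noteq> m" "j \<noteq> m" using Suc.prems(1)[of j] by auto
        then show "f j ((x(m := y)) (par j)) ((x(m := y)) j) = f j (x (par j)) (x j)" by simp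
      qed
      then show ?thesis by (simp only: prod.lessThan_Suc fun_upd_same)
    qed
    moreover have "(\<lambda>y. f m ((x(m := y)) (par m)) y) \<in> borel_measurable surface_measure"
    proof -
      have "(\<lambda>y. (if par m = m then y else x (par m), y)) \<in> borel \<rightarrow>\<^sub>M borel \<Otimes>\<^sub>M borel"
        by (cases "par m = m") simp_all
      from measurable_compose[OF this Suc.prems(2)[of m]]
      show ?thesis by (intro borel_measurable_surface) (simp add: fun_upd_def)
    qed
    moreover have "(\<integral>\<^sup>+y. f m ((x(m := y)) (par m)) y \<partial>surface_measure) = C m"
    proof (cases "par m = m")
      case True
      then show ?thesis using Suc.prems(4)[of m] by simp
    next
      case False
      then have "par m < m" using Suc.prems(1)[of m] by simp
      then show ?thesis using Suc.prems(3)[of m "x (par m)"] space_sphere_prod_D[OF x, of "par m"] False by simp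
    qed
    ultimately show "(\<integral>\<^sup>+y. (\<Prod>j<Suc m. f j ((x(m := y)) (par j)) ((x(m := y)) j)) \<partial>surface_measure) =
        (\<Prod>j<m. f j (x (par j)) (x j)) * C m"
      by (simp only: nn_integral_cmult)
  qed
  also have "\<dots> = (\<integral>\<^sup>+x. (\<Prod>j<m. f j (x (par j)) (x j)) \<partial>sphere_prod m) * C m"
    by (intro nn_integral_multc borel_measurable_prod_ennreal fm) auto
  also have "(\<integral>\<^sup>+x. (\<Prod>j<m. f j (x (par j)) (x j)) \<partial>sphere_prod m) = (\<Prod>j<m. C j)"
    using Suc.prems by (intro Suc.IH) auto
  finally show ?case by simp
qed

lemma prod_lessThan_double:
  fixes g :: "nat \<Rightarrow> 'a :: comm_monoid_mult"
  shows "(\<Prod>j<2 * k. g j) = (\<Prod>i<k. g (2 * i) * g (2 * i + 1))"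
  by (induction k) (auto simp: mult_ac)

definition close :: "real \<Rightarrow> real^3 \<Rightarrow> real^3 \<Rightarrow> real" where
  "close t p q = of_bool (dist p q \<le> t)"

text \<open>Points \<open>2 * i\<close> and \<open>2 * i + 1\<close> form the pair number
  \<open>i\<close>; below, the even point of a pair serves as its anchor.\<close>

definition pairing :: "real \<Rightarrow> nat \<Rightarrow> (nat \<Rightarrow> real^3) \<Rightarrow> real" where
  "pairing t k y = (\<Prod>i<k. close t (y (2 * i)) (y (2 * i + 1)))"

text \<open>The correlation function the k pairs would have if there were no interaction between
  different pairs.\<close>

definition rho_prod :: "nat \<Rightarrow> nat \<Rightarrow> (nat \<Rightarrow> real^3) \<Rightarrow> real" where
  "rho_prod n k y = (\<Prod>i<k. rho2 n (y (2 * i)) (y (2 * i + 1)))"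

lemma close_nonneg: "0 \<le> close t p q" and close_le_1: "close t p q \<le> 1"
  by (simp_all add: close_def)

lemma pairing_nonneg: "0 \<le> pairing t k y" and pairing_le_1: "pairing t k y \<le> 1"
  unfolding pairing_def by (auto intro!: prod_nonneg prod_le_1 simp: close_nonneg close_le_1)

lemma close_indicator: "t \<ge> 0 \<Longrightarrow> ennreal (close t p q) = indicator {q. (dist p q)\<^sup>2 / 4 \<le> t\<^sup>2 / 4} q"
  by (auto simp: close_def indicator_def power_mono_iff)

lemma measurable_close: "(\<lambda>z. close t (fst z) (snd z)) \<in> borel_measurable (borel \<Otimes>\<^sub>M borel)"
  unfolding close_def by measurable

lemma measurable_rho2: "(\<lambda>z. rho2 n (fst z) (snd z)) \<in> borel_measurable (borel \<Otimes>\<^sub>M borel)"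
  unfolding rho2_def by measurable

lemma measurable_two_components:
  assumes "i < m" "j < m" "(\<lambda>z. g (fst z) (snd z)) \<in> borel_measurable (borel \<Otimes>\<^sub>M borel)"
  shows "(\<lambda>x. g (x i) (x j)) \<in> borel_measurable (sphere_prod m)"
proof -
  have "(\<lambda>x. (x i, x j)) \<in> sphere_prod m \<rightarrow>\<^sub>M borel \<Otimes>\<^sub>M borel"
    using assms by (intro measurable_Pair measurable_component_comp[where f = "\<lambda>p. p"]) auto
  from measurable_compose[OF this assms(3)] show ?thesis by simp
qed

lemma measurable_pairing: "2 * k \<le> m \<Longrightarrow> pairing t k \<in> borel_measurable (sphere_prod m)"
  unfolding pairing_def[abs_def]
  by (intro borel_measurable_prod measurable_two_components measurable_close) auto

lemma measurable_rho_prod: "2 * k \<le> m \<Longrightarrow> rho_prod n k \<in> borel_measurable (sphere_prod m)"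
  unfolding rho_prod_def[abs_def]
  by (intro borel_measurable_prod measurable_two_components measurable_rho2) auto

lemma rho2_bounds:
  assumes "p \<in> S2" "q \<in> S2"
  shows "0 \<le> rho2 n p q" "rho2 n p q \<le> (n / (4 * pi))\<^sup>2"
proof -
  have "0 \<le> (1 - (dist p q)\<^sup>2 / 4) ^ (n - 1)" "(1 - (dist p q)\<^sup>2 / 4) ^ (n - 1) \<le> 1"
    using dist_S2_le[OF assms] by (auto intro!: zero_le_power power_le_one)
  then show "0 \<le> rho2 n p q" "rho2 n p q \<le> (n / (4 * pi))\<^sup>2"
    unfolding rho2_def by (auto intro!: mult_nonneg_nonneg mult_left_le)
qed

lemma rho_prod_bounds:
  assumes "y \<in> space (sphere_prod m)" "2 * k \<le> m"
  shows "0 \<le> rho_prod n k y" "rho_prod n k y \<le> (n / (4 * pi)) ^ (2 * k)"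
proof -
  have S: "y (2*i) \<in> S2" "y (2*i+1) \<in> S2" if "i < k" for i
    using space_sphere_prod_D[OF assms(1), of "2*i"] space_sphere_prod_D[OF assms(1), of "2*i+1"] assms(2) that by auto
  show "0 \<le> rho_prod n k y" unfolding rho_prod_def using S by (intro prod_nonneg) (auto simp: rho2_bounds)
  have "rho_prod n k y \<le> (\<Prod>i<k. (n / (4 * pi))\<^sup>2)"
    unfolding rho_prod_def using S by (intro prod_mono) (auto simp: rho2_bounds)
  then show "rho_prod n k y \<le> (n / (4 * pi)) ^ (2 * k)" by (simp add: power_mult)
qed

lemma pair_mass_nonneg: "0 \<le> a \<Longrightarrow> a \<le> 1 \<Longrightarrow> 0 \<le> pair_mass n a"
  using Bernoulli_inequality[of "- a" n] mult_left_mono[of "1 - n * a" "(1 - a) ^ n" "real n"]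
  by (simp add: pair_mass_def algebra_simps power2_eq_square)

lemma integral_of_nn_integral:
  fixes f :: "'a \<Rightarrow> real"
  assumes "f \<in> borel_measurable M" "\<And>x. x \<in> space M \<Longrightarrow> 0 \<le> f x" "(\<integral>\<^sup>+x. ennreal (f x) \<partial>M) = ennreal c" "0 \<le> c"
  shows "(\<integral>x. f x \<partial>M) = c"
  using assms by (subst integral_eq_nn_integral) auto

definition pmass :: "nat \<Rightarrow> real \<Rightarrow> real" where
  "pmass n t = pair_mass n (t\<^sup>2 / 4)"

text \<open>Only anchors are compared, so each summand adds one edge between anchors and the
  resulting integral still has tree structure.\<close>

definition crossing :: "nat \<Rightarrow> real \<Rightarrow> (nat \<Rightarrow> real^3) \<Rightarrow> real" where
  "crossing k r y = (\<Sum>j<k. \<Sum>i<j. close r (y (2 * i)) (y (2 * j)))"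

lemma crossing_nonneg: "0 \<le> crossing k r y"
  unfolding crossing_def by (intro sum_nonneg close_nonneg)

section \<open>Integrals over k close pairs at a fixed radius \<open>t\<close>, at most the diameter
  2 of the sphere\<close>

context
  fixes n :: nat and t :: real
  assumes n: "n \<ge> 1" and t: "0 \<le> t" "t \<le> 2"
begin

lemma t_sq: "0 \<le> t\<^sup>2 / 4" "t\<^sup>2 / 4 \<le> 1"
  using t power_mono[of t 2 2] by auto

lemma pmass_nonneg: "0 \<le> pmass n t"
  unfolding pmass_def by (rule pair_mass_nonneg[OF t_sq])

lemma nn_integral_close_rho2:
  "p \<in> S2 \<Longrightarrow> (\<integral>\<^sup>+q. ennreal (close t p q * rho2 n p q) \<partial>surface_measure) = ennreal (pmass n t / (4 * pi))"
  using rho2_cap[OF _ t_sq n, of p] t by (simp add: pmass_def ennreal_mult' close_nonneg close_indicator)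

lemma nn_integral_close:
  "p \<in> S2 \<Longrightarrow> 0 \<le> r \<Longrightarrow> r \<le> 2 \<Longrightarrow> (\<integral>\<^sup>+q. ennreal (close r p q) \<partial>surface_measure) = ennreal (pi * r\<^sup>2)"
  using cap_measure[of p "r\<^sup>2 / 4"] power_mono[of r 2 2] by (simp add: close_indicator)

text \<open>Each odd point hangs on its anchor with weight \<open>close * rho2\<close>, each anchor
  on an earlier point through \<open>g\<close>. Writing the anchor integrals as
  \<open>4 * pi * C i\<close> makes \<open>C i\<close> an average over the sphere and cancels the
  \<open>4 * pi\<close> in the pair integral.\<close>

lemma integral_tree_weights:
  assumes par: "\<And>i. i < k \<Longrightarrow> par i \<le> 2 * i"
    and meas: "\<And>i. i < k \<Longrightarrow> (\<lambda>z. g i (fst z) (snd z)) \<in> borel_measurable (borel \<Otimes>\<^sub>M borel)"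
    and g: "\<And>i p q. 0 \<le> g i p q" and C: "\<And>i. 0 \<le> C i"
    and C1: "\<And>i p. i < k \<Longrightarrow> par i < 2 * i \<Longrightarrow> p \<in> S2 \<Longrightarrow> (\<integral>\<^sup>+q. ennreal (g i p q) \<partial>surface_measure) = ennreal (4 * pi * C i)"
    and C2: "\<And>i. i < k \<Longrightarrow> par i = 2 * i \<Longrightarrow> (\<integral>\<^sup>+q. ennreal (g i q q) \<partial>surface_measure) = ennreal (4 * pi * C i)"
  shows "(\<integral>y. pairing t k y * rho_prod n k y * (\<Prod>i<k. g i (y (par i)) (y (2 * i))) \<partial>sphere_prod (2 * k)) =
    pmass n t ^ k * (\<Prod>i<k. C i)"
proof (rule integral_of_nn_integral)
  \<comment> \<open>Even indices carry the anchor weights and odd ones the pair weights, so two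
    consecutive constants multiply to \<open>pmass n t * C i\<close>.\<close>
  define f where "f j p q = ennreal (if even j then g (j div 2) p q else close t p q * rho2 n p q)" for j p q
  define par' where "par' j = (if even j then par (j div 2) else j - 1)" for j
  define C' where "C' j = ennreal (if even j then 4 * pi * C (j div 2) else pmass n t / (4 * pi))" for j
  have "(\<integral>\<^sup>+y. (\<Prod>j<2*k. f j (y (par' j)) (y j)) \<partial>sphere_prod (2 * k)) = (\<Prod>j<2*k. C' j)"
  proof (rule nn_integral_sphere_prod_tree)
    fix j assume j: "j < 2 * k"
    then have jk: "j div 2 < k" by auto
    show "par' j \<le> j" using par[OF jk] by (auto simp: par'_def)
    show "(\<lambda>z. f j (fst z) (snd z)) \<in> borel_measurable (borel \<Otimes>\<^sub>M borel)"
      using meas[OF jk] measurable_close measurable_rho2 unfolding f_def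
      by (cases "even j") (auto intro!: measurable_compose[OF _ measurable_ennreal])
    show "(\<integral>\<^sup>+q. f j p q \<partial>surface_measure) = C' j" if "par' j < j" "p \<in> S2" for p
      using that C1[OF jk, of p] nn_integral_close_rho2[of p] by (auto simp: f_def C'_def par'_def)
    show "(\<integral>\<^sup>+q. f j q q \<partial>surface_measure) = C' j" if "par' j = j"
    proof -
      have "even j" using that by (auto simp: par'_def split: if_splits elim: oddE)
      then show ?thesis using that C2[OF jk] by (auto simp: f_def C'_def par'_def)
    qed
  qed
  also have "(\<Prod>j<2*k. C' j) = ennreal (pmass n t ^ k * (\<Prod>i<k. C i))"
  proof -
    have "C' (2*i) * C' (2*i+1) = ennreal (pmass n t * C i)" for i
      using pmass_nonneg C[of i] by (simp add: C'_def flip: ennreal_mult)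
    then have "(\<Prod>j<2*k. C' j) = (\<Prod>i<k. ennreal (pmass n t * C i))" by (simp only: prod_lessThan_double)
    also have "\<dots> = ennreal (\<Prod>i<k. pmass n t * C i)"
      using pmass_nonneg C by (intro prod_ennreal) auto
    finally show ?thesis by (simp add: prod.distrib)
  qed
  also have "(\<integral>\<^sup>+y. (\<Prod>j<2*k. f j (y (par' j)) (y j)) \<partial>sphere_prod (2 * k)) =
     (\<integral>\<^sup>+y. ennreal (pairing t k y * rho_prod n k y * (\<Prod>i<k. g i (y (par i)) (y (2 * i)))) \<partial>sphere_prod (2 * k))"
  proof (rule nn_integral_cong)
    fix y assume y: "y \<in> space (sphere_prod (2 * k))"
    have "(\<Prod>j<2*k. f j (y (par' j)) (y j)) =
       (\<Prod>i<k. f (2*i) (y (par' (2*i))) (y (2*i)) * f (2*i+1) (y (par' (2*i+1))) (y (2*i+1)))"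
      by (rule prod_lessThan_double)
    also have "\<dots> = (\<Prod>i<k. ennreal (close t (y (2*i)) (y (2*i+1)) * rho2 n (y (2*i)) (y (2*i+1)) * g i (y (par i)) (y (2*i))))"
    proof (intro prod.cong refl)
      fix i assume "i \<in> {..<k}"
      then have "0 \<le> rho2 n (y (2*i)) (y (2*i+1))"
        using space_sphere_prod_D[OF y, of "2*i"] space_sphere_prod_D[OF y, of "2*i+1"] by (intro rho2_bounds) auto
      then show "f (2*i) (y (par' (2*i))) (y (2*i)) * f (2*i+1) (y (par' (2*i+1))) (y (2*i+1)) =
          ennreal (close t (y (2*i)) (y (2*i+1)) * rho2 n (y (2*i)) (y (2*i+1)) * g i (y (par i)) (y (2*i)))"
        using g by (simp add: f_def par'_def close_nonneg mult_ac flip: ennreal_mult)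
    qed
    also have "\<dots> = ennreal (\<Prod>i<k. close t (y (2*i)) (y (2*i+1)) * rho2 n (y (2*i)) (y (2*i+1)) * g i (y (par i)) (y (2*i)))"
      using g space_sphere_prod_D[OF y] by (intro prod_ennreal mult_nonneg_nonneg close_nonneg rho2_bounds) auto
    finally show "(\<Prod>j<2*k. f j (y (par' j)) (y j)) = ennreal (pairing t k y * rho_prod n k y * (\<Prod>i<k. g i (y (par i)) (y (2 * i))))"
      by (simp add: prod.distrib pairing_def rho_prod_def)
  qed
  finally show "(\<integral>\<^sup>+y. ennreal (pairing t k y * rho_prod n k y * (\<Prod>i<k. g i (y (par i)) (y (2 * i)))) \<partial>sphere_prod (2 * k)) =
    ennreal (pmass n t ^ k * (\<Prod>i<k. C i))" .
  show "(\<lambda>y. pairing t k y * rho_prod n k y * (\<Prod>i<k. g i (y (par i)) (y (2 * i)))) \<in> borel_measurable (sphere_prod (2 * k))"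
  proof (intro borel_measurable_times measurable_pairing measurable_rho_prod borel_measurable_prod measurable_two_components)
    fix i assume "i \<in> {..<k}"
    then show "par i < 2 * k" "2 * i < 2 * k" using par[of i] by auto
    show "(\<lambda>z. g i (fst z) (snd z)) \<in> borel_measurable (borel \<Otimes>\<^sub>M borel)" using \<open>i \<in> _\<close> meas by auto
  qed auto
  show "0 \<le> pairing t k y * rho_prod n k y * (\<Prod>i<k. g i (y (par i)) (y (2 * i)))" if "y \<in> space (sphere_prod (2 * k))" for y
    using g rho_prod_bounds(1)[OF that] by (intro mult_nonneg_nonneg pairing_nonneg prod_nonneg) auto
  show "0 \<le> pmass n t ^ k * (\<Prod>i<k. C i)" using pmass_nonneg C by (intro mult_nonneg_nonneg prod_nonneg) auto
qed


text \<open>All anchors are free: every one is its own parent with weight 1.\<close>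

lemma integral_pairing_rho: "(\<integral>y. pairing t k y * rho_prod n k y \<partial>sphere_prod (2 * k)) = pmass n t ^ k"
  using integral_tree_weights[of k "\<lambda>i. 2 * i" "\<lambda>_ _ _. 1" "\<lambda>_. 1"] by (simp add: emeasure_surface_measure_S2)

text \<open>Anchor \<open>j\<close> is attached to anchor \<open>i\<close> instead of being free;
  \<open>r\<^sup>2 / 4\<close> is the fraction of the sphere covered by a cap of radius
  \<open>r\<close>.\<close>

lemma integral_pairing_rho_close:
  assumes "i < j" "j < k" "0 \<le> r" "r \<le> 2"
  shows "(\<integral>y. pairing t k y * rho_prod n k y * close r (y (2 * i)) (y (2 * j)) \<partial>sphere_prod (2 * k)) = pmass n t ^ k * (r\<^sup>2 / 4)"
proof -
  have "(\<integral>y. pairing t k y * rho_prod n k y * (\<Prod>l<k. (\<lambda>l p q. if l = j then close r p q else 1) l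
      (y ((\<lambda>l. if l = j then 2 * i else 2 * l) l)) (y (2 * l))) \<partial>sphere_prod (2 * k)) =
    pmass n t ^ k * (\<Prod>l<k. (\<lambda>l. if l = j then r\<^sup>2 / 4 else 1) l)"
    using assms measurable_close
    by (intro integral_tree_weights) (auto simp: close_nonneg nn_integral_close emeasure_surface_measure_S2)
  moreover have "(\<Prod>l<k. (if l = j then close r (y (if l = j then 2 * i else 2 * l)) (y (2 * l)) else 1)) =
      (\<Prod>l<k. if l = j then close r (y (2 * i)) (y (2 * j)) else 1)" for y
    by (intro prod.cong) auto
  ultimately show ?thesis using assms by simp
qed

lemma pairing_rho_close_integrable:
  assumes "i < 2 * k" "j < 2 * k"
  shows "integrable (sphere_prod (2 * k)) (\<lambda>y. pairing t k y * rho_prod n k y * close r (y i) (y j))"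
proof (rule sphere_prod_integrableI)
  show "(\<lambda>y. pairing t k y * rho_prod n k y * close r (y i) (y j)) \<in> borel_measurable (sphere_prod (2 * k))"
    using assms by (intro borel_measurable_times measurable_pairing measurable_rho_prod measurable_two_components measurable_close) auto
  fix y assume y: "y \<in> space (sphere_prod (2 * k))"
  have "pairing t k y * rho_prod n k y * close r (y i) (y j) \<le> 1 * (n / (4 * pi)) ^ (2 * k) * 1"
    using rho_prod_bounds[OF y order_refl] pairing_le_1 pairing_nonneg close_le_1 close_nonneg
    by (intro mult_mono mult_nonneg_nonneg) auto
  then show "norm (pairing t k y * rho_prod n k y * close r (y i) (y j)) \<le> (n / (4 * pi)) ^ (2 * k)"
    using rho_prod_bounds[OF y order_refl] by (simp add: abs_mult pairing_nonneg close_nonneg)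
qed simp

lemma integral_pairing_rho_crossing:
  assumes "0 \<le> r" "r \<le> 2"
  shows "integrable (sphere_prod (2 * k)) (\<lambda>y. pairing t k y * rho_prod n k y * crossing k r y)"
    and "(\<integral>y. pairing t k y * rho_prod n k y * crossing k r y \<partial>sphere_prod (2 * k)) \<le> pmass n t ^ k * ((real k)\<^sup>2 * r\<^sup>2 / 4)"
proof -
  show "integrable (sphere_prod (2 * k)) (\<lambda>y. pairing t k y * rho_prod n k y * crossing k r y)"
    unfolding crossing_def sum_distrib_left by (intro Bochner_Integration.integrable_sum pairing_rho_close_integrable) auto
  let ?F = "\<lambda>j i y. pairing t k y * rho_prod n k y * close r (y (2 * i)) (y (2 * j))"
  have "(\<integral>y. pairing t k y * rho_prod n k y * crossing k r y \<partial>sphere_prod (2 * k)) = (\<integral>y. (\<Sum>j<k. \<Sum>i<j. ?F j i y) \<partial>sphere_prod (2 * k))"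
    unfolding crossing_def sum_distrib_left ..
  also have "\<dots> = (\<Sum>j<k. \<integral>y. (\<Sum>i<j. ?F j i y) \<partial>sphere_prod (2 * k))"
    by (intro Bochner_Integration.integral_sum Bochner_Integration.integrable_sum pairing_rho_close_integrable) auto
  also have "\<dots> = (\<Sum>j<k. \<Sum>i<j. \<integral>y. ?F j i y \<partial>sphere_prod (2 * k))"
    by (intro sum.cong refl Bochner_Integration.integral_sum pairing_rho_close_integrable) auto
  also have "\<dots> = (\<Sum>j<k. \<Sum>i<j. pmass n t ^ k * (r\<^sup>2 / 4))"
    by (intro sum.cong refl integral_pairing_rho_close) (use assms in auto)
  also have "\<dots> \<le> (\<Sum>j<k. \<Sum>i<k. pmass n t ^ k * (r\<^sup>2 / 4))"
    using pmass_nonneg by (intro sum_mono sum_mono2) auto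
  finally show "(\<integral>y. pairing t k y * rho_prod n k y * crossing k r y \<partial>sphere_prod (2 * k)) \<le> pmass n t ^ k * ((real k)\<^sup>2 * r\<^sup>2 / 4)"
    by (simp add: power2_eq_square mult_ac)
qed

text \<open>Every point is within \<open>t\<close> of its anchor, so two points of different pairs
  at distance \<open>d\<close> force their anchors within \<open>d + 2 * t\<close>.\<close>

lemma crossing_ge_1:
  assumes "pairing t k y \<noteq> 0" "a < 2 * k" "b < 2 * k" "a div 2 \<noteq> b div 2" "dist (y a) (y b) \<le> d"
  shows "1 \<le> crossing k (d + 2 * t) y"
proof -
  have pr: "dist (y a) (y (2 * (a div 2))) \<le> t" if "a < 2 * k" for a
  proof -
    have "close t (y (2 * (a div 2))) (y (2 * (a div 2) + 1)) \<noteq> 0"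
      using assms(1) that unfolding pairing_def by (subst (asm) prod_zero_iff) auto
    then have "dist (y (2 * (a div 2))) (y (2 * (a div 2) + 1)) \<le> t" by (simp add: close_def)
    moreover have "a = 2 * (a div 2) \<or> a = 2 * (a div 2) + 1" by linarith
    ultimately show ?thesis using t by (auto simp: dist_commute)
  qed
  have "dist (y (2 * (a div 2))) (y (2 * (b div 2))) \<le> dist (y (2 * (a div 2))) (y a) + dist (y a) (y b) + dist (y b) (y (2 * (b div 2)))"
    using dist_triangle[of "y (2 * (a div 2))" "y (2 * (b div 2))" "y a"] dist_triangle[of "y a" "y (2 * (b div 2))" "y b"] by linarith
  then have d: "dist (y (2 * (a div 2))) (y (2 * (b div 2))) \<le> d + 2 * t"
    using pr[OF assms(2)] pr[OF assms(3)] assms(5) by (simp add: dist_commute)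
  have *: "1 \<le> crossing k (d + 2 * t) y" if "i < j" "j < k" "dist (y (2 * i)) (y (2 * j)) \<le> d + 2 * t" for i j
  proof -
    have "1 = close (d + 2 * t) (y (2 * i)) (y (2 * j))" using that by (simp add: close_def)
    also have "\<dots> \<le> (\<Sum>i<j. close (d + 2 * t) (y (2 * i)) (y (2 * j)))"
      using that by (intro member_le_sum) (auto simp: close_nonneg)
    also have "\<dots> \<le> crossing k (d + 2 * t) y"
      unfolding crossing_def using that by (intro member_le_sum[of j "{..<k}" "\<lambda>j. \<Sum>i<j. close (d + 2 * t) (y (2 * i)) (y (2 * j))"])
        (auto intro!: sum_nonneg simp: close_nonneg)
    finally show ?thesis .
  qed
  show ?thesis
  proof (cases "a div 2 < b div 2")
    case True
    then show ?thesis using *[of "a div 2" "b div 2"] d assms by auto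
  next
    case False
    then show ?thesis using *[of "b div 2" "a div 2"] d assms by (auto simp: dist_commute)
  qed
qed

text \<open>Fischer's inequality: kernel values are inner products of basis vectors, and the Gram
  determinant of one pair is \<open>rho2\<close>.\<close>

lemma ker_det_le_rho_prod:
  assumes y: "y \<in> space (sphere_prod m)" and k: "2 * k \<le> m"
  shows "ker_det n (2 * k) y \<le> rho_prod n k y"
proof -
  have "ker_det n (2 * k) y \<le> (\<Prod>i<k. Re (ker n (y (2*i)) (y (2*i))) * Re (ker n (y (2*i+1)) (y (2*i+1)))
      - (cmod (ker n (y (2*i)) (y (2*i+1))))\<^sup>2)"
    using gram_pairs_le[of n k "\<lambda>i k. basis_fun n k (y i)"] by (simp add: ker_det_def gram_def ker_ip)
  also have "\<dots> = rho_prod n k y"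
    unfolding rho_prod_def
  proof (intro prod.cong refl)
    fix i assume "i \<in> {..<k}"
    then have S: "y (2*i) \<in> S2" "y (2*i+1) \<in> S2"
      using space_sphere_prod_D[OF y, of "2*i"] space_sphere_prod_D[OF y, of "2*i+1"] k by auto
    then show "Re (ker n (y (2*i)) (y (2*i))) * Re (ker n (y (2*i+1)) (y (2*i+1))) - (cmod (ker n (y (2*i)) (y (2*i+1))))\<^sup>2
        = rho2 n (y (2*i)) (y (2*i+1))"
      unfolding ker_self[OF n S(1)] ker_self[OF n S(2)] ker_norm_sq[OF n S] rho2_def
      by (simp add: right_diff_distrib power2_eq_square)
  qed
  finally show ?thesis .
qed

text \<open>A further point multiplies the correlation function by at most its own intensity, the
  value of the kernel on the diagonal.\<close>

lemma ker_det_Suc_le: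
  assumes y: "y \<in> space (sphere_prod (Suc m))"
  shows "ker_det n (Suc m) y \<le> ker_det n m y * (n / (4 * pi))"
  using gram_Suc_le[of n m "\<lambda>i k. basis_fun n k (y i)"] space_sphere_prod_D[OF y, of m] n
  by (simp add: ker_det_def fdet_ker_gram ker_self flip: ker_ip)

text \<open>Deleting the kernel entries between different pairs turns the determinant into exactly
  \<open>rho_prod\<close>. The separation \<open>d\<close> makes those entries small, and
  \<open>norm_fdet_diff_le\<close> bounds the effect of deleting them.\<close>

lemma ker_det_near_rho_prod:
  assumes y: "y \<in> space (sphere_prod (2 * k))" and d: "0 \<le> d" "d \<le> 2"
    and sep: "\<And>a b. a < 2 * k \<Longrightarrow> b < 2 * k \<Longrightarrow> a div 2 \<noteq> b div 2 \<Longrightarrow> d \<le> dist (y a) (y b)"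
  shows "\<bar>ker_det n (2 * k) y - rho_prod n k y\<bar> \<le> fact (2 * k) * ((n / (4 * pi)) ^ (2 * k) * sqrt ((1 - d\<^sup>2 / 4) ^ (n - 1)))"
proof -
  let ?c = "n / (4 * pi)"
  have S: "y i \<in> S2" if "i < 2 * k" for i using space_sphere_prod_D[OF y] that by auto
  have kn: "cmod (ker n p q) = ?c * sqrt ((1 - (dist p q)\<^sup>2 / 4) ^ (n - 1))" if "p \<in> S2" "q \<in> S2" for p q
  proof -
    have "cmod (ker n p q) = sqrt ((cmod (ker n p q))\<^sup>2)" by simp
    also have "\<dots> = ?c * sqrt ((1 - (dist p q)\<^sup>2 / 4) ^ (n - 1))"
      unfolding ker_norm_sq[OF n that] real_sqrt_mult by simp
    finally show ?thesis .
  qed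
  have herm: "ker n q p = cnj (ker n p q)" for p q by (simp add: ker_ip ip_cnj)
  have "fdet (2 * k) (\<lambda>i j. if i div 2 = j div 2 then ker n (y i) (y j) else 0) = of_real (rho_prod n k y)"
    unfolding fdet_blocks rho_prod_def of_real_prod
  proof (intro prod.cong refl)
    fix i assume "i \<in> {..<k}"
    then have s: "y (2*i) \<in> S2" "y (2*i+1) \<in> S2" using S[of "2*i"] S[of "2*i+1"] by auto
    have "ker n (y (2*i)) (y (2*i+1)) * ker n (y (2*i+1)) (y (2*i)) = of_real ((cmod (ker n (y (2*i)) (y (2*i+1))))\<^sup>2)"
      unfolding herm[of "y (2*i+1)" "y (2*i)"] complex_norm_square ..
    then show "ker n (y (2*i)) (y (2*i)) * ker n (y (2*i+1)) (y (2*i+1)) - ker n (y (2*i)) (y (2*i+1)) * ker n (y (2*i+1)) (y (2*i))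
        = of_real (rho2 n (y (2*i)) (y (2*i+1)))"
      unfolding ker_self[OF n s(1)] ker_self[OF n s(2)] ker_norm_sq[OF n s] rho2_def
      by (simp add: right_diff_distrib power2_eq_square)
  qed
  moreover have "cmod (fdet (2 * k) (\<lambda>i j. ker n (y i) (y j)) - fdet (2 * k) (\<lambda>i j. if i div 2 = j div 2 then ker n (y i) (y j) else 0))
     \<le> fact (2 * k) * (?c ^ (2 * k) * sqrt ((1 - d\<^sup>2 / 4) ^ (n - 1)))"
  proof (rule norm_fdet_diff_le[where b = "\<lambda>i. i div 2"])
    fix i j assume ij: "i < 2 * k" "j < 2 * k"
    have b: "0 \<le> 1 - (dist (y i) (y j))\<^sup>2 / 4" using dist_S2_le[of "y i" "y j"] S ij by simp
    then have "(1 - (dist (y i) (y j))\<^sup>2 / 4) ^ (n - 1) \<le> 1" by (intro power_le_one) auto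
    then have "sqrt ((1 - (dist (y i) (y j))\<^sup>2 / 4) ^ (n - 1)) \<le> 1" by simp
    then show "cmod (ker n (y i) (y j)) \<le> ?c" unfolding kn[OF S[OF ij(1)] S[OF ij(2)]] by (intro mult_left_le) auto
    assume "i div 2 \<noteq> j div 2"
    then have "d\<^sup>2 \<le> (dist (y i) (y j))\<^sup>2" using sep[OF ij] d by (intro power_mono) auto
    then have "(1 - (dist (y i) (y j))\<^sup>2 / 4) ^ (n - 1) \<le> (1 - d\<^sup>2 / 4) ^ (n - 1)"
      using b by (intro power_mono) auto
    then show "cmod (ker n (y i) (y j)) \<le> ?c * sqrt ((1 - d\<^sup>2 / 4) ^ (n - 1))"
      unfolding kn[OF S[OF ij(1)] S[OF ij(2)]] by (intro mult_left_mono real_sqrt_le_mono) auto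
  qed (use d power_mono[of d 2 2] in \<open>auto intro!: zero_le_power\<close>)
  ultimately have "cmod (of_real (ker_det n (2 * k) y) - of_real (rho_prod n k y)) \<le> fact (2 * k) * (?c ^ (2 * k) * sqrt ((1 - d\<^sup>2 / 4) ^ (n - 1)))"
    by (simp add: of_real_ker_det)
  then show ?thesis by (simp only: norm_of_real flip: of_real_diff)
qed

end

text \<open>An indicator written as a truncated count, so that measurability follows from that of
  \<open>close\<close>.\<close>

definition cross_close :: "real \<Rightarrow> nat \<Rightarrow> (nat \<Rightarrow> real^3) \<Rightarrow> real" where
  "cross_close t k y = min 1 (\<Sum>a<2 * k. \<Sum>b<2 * k. of_bool (a div 2 \<noteq> b div 2) * close t (y a) (y b))"

lemma cross_close_nonneg: "0 \<le> cross_close t k y" and cross_close_le_1: "cross_close t k y \<le> 1"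
  unfolding cross_close_def by (auto intro!: sum_nonneg simp: close_nonneg)

lemma cross_close_eq_1:
  assumes "a < 2 * k" "b < 2 * k" "a div 2 \<noteq> b div 2" "dist (y a) (y b) \<le> t"
  shows "cross_close t k y = 1"
proof -
  let ?f = "\<lambda>a b. of_bool (a div 2 \<noteq> b div 2) * close t (y a) (y b)"
  have "1 = ?f a b" using assms by (simp add: close_def)
  also have "\<dots> \<le> (\<Sum>b<2 * k. ?f a b)" using assms by (intro member_le_sum[of b _ "?f a"]) (auto simp: close_nonneg)
  also have "\<dots> \<le> (\<Sum>a<2 * k. \<Sum>b<2 * k. ?f a b)"
    using assms by (intro member_le_sum[of a _ "\<lambda>a. \<Sum>b<2 * k. ?f a b"]) (auto intro!: sum_nonneg simp: close_nonneg)
  finally show ?thesis by (simp add: cross_close_def)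
qed

lemma cross_closeE:
  assumes "cross_close t k y \<noteq> 0"
  obtains a b where "a < 2 * k" "b < 2 * k" "a div 2 \<noteq> b div 2" "dist (y a) (y b) \<le> t"
proof -
  have "\<exists>a<2 * k. \<exists>b<2 * k. a div 2 \<noteq> b div 2 \<and> dist (y a) (y b) \<le> t"
  proof (rule ccontr)
    assume "\<not> ?thesis"
    then have "(\<Sum>a<2 * k. \<Sum>b<2 * k. of_bool (a div 2 \<noteq> b div 2) * close t (y a) (y b)) = 0"
      by (intro sum.neutral ballI) (auto simp: close_def)
    then show False using assms by (simp add: cross_close_def)
  qed
  then show ?thesis using that by blast
qed

lemma measurable_cross_close: "2 * k \<le> m \<Longrightarrow> cross_close t k \<in> borel_measurable (sphere_prod m)"
  unfolding cross_close_def[abs_def]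
  by (intro borel_measurable_min borel_measurable_const borel_measurable_sum borel_measurable_times
      measurable_two_components measurable_close) auto

text \<open>Hadamard's inequality by adding one point at a time; it supplies the boundedness behind
  the integrability claims.\<close>

lemma ker_det_le_power:
  assumes "n \<ge> 1" "y \<in> space (sphere_prod m)"
  shows "ker_det n m y \<le> (n / (4 * pi)) ^ m"
  using assms(2)
proof (induction m arbitrary: y)
  case 0
  show ?case by (simp add: ker_det_def fdet_altdef)
next
  case (Suc m)
  have "ker_det n m y = ker_det n m (restrict y {..<m})"
    unfolding ker_det_def by (intro arg_cong[where f = Re] fdet_cong) auto
  moreover have "restrict y {..<m} \<in> space (sphere_prod m)"
    using Suc.prems by (auto simp: space_PiM PiE_iff)
  ultimately have "ker_det n m y \<le> (n / (4 * pi)) ^ m" using Suc.IH by simp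
  then have "ker_det n m y * (n / (4 * pi)) \<le> (n / (4 * pi)) ^ m * (n / (4 * pi))" by (intro mult_right_mono) auto
  \<comment> \<open>The value 0 merely instantiates the radius of the surrounding context.\<close>
  then show ?case using ker_det_Suc_le[OF assms(1) _ _ Suc.prems, of 0] by (simp add: mult_ac)
qed

lemma integrable_times_ker_det:
  assumes "n \<ge> 1" "h \<in> borel_measurable (sphere_prod m)" "\<And>y. y \<in> space (sphere_prod m) \<Longrightarrow> \<bar>h y\<bar> \<le> 1"
  shows "integrable (sphere_prod m) (\<lambda>y. h y * ker_det n m y)"
proof (rule sphere_prod_integrableI)
  fix y assume y: "y \<in> space (sphere_prod m)"
  have "\<bar>h y\<bar> * ker_det n m y \<le> 1 * (n / (4 * pi)) ^ m"
    using assms(3)[OF y] ker_det_le_power[OF assms(1) y] ker_det_nonneg by (intro mult_mono) auto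
  then show "norm (h y * ker_det n m y) \<le> (n / (4 * pi)) ^ m" by (simp add: abs_mult ker_det_nonneg)
qed (intro finite_lessThan borel_measurable_times assms measurable_ker_det)+

text \<open>Where points of different pairs are at least \<open>d\<close> apart, the determinant is
  within the kernel error of \<open>rho_prod\<close>. Elsewhere both lie between 0 and
  \<open>rho_prod\<close>, and the anchors cross at radius \<open>d + 2 * t\<close>, which is
  rare.\<close>

lemma integral_pairing_ker_det:
  assumes n: "n \<ge> 1" and t: "0 \<le> t" and d: "0 \<le> d" "d + 2 * t \<le> 2"
  shows "\<bar>(\<integral>y. pairing t k y * ker_det n (2 * k) y \<partial>sphere_prod (2 * k)) - pmass n t ^ k\<bar> \<le>
    pmass n t ^ k * ((real k)\<^sup>2 * (d + 2 * t)\<^sup>2 / 4) + fact (2 * k) * (real n ^ (2 * k) * sqrt ((1 - d\<^sup>2 / 4) ^ (n - 1)))"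
proof -
  have t2: "t \<le> 2" using t d by simp
  let ?S = "sphere_prod (2 * k)"
  let ?\<epsilon> = "fact (2 * k) * ((n / (4 * pi)) ^ (2 * k) * sqrt ((1 - d\<^sup>2 / 4) ^ (n - 1)))"
  have int1: "integrable ?S (\<lambda>y. pairing t k y * ker_det n (2 * k) y)"
    using n by (intro integrable_times_ker_det measurable_pairing) (auto simp: pairing_nonneg pairing_le_1)
  have int2: "integrable ?S (\<lambda>y. pairing t k y * rho_prod n k y)"
  proof (rule sphere_prod_integrableI)
    fix y assume y: "y \<in> space ?S"
    have "pairing t k y * rho_prod n k y \<le> 1 * (n / (4 * pi)) ^ (2 * k)"
      using rho_prod_bounds[OF y order_refl] by (intro mult_mono pairing_le_1 pairing_nonneg) auto
    then show "norm (pairing t k y * rho_prod n k y) \<le> (n / (4 * pi)) ^ (2 * k)"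
      using rho_prod_bounds[OF y order_refl] by (simp add: pairing_nonneg)
  qed (auto intro!: borel_measurable_times measurable_pairing measurable_rho_prod)
  have \<epsilon>: "0 \<le> ?\<epsilon>" using d t power_mono[of d 2 2] by (intro mult_nonneg_nonneg) auto
  have int3: "integrable ?S (\<lambda>y. pairing t k y * rho_prod n k y * crossing k (d + 2 * t) y)"
    using d t by (intro integral_pairing_rho_crossing(1)[OF n t t2]) auto
  interpret S: finite_measure ?S by (rule finite_measure_sphere_prod) simp
  have "\<bar>(\<integral>y. pairing t k y * ker_det n (2 * k) y \<partial>?S) - pmass n t ^ k\<bar> =
      \<bar>\<integral>y. pairing t k y * ker_det n (2 * k) y - pairing t k y * rho_prod n k y \<partial>?S\<bar>"
    using int1 int2 integral_pairing_rho[OF n t t2, of k] by simp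
  also have "\<dots> \<le> (\<integral>y. \<bar>pairing t k y * ker_det n (2 * k) y - pairing t k y * rho_prod n k y\<bar> \<partial>?S)"
    by (rule integral_abs_bound)
  also have "\<dots> \<le> (\<integral>y. pairing t k y * rho_prod n k y * crossing k (d + 2 * t) y + ?\<epsilon> \<partial>?S)"
  proof (rule integral_mono)
    fix y assume y: "y \<in> space ?S"
    have R: "0 \<le> rho_prod n k y" by (rule rho_prod_bounds(1)[OF y order_refl])
    show "\<bar>pairing t k y * ker_det n (2 * k) y - pairing t k y * rho_prod n k y\<bar> \<le>
      pairing t k y * rho_prod n k y * crossing k (d + 2 * t) y + ?\<epsilon>"
    proof (cases "pairing t k y = 0")
      case True
      then show ?thesis using \<epsilon> by simp
    next
      case False
      show ?thesis
      proof (cases "\<forall>a<2 * k. \<forall>b<2 * k. a div 2 \<noteq> b div 2 \<longrightarrow> d \<le> dist (y a) (y b)")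
        case True
        then have "\<bar>ker_det n (2 * k) y - rho_prod n k y\<bar> \<le> ?\<epsilon>"
          using d t by (intro ker_det_near_rho_prod[OF n t t2 y]) auto
        then have "pairing t k y * \<bar>ker_det n (2 * k) y - rho_prod n k y\<bar> \<le> 1 * ?\<epsilon>"
          by (intro mult_mono pairing_le_1) auto
        moreover have "0 \<le> pairing t k y * rho_prod n k y * crossing k (d + 2 * t) y"
          using R pairing_nonneg crossing_nonneg by (intro mult_nonneg_nonneg) auto
        moreover have "\<bar>pairing t k y * ker_det n (2 * k) y - pairing t k y * rho_prod n k y\<bar> =
            pairing t k y * \<bar>ker_det n (2 * k) y - rho_prod n k y\<bar>"
          by (simp add: abs_mult pairing_nonneg flip: right_diff_distrib)
        ultimately show ?thesis by linarith
      next
        case F: False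
        then obtain a b where "a < 2 * k" "b < 2 * k" "a div 2 \<noteq> b div 2" "dist (y a) (y b) \<le> d"
          by (auto simp: not_le intro: less_imp_le)
        then have "1 \<le> crossing k (d + 2 * t) y" by (intro crossing_ge_1[OF n t t2 False])
        then have "pairing t k y * rho_prod n k y * 1 \<le> pairing t k y * rho_prod n k y * crossing k (d + 2 * t) y"
          using R by (intro mult_left_mono mult_nonneg_nonneg pairing_nonneg) auto
        moreover have "0 \<le> pairing t k y * ker_det n (2 * k) y" "pairing t k y * ker_det n (2 * k) y \<le> pairing t k y * rho_prod n k y"
          using ker_det_le_rho_prod[OF n t t2 y order_refl] ker_det_nonneg
          by (auto intro!: mult_nonneg_nonneg mult_left_mono pairing_nonneg)
        ultimately show ?thesis using \<epsilon> by linarith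
      qed
    qed
  qed (use int1 int2 int3 in auto)
  also have "\<dots> = (\<integral>y. pairing t k y * rho_prod n k y * crossing k (d + 2 * t) y \<partial>?S) + ?\<epsilon> * (4 * pi) ^ (2 * k)"
    using int3 by (simp add: measure_sphere_prod)
  also have "\<dots> \<le> pmass n t ^ k * ((real k)\<^sup>2 * (d + 2 * t)\<^sup>2 / 4) + ?\<epsilon> * (4 * pi) ^ (2 * k)"
    using d t by (intro add_right_mono integral_pairing_rho_crossing(2)[OF n t t2]) auto
  \<comment> \<open>The total mass of the product of spheres cancels the powers of
    \<open>4 * pi\<close> in the uniform error.\<close>
  also have "?\<epsilon> * (4 * pi) ^ (2 * k) = fact (2 * k) * (real n ^ (2 * k) * sqrt ((1 - d\<^sup>2 / 4) ^ (n - 1)))"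
    by (simp add: power_divide)
  finally show ?thesis .
qed

text \<open>A contact at distance \<open>t\<close> between different pairs forces their anchors
  within \<open>3 * t\<close>; Fischer's inequality then permits replacing the determinant by
  \<open>rho_prod\<close>.\<close>

lemma integral_cross_close_ker_det:
  assumes n: "n \<ge> 1" and t: "0 \<le> t" "3 * t \<le> 2"
  shows "(\<integral>y. pairing t k y * cross_close t k y * ker_det n (2 * k) y \<partial>sphere_prod (2 * k)) \<le>
    pmass n t ^ k * ((real k)\<^sup>2 * (3 * t)\<^sup>2 / 4)"
proof -
  have t2: "t \<le> 2" using t by simp
  let ?S = "sphere_prod (2 * k)"
  have int1: "integrable ?S (\<lambda>y. pairing t k y * cross_close t k y * ker_det n (2 * k) y)"
    using n by (intro integrable_times_ker_det borel_measurable_times measurable_pairing measurable_cross_close)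
      (auto simp: pairing_nonneg pairing_le_1 cross_close_nonneg cross_close_le_1 abs_mult intro!: mult_le_one)
  have int3: "integrable ?S (\<lambda>y. pairing t k y * rho_prod n k y * crossing k (3 * t) y)"
    using t by (intro integral_pairing_rho_crossing(1)[OF n t(1) t2]) auto
  have "(\<integral>y. pairing t k y * cross_close t k y * ker_det n (2 * k) y \<partial>?S) \<le> (\<integral>y. pairing t k y * rho_prod n k y * crossing k (3 * t) y \<partial>?S)"
  proof (rule integral_mono[OF int1 int3])
    fix y assume y: "y \<in> space ?S"
    have R: "0 \<le> rho_prod n k y" by (rule rho_prod_bounds(1)[OF y order_refl])
    have nn: "0 \<le> pairing t k y * rho_prod n k y * crossing k (3 * t) y"
      using R pairing_nonneg crossing_nonneg by (intro mult_nonneg_nonneg) auto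
    show "pairing t k y * cross_close t k y * ker_det n (2 * k) y \<le> pairing t k y * rho_prod n k y * crossing k (3 * t) y"
    proof (cases "pairing t k y = 0 \<or> cross_close t k y = 0")
      case True
      then show ?thesis using nn by auto
    next
      case False
      then obtain a b where "a < 2 * k" "b < 2 * k" "a div 2 \<noteq> b div 2" "dist (y a) (y b) \<le> t"
        by (auto elim: cross_closeE)
      note ab = this
      then have "1 \<le> crossing k (t + 2 * t) y" using False by (intro crossing_ge_1[OF n t(1) t2]) auto
      then have 1: "pairing t k y * rho_prod n k y * 1 \<le> pairing t k y * rho_prod n k y * crossing k (3 * t) y"
        using R by (intro mult_left_mono mult_nonneg_nonneg pairing_nonneg) auto
      have "cross_close t k y = 1" by (rule cross_close_eq_1[OF ab])
      moreover have "pairing t k y * ker_det n (2 * k) y \<le> pairing t k y * rho_prod n k y"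
        using ker_det_le_rho_prod[OF n t(1) t2 y order_refl] by (intro mult_left_mono pairing_nonneg)
      ultimately show ?thesis using 1 by simp
    qed
  qed
  also have "\<dots> \<le> pmass n t ^ k * ((real k)\<^sup>2 * (3 * t)\<^sup>2 / 4)"
    using t by (intro integral_pairing_rho_crossing(2)[OF n t(1) t2]) auto
  finally show ?thesis .
qed

text \<open>Point \<open>2 * k\<close> is the additional one. It enters the determinant at a cost of
  at most \<open>n / (4 * pi)\<close> and ranges over a cap of area
  \<open>pi * t\<^sup>2\<close>.\<close>

lemma integral_extra_point_ker_det:
  assumes n: "n \<ge> 1" and t: "0 \<le> t" "t \<le> 2" and a: "a < 2 * k"
  shows "(\<integral>y. pairing t k y * close t (y a) (y (2 * k)) * ker_det n (Suc (2 * k)) y \<partial>sphere_prod (Suc (2 * k))) \<le>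
    pmass n t ^ k * (n * t\<^sup>2 / 4)"
proof -
  let ?S = "sphere_prod (Suc (2 * k))"
  define F where "F y = pairing t k y * rho_prod n k y * (close t (y a) (y (2 * k)) * (n / (4 * pi)))" for y
  have int1: "integrable ?S (\<lambda>y. pairing t k y * close t (y a) (y (2 * k)) * ker_det n (Suc (2 * k)) y)"
    using n a by (intro integrable_times_ker_det borel_measurable_times measurable_pairing measurable_two_components measurable_close)
      (auto simp: pairing_nonneg pairing_le_1 close_nonneg close_le_1 abs_mult intro!: mult_le_one)
  have F: "integrable ?S F"
  proof (rule sphere_prod_integrableI)
    fix y assume y: "y \<in> space ?S"
    have R: "0 \<le> rho_prod n k y" "rho_prod n k y \<le> (n / (4 * pi)) ^ (2 * k)"
      using rho_prod_bounds[OF y, of k n] by auto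
    have "F y \<le> 1 * (n / (4 * pi)) ^ (2 * k) * (1 * (n / (4 * pi)))"
      unfolding F_def using R by (intro mult_mono mult_nonneg_nonneg pairing_le_1 pairing_nonneg close_le_1 close_nonneg) auto
    moreover have "0 \<le> F y" unfolding F_def using R by (intro mult_nonneg_nonneg pairing_nonneg close_nonneg) auto
    ultimately show "norm (F y) \<le> 1 * (n / (4 * pi)) ^ (2 * k) * (1 * (n / (4 * pi)))" by simp
  next
    show "F \<in> borel_measurable ?S" unfolding F_def[abs_def] using a
      by (intro borel_measurable_times borel_measurable_const measurable_pairing measurable_rho_prod
          measurable_two_components measurable_close) auto
  qed simp
  have "(\<integral>y. pairing t k y * close t (y a) (y (2 * k)) * ker_det n (Suc (2 * k)) y \<partial>?S) \<le> (\<integral>y. F y \<partial>?S)"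
  proof (rule integral_mono[OF int1 F])
    fix y assume y: "y \<in> space ?S"
    have "ker_det n (Suc (2 * k)) y \<le> ker_det n (2 * k) y * (n / (4 * pi))"
      by (rule ker_det_Suc_le[OF n t y])
    also have "\<dots> \<le> rho_prod n k y * (n / (4 * pi))"
    proof -
      have "ker_det n (2 * k) y = ker_det n (2 * k) (restrict y {..<2 * k})"
        unfolding ker_det_def by (intro arg_cong[where f = Re] fdet_cong) auto
      also have "\<dots> \<le> rho_prod n k (restrict y {..<2 * k})"
        using y by (intro ker_det_le_rho_prod[OF n t _ order_refl]) (auto simp: space_PiM PiE_iff)
      also have "\<dots> = rho_prod n k y" unfolding rho_prod_def by (intro prod.cong) auto
      finally show ?thesis by (intro mult_right_mono) auto
    qed
    finally have "pairing t k y * close t (y a) (y (2 * k)) * ker_det n (Suc (2 * k)) y \<le>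
        pairing t k y * close t (y a) (y (2 * k)) * (rho_prod n k y * (n / (4 * pi)))"
      by (intro mult_left_mono mult_nonneg_nonneg pairing_nonneg close_nonneg)
    then show "pairing t k y * close t (y a) (y (2 * k)) * ker_det n (Suc (2 * k)) y \<le> F y"
      by (simp add: F_def mult_ac)
  qed
  also have "(\<integral>y. F y \<partial>?S) = (\<integral>x. \<integral>q. F (x(2 * k := q)) \<partial>surface_measure \<partial>sphere_prod (2 * k))"
    unfolding lessThan_Suc by (rule surface_prod.product_integral_insert) (use F in \<open>auto simp: lessThan_Suc\<close>)
  also have "\<dots> = (\<integral>x. pairing t k x * rho_prod n k x * (n * t\<^sup>2 / 4) \<partial>sphere_prod (2 * k))"
  proof (rule Bochner_Integration.integral_cong[OF refl])
    fix x assume x: "x \<in> space (sphere_prod (2 * k))"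
    have "F (x(2 * k := q)) = pairing t k x * rho_prod n k x * (n / (4 * pi)) * close t (x a) q" for q
    proof -
      have "pairing t k (x(2 * k := q)) = pairing t k x" "rho_prod n k (x(2 * k := q)) = rho_prod n k x"
        unfolding pairing_def rho_prod_def by (auto intro!: prod.cong)
      then show ?thesis using a by (simp add: F_def)
    qed
    moreover have "(\<integral>q. close t (x a) q \<partial>surface_measure) = pi * t\<^sup>2"
    proof (rule integral_of_nn_integral)
      show "(\<lambda>q. close t (x a) q) \<in> borel_measurable surface_measure"
        unfolding close_def by (intro borel_measurable_surface) measurable
      show "(\<integral>\<^sup>+q. ennreal (close t (x a) q) \<partial>surface_measure) = ennreal (pi * t\<^sup>2)"
        using space_sphere_prod_D[OF x, of a] a t by (intro nn_integral_close[OF n t]) auto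
    qed (auto simp: close_nonneg)
    ultimately show "(\<integral>q. F (x(2 * k := q)) \<partial>surface_measure) = pairing t k x * rho_prod n k x * (n * t\<^sup>2 / 4)"
      by simp
  qed
  also have "\<dots> = pmass n t ^ k * (n * t\<^sup>2 / 4)"
    using integral_pairing_rho[OF n t, of k] by simp
  finally show ?thesis .
qed

section \<open>Asymptotics of the pair mass and of the kernel decay\<close>

lemma one_minus_power_bounds:
  fixes a :: real
  assumes "0 \<le> a" "a \<le> 1"
  shows "(1 - a) ^ n \<le> 1 - n * a + n * (real n - 1) / 2 * a\<^sup>2"
    and "1 - n * a + n * (real n - 1) / 2 * a\<^sup>2 - n * (real n - 1) * (real n - 2) / 6 * a ^ 3 \<le> (1 - a) ^ n"
\<comment> \<open>Multiplying a truncated binomial expansion by \<open>1 - a\<close> gives the next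
  one up to a top-order term of known sign. Orders two and three are needed because
  \<open>pair_mass\<close> cancels the orders zero and one.\<close>
proof (induction n)
  case (Suc n)
  have n1: "0 \<le> real n * (real n - 1)" by (cases n) auto
  have n2: "0 \<le> real n * (real n - 1) * (real n - 2)"
  proof (cases "n < 2")
    case True
    then have "n = 0 \<or> n = 1" by auto
    then show ?thesis by auto
  qed auto
  {
    case 1
    have "(1 - a) ^ Suc n \<le> (1 - a) * (1 - n * a + n * (real n - 1) / 2 * a\<^sup>2)"
      using mult_left_mono[OF Suc.IH(1)] assms by simp
    also have "\<dots> = (1 - Suc n * a + Suc n * (real (Suc n) - 1) / 2 * a\<^sup>2) - real n * (real n - 1) / 2 * a ^ 3"
      by (simp add: field_simps power2_eq_square power3_eq_cube)
    also have "\<dots> \<le> (1 - Suc n * a + Suc n * (real (Suc n) - 1) / 2 * a\<^sup>2)"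
      using mult_nonneg_nonneg[OF n1, of "a ^ 3"] assms by simp
    finally show ?case .
  next
    case 2
    have "1 - Suc n * a + Suc n * (real (Suc n) - 1) / 2 * a\<^sup>2 - Suc n * (real (Suc n) - 1) * (real (Suc n) - 2) / 6 * a ^ 3
      = (1 - a) * (1 - n * a + n * (real n - 1) / 2 * a\<^sup>2 - n * (real n - 1) * (real n - 2) / 6 * a ^ 3)
        - real n * (real n - 1) * (real n - 2) / 6 * a ^ 4"
      by (simp add: field_simps power2_eq_square power3_eq_cube power4_eq_xxxx)
    also have "\<dots> \<le> (1 - a) * (1 - n * a + n * (real n - 1) / 2 * a\<^sup>2 - n * (real n - 1) * (real n - 2) / 6 * a ^ 3)"
      using mult_nonneg_nonneg[OF n2, of "a ^ 4"] assms by simp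
    also have "\<dots> \<le> (1 - a) ^ Suc n" using mult_left_mono[OF Suc.IH(2)] assms by simp
    finally show ?case .
  }
qed simp_all

lemma pair_mass_eq: "pair_mass n a = n * (n * a - 1 + (1 - a) ^ n)"
  by (simp add: pair_mass_def algebra_simps power2_eq_square)

text \<open>With \<open>a\<close> of order \<open>n powr (-3/2)\<close> the quadratic term tends to
  \<open>(x\<^sup>2 / 4)\<^sup>2 / 2\<close>, and the cubic one, of order \<open>n^4 * a^3\<close>,
  decays like \<open>n powr (-1/2)\<close>.\<close>

lemma pmass_limit:
  assumes "x > 0"
  shows "(\<lambda>n. pmass n (x / real n powr (3/4))) \<longlonglongrightarrow> x ^ 4 / 32"
proof -
  define a where "a n = (x / real n powr (3/4))\<^sup>2 / 4" for n
  have pm: "pmass n (x / real n powr (3/4)) = pair_mass n (a n)" for n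
    by (simp only: pmass_def a_def)
  have "(\<lambda>n. a n) \<longlonglongrightarrow> 0" unfolding a_def using assms by real_asymp
  then have "eventually (\<lambda>n. a n < 1) sequentially" by (rule order_tendstoD) simp
  then have ev: "eventually (\<lambda>n. 0 \<le> a n \<and> a n \<le> 1) sequentially"
    by eventually_elim (simp add: a_def)
  have e: "(x\<^sup>2 / 4)\<^sup>2 / 2 = x ^ 4 / 32" by (simp add: power2_eq_square power4_eq_xxxx)
  show ?thesis
  proof (rule tendsto_sandwich)
    show "\<forall>\<^sub>F n in sequentially. real n ^ 2 * (real n - 1) / 2 * (a n)\<^sup>2 - real n ^ 2 * (real n - 1) * (real n - 2) / 6 * (a n) ^ 3
      \<le> pmass n (x / real n powr (3/4))"
      using ev
    proof eventually_elim
      case (elim n)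
      have eq: "real n ^ 2 * (real n - 1) / 2 * (a n)\<^sup>2 - real n ^ 2 * (real n - 1) * (real n - 2) / 6 * (a n) ^ 3 =
          n * (n * (real n - 1) / 2 * (a n)\<^sup>2 - n * (real n - 1) * (real n - 2) / 6 * (a n) ^ 3)"
        by (simp add: field_simps power2_eq_square)
      show ?case
        unfolding pm pair_mass_eq eq
        by (rule mult_left_mono) (use elim one_minus_power_bounds(2)[of "a n" n] in \<open>linarith, simp\<close>)
    qed
    show "\<forall>\<^sub>F n in sequentially. pmass n (x / real n powr (3/4)) \<le> real n ^ 2 * (real n - 1) / 2 * (a n)\<^sup>2"
      using ev
    proof eventually_elim
      case (elim n)
      then show ?case
        using mult_left_mono[of "n * a n - 1 + (1 - a n) ^ n" "n * (real n - 1) / 2 * (a n)\<^sup>2" "real n"]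
            one_minus_power_bounds(1)[of "a n" n]
        unfolding pm pair_mass_eq by (simp add: power2_eq_square mult.assoc)
    qed
    show "(\<lambda>n. real n ^ 2 * (real n - 1) / 2 * (a n)\<^sup>2) \<longlonglongrightarrow> x ^ 4 / 32"
      unfolding a_def e[symmetric] using assms by real_asymp
    show "(\<lambda>n. real n ^ 2 * (real n - 1) / 2 * (a n)\<^sup>2 - real n ^ 2 * (real n - 1) * (real n - 2) / 6 * (a n) ^ 3) \<longlonglongrightarrow> x ^ 4 / 32"
      unfolding a_def e[symmetric] using assms by real_asymp
  qed
qed

text \<open>At separation \<open>n powr (-1/4)\<close> the kernel factor is at most the exponential
  of about \<open>- sqrt n / 8\<close>, which defeats every power of n.\<close>

lemma power_times_exp_limit:
  "(\<lambda>n. real n ^ m * sqrt ((1 - (real n powr (-1/4))\<^sup>2 / 4) ^ (n - 1))) \<longlonglongrightarrow> 0"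
proof (rule tendsto_sandwich[OF _ _ tendsto_const])
  show "(\<lambda>n. real n powr m * exp (- (real n powr (-1/2) * (real n - 1) / 8))) \<longlonglongrightarrow> 0"
    by real_asymp
  have b: "0 \<le> 1 - (real n powr (-1/4))\<^sup>2 / 4 \<and> real n ^ m * sqrt ((1 - (real n powr (-1/4))\<^sup>2 / 4) ^ (n - 1)) \<le>
     real n powr m * exp (- (real n powr (-1/2) * (real n - 1) / 8))" if "n \<ge> 1" for n
  proof -
    define u where "u = real n powr (-1/2) / 4"
    have u: "(real n powr (-1/4))\<^sup>2 / 4 = u" by (simp add: u_def power2_eq_square flip: powr_add)
    have u1: "u \<le> 1" using powr_mono[of "-1/2" 0 "real n"] that by (simp add: u_def)
    have "(1 - u) ^ (n - 1) \<le> exp (- u) ^ (n - 1)" using u1 exp_ge_add_one_self[of "- u"] by (intro power_mono) auto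
    also have "\<dots> = (exp (- (u * (real n - 1) / 2)))\<^sup>2"
      using that by (simp add: of_nat_diff mult_ac flip: exp_of_nat_mult exp_double)
    finally have "sqrt ((1 - u) ^ (n - 1)) \<le> exp (- (u * (real n - 1) / 2))"
      by (rule real_le_lsqrt[rotated -1]) auto
    then have "real n ^ m * sqrt ((1 - u) ^ (n - 1)) \<le> real n ^ m * exp (- (u * (real n - 1) / 2))"
      by (intro mult_left_mono) auto
    then show ?thesis unfolding u using u1 that by (simp add: u_def powr_realpow)
  qed
  show "\<forall>\<^sub>F n in sequentially. 0 \<le> real n ^ m * sqrt ((1 - (real n powr (-1/4))\<^sup>2 / 4) ^ (n - 1))"
    using eventually_ge_at_top[of 1] by eventually_elim (use b in \<open>auto intro!: mult_nonneg_nonneg zero_le_power\<close>)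
  show "\<forall>\<^sub>F n in sequentially. real n ^ m * sqrt ((1 - (real n powr (-1/4))\<^sup>2 / 4) ^ (n - 1)) \<le>
     real n powr m * exp (- (real n powr (-1/2) * (real n - 1) / 8))"
    using eventually_ge_at_top[of 1] by eventually_elim (use b in auto)
qed

section \<open>Matchings and isolated pairs\<close>

definition verts :: "(nat \<times> nat) list \<Rightarrow> nat list" where
  "verts xs = concat (map (\<lambda>(a, b). [a, b]) xs)"

definition upairs :: "nat \<Rightarrow> (nat \<times> nat) set" where
  "upairs n = {(i, j). i < j \<and> j < n}"

text \<open>Lists, not sets: factorial moments count ordered selections of pairs, and the position
  in the list numbers the pairs as in \<open>pairing\<close>.\<close>

definition matchings :: "nat \<Rightarrow> nat \<Rightarrow> (nat \<times> nat) list set" where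
  "matchings n k = {xs. length xs = k \<and> set xs \<subseteq> upairs n \<and> distinct (verts xs)}"

lemma verts_simps [simp]: "verts [] = []" "verts (p # xs) = fst p # snd p # verts xs"
  by (simp_all add: verts_def split: prod.splits)

lemma length_verts [simp]: "length (verts xs) = 2 * length xs"
  by (induction xs) auto

lemma set_verts: "set (verts xs) = fst ` set xs \<union> snd ` set xs"
  by (induction xs) auto

lemma verts_nth:
  assumes "i < length xs"
  shows "verts xs ! (2 * i) = fst (xs ! i)" "verts xs ! (2 * i + 1) = snd (xs ! i)"
proof -
  have "verts xs ! (2 * i) = fst (xs ! i) \<and> verts xs ! (2 * i + 1) = snd (xs ! i)"
    using assms by (induction xs arbitrary: i) (auto simp: nth_Cons split: nat.split)
  then show "verts xs ! (2 * i) = fst (xs ! i)" "verts xs ! (2 * i + 1) = snd (xs ! i)" by auto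
qed

lemma finite_upairs: "finite (upairs n)"
  by (rule finite_subset[of _ "{..<n} \<times> {..<n}"]) (auto simp: upairs_def)

lemma finite_matchings: "finite (matchings n k)"
  by (rule finite_subset[OF _ finite_lists_length_eq[OF finite_upairs[of n], of k]]) (auto simp: matchings_def)

lemma matchings_verts_less: "xs \<in> matchings n k \<Longrightarrow> set (verts xs) \<subseteq> {..<n}"
  by (auto simp: matchings_def set_verts upairs_def)

lemma card_ordered_pairs:
  fixes V :: "nat set"
  assumes "finite V"
  shows "2 * card {(a, b). a \<in> V \<and> b \<in> V \<and> a < b} + card V = card V * card V"
proof -
  let ?L = "{(a, b). a \<in> V \<and> b \<in> V \<and> a < b}"
  let ?U = "prod.swap ` ?L"
  let ?D = "(\<lambda>a. (a, a)) ` V"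
  have fin: "finite ?L" by (rule finite_subset[of _ "V \<times> V"]) (use assms in auto)
  have "V \<times> V = ?L \<union> ?U \<union> ?D"
  proof (intro equalityI subsetI)
    fix p assume "p \<in> V \<times> V"
    then obtain a b where p: "p = (a, b)" "a \<in> V" "b \<in> V" by auto
    consider "a < b" | "b < a" | "a = b" by linarith
    then show "p \<in> ?L \<union> ?U \<union> ?D"
    proof cases
      case 2
      then have "(b, a) \<in> ?L" using p by auto
      then have "prod.swap (b, a) \<in> ?U" by (rule imageI)
      then show ?thesis by (simp add: p)
    qed (use p in auto)
  qed auto
  then have "card (V \<times> V) = card (?L \<union> ?U \<union> ?D)" by simp
  also have "\<dots> = card (?L \<union> ?U) + card ?D"
    using fin assms by (intro card_Un_disjoint) auto
  also have "card (?L \<union> ?U) = card ?L + card ?U"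
    using fin by (intro card_Un_disjoint) auto
  also have "card ?U = card ?L" by (intro card_image) (auto intro: inj_onI)
  also have "card ?D = card V" by (intro card_image) (auto intro: inj_onI)
  finally show ?thesis by (simp add: card_cartesian_product)
qed

text \<open>A matching is extended by any pair of the \<open>m = n - 2 * k\<close> free vertices, in
  m(m - 1)/2 ways. Products avoid division of naturals.\<close>

lemma card_matchings: "2 * k \<le> n \<Longrightarrow> card (matchings n k) * 2 ^ k * fact (n - 2 * k) = (fact n :: nat)"
proof (induction k)
  case 0
  have "matchings n 0 = {[]}" by (auto simp: matchings_def)
  then show ?case by simp
next
  case (Suc k)
  define m where "m = n - 2 * k"
  have m: "m \<ge> 2" "n - 2 * Suc k = m - 2" using Suc.prems by (auto simp: m_def)
  let ?V = "\<lambda>xs. {..<n} - set (verts xs)"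
  let ?P = "\<lambda>xs. {(a, b). a \<in> ?V xs \<and> b \<in> ?V xs \<and> a < b}"
  have "matchings n (Suc k) = (\<lambda>(xs, p). p # xs) ` (SIGMA xs:matchings n k. ?P xs)"
  proof (intro equalityI subsetI)
    fix ys assume ys: "ys \<in> matchings n (Suc k)"
    then obtain p xs where p: "ys = p # xs" by (cases ys) (auto simp: matchings_def)
    then have "xs \<in> matchings n k" "p \<in> ?P xs" using ys by (auto simp: matchings_def upairs_def)
    then show "ys \<in> (\<lambda>(xs, p). p # xs) ` (SIGMA xs:matchings n k. ?P xs)" using p by force
  qed (auto simp: matchings_def upairs_def)
  then have "card (matchings n (Suc k)) = card (SIGMA xs:matchings n k. ?P xs)"
    by (simp add: card_image inj_on_def)
  also have "\<dots> = (\<Sum>xs\<in>matchings n k. card (?P xs))"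
    by (intro card_SigmaI finite_matchings ballI) (auto intro: finite_subset[of _ "{..<n} \<times> {..<n}"])
  also have "2 * \<dots> = (\<Sum>xs\<in>matchings n k. m * (m - 1))"
    unfolding sum_distrib_left
  proof (intro sum.cong refl)
    fix xs assume xs: "xs \<in> matchings n k"
    have "card (?V xs) = n - card (set (verts xs))"
      using matchings_verts_less[OF xs] by (simp add: card_Diff_subset)
    also have "card (set (verts xs)) = 2 * k" using xs by (simp add: matchings_def distinct_card)
    finally have "card (?V xs) = m" by (simp add: m_def)
    then show "2 * card (?P xs) = m * (m - 1)"
      using card_ordered_pairs[of "?V xs"] by (simp add: diff_mult_distrib2)
  qed
  finally have c: "2 * card (matchings n (Suc k)) = card (matchings n k) * (m * (m - 1))" by simp
  have "card (matchings n (Suc k)) * 2 ^ Suc k * fact (n - 2 * Suc k) =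
      (2 * card (matchings n (Suc k))) * 2 ^ k * fact (m - 2)"
    unfolding m(2) by (simp only: power_Suc mult_ac)
  also have "\<dots> = card (matchings n k) * 2 ^ k * fact m"
  proof -
    have "fact m = m * fact (m - 1)" using m(1) fact_reduce[of m, where 'a = nat] by simp
    moreover have "fact (m - 1) = (m - 1) * fact (m - 1 - 1)" using m(1) fact_reduce[of "m - 1", where 'a = nat] by simp
    moreover have "m - 1 - 1 = m - 2" by simp
    ultimately have "fact m = m * (m - 1) * fact (m - 2)" by (simp only: mult.assoc)
    then show ?thesis unfolding c by (simp only: mult_ac)
  qed
  also have "\<dots> = fact n" using Suc by (simp add: m_def)
  finally show ?case .
qed

definition rel_pairs :: "nat \<Rightarrow> (nat \<Rightarrow> nat \<Rightarrow> bool) \<Rightarrow> (nat \<times> nat) set" where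
  "rel_pairs n R = {(i, j). i < j \<and> j < n \<and> R i j}"

definition isolated :: "nat \<Rightarrow> (nat \<Rightarrow> nat \<Rightarrow> bool) \<Rightarrow> (nat \<times> nat) set" where
  "isolated n R = {(i, j) \<in> rel_pairs n R. \<forall>v<n. v \<noteq> i \<and> v \<noteq> j \<longrightarrow> \<not> R i v \<and> \<not> R j v}"

lemma isolated_subset: "isolated n R \<subseteq> rel_pairs n R"
  by (auto simp: isolated_def)

lemma rel_pairs_subset: "rel_pairs n R \<subseteq> upairs n"
  by (auto simp: rel_pairs_def upairs_def)

lemma finite_isolated: "finite (isolated n R)"
  using isolated_subset rel_pairs_subset finite_upairs finite_subset by meson

lemma isolated_disjoint:
  assumes R: "\<And>i j. R i j = R j i" and "p \<in> isolated n R" "q \<in> isolated n R" "p \<noteq> q"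
  shows "fst p \<noteq> fst q" "fst p \<noteq> snd q" "snd p \<noteq> fst q" "snd p \<noteq> snd q"
proof -
  obtain a b c d where pq: "p = (a, b)" "q = (c, d)" by (cases p, cases q)
  then have p: "a < b" "b < n" "R a b" "\<And>v. v < n \<Longrightarrow> v \<noteq> a \<Longrightarrow> v \<noteq> b \<Longrightarrow> \<not> R a v \<and> \<not> R b v"
    and q: "c < d" "d < n" "R c d"
    using assms by (auto simp: isolated_def rel_pairs_def)
  have "R d c" using q R by simp
  note f = p q this
  show "fst p \<noteq> fst q" using f assms(4) pq by auto
  show "fst p \<noteq> snd q" using f(4)[of c] f pq by auto
  show "snd p \<noteq> fst q" using f(4)[of d] f pq by auto
  show "snd p \<noteq> snd q" using f(4)[of c] f assms(4) pq by auto
qed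

text \<open>This is the purpose of isolation: distinct isolated pairs cannot share a vertex, so no
  overlap patterns have to be enumerated.\<close>

lemma isolated_list_matching:
  assumes R: "\<And>i j. R i j = R j i" and "distinct xs" "set xs \<subseteq> isolated n R"
  shows "xs \<in> matchings n (length xs)"
proof -
  have "distinct (verts xs)"
    using assms(2,3)
  proof (induction xs)
    case (Cons p xs)
    then have p: "p \<in> isolated n R" by simp
    then have "fst p \<noteq> snd p" by (auto simp: isolated_def rel_pairs_def)
    moreover have "fst p \<noteq> fst q \<and> fst p \<noteq> snd q \<and> snd p \<noteq> fst q \<and> snd p \<noteq> snd q" if "q \<in> set xs" for q
      using isolated_disjoint[where R = R, OF R p, of q] Cons.prems that by auto
    ultimately show ?case using Cons by (auto simp: set_verts)
  qed simp
  then show ?thesis using assms(3) isolated_subset rel_pairs_subset by (fastforce simp: matchings_def)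
qed

lemma card_distinct_lists:
  assumes "finite A"
  shows "card {xs. length xs = k \<and> distinct xs \<and> set xs \<subseteq> A} = fact k * (card A choose k)"
proof (cases "k \<le> card A")
  case True
  have "fact k * (card A choose k) = \<Prod>{card A - k + 1..card A}"
  proof -
    have "fact (card A - k) * (fact k * (card A choose k)) = fact (card A)"
      using binomial_fact_lemma[OF True] by (simp add: mult_ac)
    then have "fact k * (card A choose k) = fact (card A) div fact (card A - k)"
      by (metis fact_nonzero nonzero_mult_div_cancel_left)
    also have "\<dots> = \<Prod>{card A - k + 1..card A}" by (rule fact_div_fact) simp
    finally show ?thesis .
  qed
  then show ?thesis using card_lists_distinct_length_eq[OF assms True] by simp
next
  case False
  have e: "{xs. length xs = k \<and> distinct xs \<and> set xs \<subseteq> A} = {}"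
  proof (rule equals0I)
    fix xs assume "xs \<in> {xs. length xs = k \<and> distinct xs \<and> set xs \<subseteq> A}"
    then have "k \<le> card A" using card_mono[OF assms, of "set xs"] distinct_card[of xs] by simp
    then show False using False by simp
  qed
  show ?thesis unfolding e using False by simp
qed

text \<open>A witness against isolation of one pair is a third vertex related to it; that vertex
  lies either outside the matching or in another of its pairs.\<close>

lemma matching_not_isolated:
  assumes R: "\<And>i j. R i j = R j i" and xs: "xs \<in> matchings n k" "set xs \<subseteq> rel_pairs n R" "\<not> set xs \<subseteq> isolated n R"
  shows "(\<exists>v<n. v \<notin> set (verts xs) \<and> (\<exists>a<2 * k. R (verts xs ! a) v)) \<or>
    (\<exists>a<2 * k. \<exists>b<2 * k. a div 2 \<noteq> b div 2 \<and> R (verts xs ! a) (verts xs ! b))"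
proof -
  have len: "length xs = k" using xs by (simp add: matchings_def)
  obtain p where p: "p \<in> set xs" "p \<notin> isolated n R" using xs(3) by blast
  then obtain l where l: "l < k" "xs ! l \<notin> isolated n R" using len by (auto simp: in_set_conv_nth)
  obtain i j where ij: "xs ! l = (i, j)" by force
  have "(i, j) \<in> rel_pairs n R" using xs(2) l(1) len ij by (metis nth_mem subsetD)
  then obtain v where v: "v < n" "v \<noteq> i" "v \<noteq> j" "R i v \<or> R j v"
    using l(2) ij by (auto simp: isolated_def)
  have vi: "verts xs ! (2 * l) = i" "verts xs ! (2 * l + 1) = j" using verts_nth[of l xs] l(1) len ij by auto
  from v(4) obtain a where a: "a < 2 * k" "a div 2 = l" "R (verts xs ! a) v"
  proof
    assume "R i v"
    then show ?thesis using that[of "2 * l"] vi l(1) by auto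
  next
    assume "R j v"
    then show ?thesis using that[of "2 * l + 1"] vi l(1) by auto
  qed
  show ?thesis
  proof (cases "v \<in> set (verts xs)")
    case False
    then show ?thesis using v a by blast
  next
    case True
    then obtain b where b: "b < 2 * k" "verts xs ! b = v" using len by (auto simp: in_set_conv_nth)
    have "b div 2 \<noteq> l"
    proof
      assume "b div 2 = l"
      then have "b = 2 * l \<or> b = 2 * l + 1" by linarith
      then show False using vi v(2,3) b(2) by auto
    qed
    then have "a div 2 \<noteq> b div 2 \<and> R (verts xs ! a) (verts xs ! b)" using a(2,3) b(2) by simp
    then show ?thesis using a(1) b(1) by blast
  qed
qed

text \<open>\<open>w\<close> is the indicator that all pairs of the matching are related. Lists of k
  distinct isolated pairs are among these matchings, and each surplus matching is charged to a
  witness from \<open>matching_not_isolated\<close>.\<close>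

lemma isolated_counts:
  fixes R :: "nat \<Rightarrow> nat \<Rightarrow> bool" and n k :: nat
  assumes R: "\<And>i j. R i j = R j i"
  defines "w \<equiv> \<lambda>xs. (\<Prod>i<k. of_bool (R (verts xs ! (2 * i)) (verts xs ! (2 * i + 1))) :: real)"
  shows "fact k * real (card (isolated n R) choose k) \<le> (\<Sum>xs\<in>matchings n k. w xs)"
    and "(\<Sum>xs\<in>matchings n k. w xs) - fact k * real (card (isolated n R) choose k) \<le>
      (\<Sum>xs\<in>matchings n k. (\<Sum>v\<in>{..<n} - set (verts xs). \<Sum>a<2 * k. w xs * of_bool (R (verts xs ! a) v)) +
        w xs * of_bool (\<exists>a<2 * k. \<exists>b<2 * k. a div 2 \<noteq> b div 2 \<and> R (verts xs ! a) (verts xs ! b)))"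
proof -
  let ?I = "{xs. length xs = k \<and> distinct xs \<and> set xs \<subseteq> isolated n R}"
  let ?A = "{xs \<in> matchings n k. set xs \<subseteq> rel_pairs n R}"
  have w: "w xs = of_bool (set xs \<subseteq> rel_pairs n R)" if "xs \<in> matchings n k" for xs
  proof -
    have len: "length xs = k" and up: "set xs \<subseteq> upairs n" using that by (auto simp: matchings_def)
    have "w xs = (\<Prod>i<k. of_bool (R (fst (xs ! i)) (snd (xs ! i))))"
      unfolding w_def using verts_nth[of _ xs] len by (intro prod.cong refl) (simp only: lessThan_iff)
    also have "\<dots> = of_bool (\<forall>i<k. R (fst (xs ! i)) (snd (xs ! i)))"
    proof (cases "\<forall>i<k. R (fst (xs ! i)) (snd (xs ! i))")
      case False
      then obtain i where "i < k" "\<not> R (fst (xs ! i)) (snd (xs ! i))" by auto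
      then have "(\<Prod>i<k. of_bool (R (fst (xs ! i)) (snd (xs ! i)))) = (0::real)"
        by (intro prod_zero bexI[of _ i]) auto
      then show ?thesis using False by simp
    qed auto
    also have "(\<forall>i<k. R (fst (xs ! i)) (snd (xs ! i))) \<longleftrightarrow> (\<forall>p\<in>set xs. R (fst p) (snd p))"
      using len by (auto simp: all_set_conv_all_nth)
    also have "\<dots> \<longleftrightarrow> set xs \<subseteq> rel_pairs n R"
      using up by (force simp: rel_pairs_def upairs_def)
    finally show ?thesis .
  qed
  have nn: "0 \<le> w xs" for xs unfolding w_def by (intro prod_nonneg) auto
  have IA: "?I \<subseteq> ?A" using isolated_list_matching[where R = R, OF R] isolated_subset by blast
  have finA: "finite ?A" using finite_matchings by simp
  have cI: "real (card ?I) = fact k * real (card (isolated n R) choose k)"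
    unfolding card_distinct_lists[OF finite_isolated] by simp
  have cA: "(\<Sum>xs\<in>matchings n k. w xs) = real (card ?A)"
  proof -
    have "(\<Sum>xs\<in>matchings n k. w xs) = (\<Sum>xs\<in>matchings n k. if set xs \<subseteq> rel_pairs n R then 1 else 0)"
      using w by (intro sum.cong) auto
    also have "\<dots> = (\<Sum>xs\<in>?A. 1)" by (rule sum.inter_filter[symmetric, OF finite_matchings])
    finally show ?thesis by simp
  qed
  show "fact k * real (card (isolated n R) choose k) \<le> (\<Sum>xs\<in>matchings n k. w xs)"
    unfolding cA cI[symmetric] using card_mono[OF finA IA] by simp
  let ?B = "\<lambda>xs. (\<Sum>v\<in>{..<n} - set (verts xs). \<Sum>a<2 * k. w xs * of_bool (R (verts xs ! a) v)) +
        w xs * of_bool (\<exists>a<2 * k. \<exists>b<2 * k. a div 2 \<noteq> b div 2 \<and> R (verts xs ! a) (verts xs ! b))"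
  have B0: "0 \<le> ?B xs" for xs using nn by (intro add_nonneg_nonneg sum_nonneg mult_nonneg_nonneg) auto
  have B1: "1 \<le> ?B xs" if "xs \<in> ?A - ?I" for xs
  proof -
    have xs: "xs \<in> matchings n k" "set xs \<subseteq> rel_pairs n R" using that by auto
    have d: "distinct xs"
    proof -
      have "distinct (map fst xs)" using xs(1) unfolding matchings_def by (induction xs arbitrary: k) (auto simp: set_verts)
      then show ?thesis by (simp add: distinct_map)
    qed
    have "\<not> set xs \<subseteq> isolated n R" using that d by (auto simp: matchings_def)
    from matching_not_isolated[where R = R, OF R xs this] have w1: "w xs = 1" using w[OF xs(1)] xs(2) by simp
    from matching_not_isolated[where R = R, OF R xs \<open>\<not> set xs \<subseteq> isolated n R\<close>] show ?thesis
    proof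
      assume "\<exists>v<n. v \<notin> set (verts xs) \<and> (\<exists>a<2 * k. R (verts xs ! a) v)"
      then obtain v a where v: "v < n" "v \<notin> set (verts xs)" "a < 2 * k" "R (verts xs ! a) v" by auto
      let ?g = "\<lambda>v a. w xs * of_bool (R (verts xs ! a) v) :: real"
      have "1 = ?g v a" using v w1 by simp
      also have "\<dots> \<le> (\<Sum>a<2 * k. ?g v a)" using v nn by (intro member_le_sum[of a _ "?g v"]) auto
      also have "\<dots> \<le> (\<Sum>v\<in>{..<n} - set (verts xs). \<Sum>a<2 * k. ?g v a)"
        using v nn by (intro member_le_sum[of v _ "\<lambda>v. \<Sum>a<2 * k. ?g v a"]) (auto intro!: sum_nonneg)
      also have "\<dots> \<le> ?B xs" using nn by simp
      finally show ?thesis .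
    next
      assume "\<exists>a<2 * k. \<exists>b<2 * k. a div 2 \<noteq> b div 2 \<and> R (verts xs ! a) (verts xs ! b)"
      moreover have "0 \<le> (\<Sum>v\<in>{..<n} - set (verts xs). \<Sum>a<2 * k. w xs * of_bool (R (verts xs ! a) v))"
        using nn by (intro sum_nonneg mult_nonneg_nonneg) auto
      ultimately show ?thesis using w1 by simp
    qed
  qed
  have "(\<Sum>xs\<in>matchings n k. w xs) - fact k * real (card (isolated n R) choose k) = real (card (?A - ?I))"
    unfolding cA cI[symmetric] using card_mono[OF finA IA] finite_subset[OF IA finA]
    by (subst card_Diff_subset[OF _ IA]) auto
  also have "\<dots> = (\<Sum>xs\<in>?A - ?I. 1)" by simp
  also have "\<dots> \<le> (\<Sum>xs\<in>?A - ?I. ?B xs)" using B1 by (intro sum_mono) auto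
  also have "\<dots> \<le> (\<Sum>xs\<in>matchings n k. ?B xs)" using B0 by (intro sum_mono2 finite_matchings) auto
  finally show "(\<Sum>xs\<in>matchings n k. w xs) - fact k * real (card (isolated n R) choose k) \<le> (\<Sum>xs\<in>matchings n k. ?B xs)" .
qed

section \<open>Poisson limits from factorial moments\<close>

lemma alternating_binomial_sum:
  "(\<Sum>i\<le>r. (-1) ^ i * real (Suc z choose i)) = (-1) ^ r * real (z choose r)"
  by (induction r) (auto simp: algebra_simps)

text \<open>Truncated inclusion-exclusion for the event \<open>x = m\<close>. For
  \<open>x > m\<close> the partial sum collapses to a single binomial coefficient with a sign, which
  the first omitted term dominates.\<close>

lemma bonferroni_binomial:
  fixes x m r :: nat
  shows "\<bar>of_bool (x = m) - (\<Sum>i\<le>r. (-1) ^ i * real ((m + i) choose m) * real (x choose (m + i)))\<bar> \<le>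
    real ((m + Suc r) choose m) * real (x choose (m + Suc r))"
proof (cases "x < m")
  case True
  then show ?thesis by (simp add: binomial_eq_0)
next
  case False
  \<comment> \<open>Choosing \<open>m + i\<close> out of x and then m of these is choosing m first
    and i from the rest.\<close>
  have mult: "real ((m + i) choose m) * real (x choose (m + i)) = real (x choose m) * real ((x - m) choose i)" for i
  proof (cases "m + i \<le> x")
    case True
    then have "(x choose (m + i)) * ((m + i) choose m) = (x choose m) * ((x - m) choose (m + i - m))"
      by (intro choose_mult) auto
    then show ?thesis by (simp add: mult.commute flip: of_nat_mult)
  next
    case F: False
    then have "x - m < i" using False by linarith
    then show ?thesis using F by (simp add: binomial_eq_0)
  qed
  have S: "(\<Sum>i\<le>r. (-1) ^ i * real ((m + i) choose m) * real (x choose (m + i))) =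
      real (x choose m) * (\<Sum>i\<le>r. (-1) ^ i * real ((x - m) choose i))"
    unfolding sum_distrib_left by (intro sum.cong refl) (simp only: mult.assoc mult mult.left_commute)
  show ?thesis
  proof (cases "x = m")
    case True
    have "(\<Sum>i\<le>r. (-1) ^ i * real (0 choose i)) = (\<Sum>i\<le>r. if i = 0 then 1 else 0)"
      by (intro sum.cong) (auto simp: binomial_eq_0)
    then show ?thesis unfolding S mult using True by simp
  next
    case F: False
    then obtain z where z: "x - m = Suc z" using False by (metis Suc_diff_Suc linorder_neqE_nat)
    have "real (z choose r) \<le> real (Suc z choose Suc r)" by simp
    then have "real (x choose m) * real (z choose r) \<le> real (x choose m) * real (Suc z choose Suc r)"
      by (intro mult_left_mono) auto
    then show ?thesis unfolding S mult z alternating_binomial_sum using F by (simp add: abs_mult)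
  qed
qed

text \<open>Taking expectations in Bonferroni's inequality bounds the error of a truncated sum by
  one more factorial moment. The bound \<open>B n\<close> is only for integrability and may grow
  with n.\<close>

lemma poisson_limit_factorial_moments:
  fixes M :: "nat \<Rightarrow> 'a measure" and X :: "nat \<Rightarrow> 'a \<Rightarrow> nat"
  assumes M: "\<And>n. prob_space (M n)" and X: "\<And>n. X n \<in> M n \<rightarrow>\<^sub>M count_space UNIV"
    and bounded: "\<And>n \<omega>. X n \<omega> \<le> B n"
    and moments: "\<And>k. (\<lambda>n. \<integral>\<omega>. real (X n \<omega> choose k) \<partial>M n) \<longlonglongrightarrow> \<mu> ^ k / fact k"
  shows "(\<lambda>n. measure (M n) {\<omega> \<in> space (M n). X n \<omega> = m}) \<longlonglongrightarrow> \<mu> ^ m / fact m * exp (- \<mu>)"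
proof -
  define b where "b n k = (\<integral>\<omega>. real (X n \<omega> choose k) \<partial>M n)" for n k
  define p where "p n = measure (M n) {\<omega> \<in> space (M n). X n \<omega> = m}" for n
  define c where "c i = real ((m + i) choose m)" for i
  define S where "S r n = (\<Sum>i\<le>r. (-1) ^ i * c i * b n (m + i))" for r n
  define T where "T r = (\<Sum>i\<le>r. (-1) ^ i * c i * (\<mu> ^ (m + i) / fact (m + i)))" for r
  have le: "\<bar>p n - S r n\<bar> \<le> c (Suc r) * b n (m + Suc r)" for n r
  proof -
    interpret prob_space "M n" by (rule M)
    have int: "integrable (M n) (\<lambda>\<omega>. f (X n \<omega>))" for f :: "nat \<Rightarrow> real"
    proof (rule integrable_const_bound[where B = "Max ((\<lambda>x. \<bar>f x\<bar>) ` {..B n})"])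
      show "AE \<omega> in M n. norm (f (X n \<omega>)) \<le> Max ((\<lambda>x. \<bar>f x\<bar>) ` {..B n})"
        using bounded by (intro AE_I2) (auto intro!: Max_ge)
      show "(\<lambda>\<omega>. f (X n \<omega>)) \<in> borel_measurable (M n)"
        by (rule measurable_compose[OF X]) simp
    qed
    have "p n = (\<integral>\<omega>. indicator {\<omega> \<in> space (M n). X n \<omega> = m} \<omega> \<partial>M n)"
      unfolding p_def by (simp, rule arg_cong[where f = prob], auto)
    also have "\<dots> = (\<integral>\<omega>. of_bool (X n \<omega> = m) \<partial>M n)"
      by (intro Bochner_Integration.integral_cong) (auto simp: indicator_def)
    finally have p: "p n = (\<integral>\<omega>. of_bool (X n \<omega> = m) \<partial>M n)" .
    have S: "S r n = (\<integral>\<omega>. (\<Sum>i\<le>r. (-1) ^ i * c i * real (X n \<omega> choose (m + i))) \<partial>M n)"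
      unfolding S_def b_def using int[of "\<lambda>x. real (x choose j)" for j] by simp
    have "\<bar>p n - S r n\<bar> = \<bar>\<integral>\<omega>. of_bool (X n \<omega> = m) - (\<Sum>i\<le>r. (-1) ^ i * c i * real (X n \<omega> choose (m + i))) \<partial>M n\<bar>"
      unfolding p S using int[of "\<lambda>x. of_bool (x = m)"] int[of "\<lambda>x. \<Sum>i\<le>r. (-1) ^ i * c i * real (x choose (m + i))"]
      by simp
    also have "\<dots> \<le> (\<integral>\<omega>. \<bar>of_bool (X n \<omega> = m) - (\<Sum>i\<le>r. (-1) ^ i * c i * real (X n \<omega> choose (m + i)))\<bar> \<partial>M n)"
      by (rule integral_abs_bound)
    also have "\<dots> \<le> (\<integral>\<omega>. c (Suc r) * real (X n \<omega> choose (m + Suc r)) \<partial>M n)"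
      using int[of "\<lambda>x. \<bar>of_bool (x = m) - (\<Sum>i\<le>r. (-1) ^ i * c i * real (x choose (m + i)))\<bar>"]
        int[of "\<lambda>x. c (Suc r) * real (x choose (m + Suc r))"]
      by (rule integral_mono) (simp only: c_def bonferroni_binomial)
    finally show ?thesis by (simp add: b_def)
  qed
  have split_term: "c i * (\<mu> ^ (m + i) / fact (m + i)) = \<mu> ^ m / fact m * (\<mu> ^ i / fact i)" for i
    by (simp add: c_def binomial_fact power_add)
  have expsum: "(\<lambda>i. \<mu> ^ m / fact m * ((- \<mu>) ^ i / fact i)) sums (\<mu> ^ m / fact m * exp (- \<mu>))"
    using exp_converges[of "- \<mu>"] by (intro sums_mult) (simp add: divide_inverse mult.commute)
  have T: "T \<longlonglongrightarrow> \<mu> ^ m / fact m * exp (- \<mu>)"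
  proof -
    have "T = (\<lambda>r. \<Sum>i\<le>r. \<mu> ^ m / fact m * ((- \<mu>) ^ i / fact i))"
      unfolding T_def mult.assoc split_term by (intro ext sum.cong refl) (simp add: power_minus[of \<mu>])
    then show ?thesis using expsum by (simp only: sums_def_le)
  qed
  have err: "(\<lambda>r. c (Suc r) * (\<mu> ^ (m + Suc r) / fact (m + Suc r))) \<longlonglongrightarrow> 0"
  proof -
    have "(\<lambda>i. \<mu> ^ i / fact i) \<longlonglongrightarrow> 0"
      using summable_LIMSEQ_zero[OF summable_exp[of \<mu>]] by (simp add: divide_inverse mult.commute)
    then have "(\<lambda>i. \<mu> ^ m / fact m * (\<mu> ^ i / fact i)) \<longlonglongrightarrow> \<mu> ^ m / fact m * 0" by (intro tendsto_mult tendsto_const)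
    from LIMSEQ_Suc[OF this] show ?thesis unfolding split_term by simp
  qed
  have "(\<lambda>n. p n) \<longlonglongrightarrow> \<mu> ^ m / fact m * exp (- \<mu>)"
  proof (rule LIMSEQ_I)
    fix \<epsilon> :: real assume "0 < \<epsilon>"
    then have e: "0 < \<epsilon> / 4" by simp
    \<comment> \<open>The truncation order is fixed first, from the limiting series and its tail;
      only finitely many moments must then converge in n.\<close>
    have "eventually (\<lambda>r. dist (T r) (\<mu> ^ m / fact m * exp (- \<mu>)) < \<epsilon> / 4 \<and>
        dist (c (Suc r) * (\<mu> ^ (m + Suc r) / fact (m + Suc r))) 0 < \<epsilon> / 4) sequentially"
      by (intro eventually_conj tendstoD[OF T e] tendstoD[OF err e])
    then obtain r where r: "dist (T r) (\<mu> ^ m / fact m * exp (- \<mu>)) < \<epsilon> / 4"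
        "dist (c (Suc r) * (\<mu> ^ (m + Suc r) / fact (m + Suc r))) 0 < \<epsilon> / 4"
      by (auto dest: eventually_happens)
    have "(\<lambda>n. S r n) \<longlonglongrightarrow> T r" unfolding S_def T_def b_def by (intro tendsto_intros moments)
    moreover have "(\<lambda>n. c (Suc r) * b n (m + Suc r)) \<longlonglongrightarrow> c (Suc r) * (\<mu> ^ (m + Suc r) / fact (m + Suc r))"
      unfolding b_def by (intro tendsto_intros moments)
    ultimately have "eventually (\<lambda>n. dist (S r n) (T r) < \<epsilon> / 4 \<and>
        dist (c (Suc r) * b n (m + Suc r)) (c (Suc r) * (\<mu> ^ (m + Suc r) / fact (m + Suc r))) < \<epsilon> / 4) sequentially"
      by (intro eventually_conj tendstoD e)
    then have "eventually (\<lambda>n. norm (p n - \<mu> ^ m / fact m * exp (- \<mu>)) < \<epsilon>) sequentially"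
    proof eventually_elim
      case (elim n)
      then show ?case using r le[of n r] unfolding dist_real_def real_norm_def by linarith
    qed
    then show "\<exists>n0. \<forall>n\<ge>n0. norm (p n - \<mu> ^ m / fact m * exp (- \<mu>)) < \<epsilon>"
      by (simp add: eventually_sequentially)
  qed
  then show ?thesis unfolding p_def .
qed

section \<open>Factorial moments of the number of isolated close pairs\<close>

definition near :: "real \<Rightarrow> (nat \<Rightarrow> real^3) \<Rightarrow> nat \<Rightarrow> nat \<Rightarrow> bool" where
  "near t x i j \<longleftrightarrow> dist (x i) (x j) \<le> t"

lemma near_sym: "near t x i j = near t x j i"
  by (simp add: near_def dist_commute)

lemma of_bool_near: "of_bool (near t x i j) = close t (x i) (x j)"
  by (simp add: near_def close_def)

lemma measurable_near: "i < n \<Longrightarrow> j < n \<Longrightarrow> (\<lambda>x. of_bool (near t x i j) :: real) \<in> borel_measurable (sphere_prod n)"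
  unfolding of_bool_near by (rule measurable_two_components[OF _ _ measurable_close])

text \<open>The cardinality is a finite sum of indicators over \<open>upairs n\<close>, so no
  sigma-algebra on sets of pairs is needed.\<close>

lemma measurable_card_pairs:
  fixes S :: "(nat \<Rightarrow> real^3) \<Rightarrow> (nat \<times> nat) set"
  assumes "\<And>x. S x \<subseteq> upairs n"
    and "\<And>p. p \<in> upairs n \<Longrightarrow> (\<lambda>x. of_bool (p \<in> S x) :: real) \<in> borel_measurable (sphere_prod n)"
  shows "(\<lambda>x. card (S x)) \<in> sphere_prod n \<rightarrow>\<^sub>M count_space UNIV"
proof -
  have "real (card (S x)) = (\<Sum>p\<in>upairs n. of_bool (p \<in> S x))" for x
  proof -
    have "(\<Sum>p\<in>upairs n. of_bool (p \<in> S x)) = (\<Sum>p\<in>upairs n. if p \<in> S x then 1 else 0 :: real)"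
      by (intro sum.cong) auto
    also have "\<dots> = (\<Sum>p | p \<in> upairs n \<and> p \<in> S x. 1)" by (rule sum.inter_filter[symmetric, OF finite_upairs])
    also have "{p. p \<in> upairs n \<and> p \<in> S x} = S x" using assms(1) by auto
    finally show ?thesis by simp
  qed
  then have m: "(\<lambda>x. real (card (S x))) \<in> borel_measurable (sphere_prod n)"
    using assms(2) by simp
  have "(\<lambda>x. card (S x)) -` {a} \<inter> space (sphere_prod n) = (\<lambda>x. real (card (S x))) -` {real a} \<inter> space (sphere_prod n)" for a
    by auto
  then show ?thesis
    unfolding measurable_count_space_eq2_countable using measurable_sets[OF m] by simp
qed

lemma measurable_card_rel_pairs: "(\<lambda>x. card (rel_pairs n (near t x))) \<in> sphere_prod n \<rightarrow>\<^sub>M count_space UNIV"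
proof (rule measurable_card_pairs[OF rel_pairs_subset])
  fix p assume p: "p \<in> upairs n"
  then have "of_bool (p \<in> rel_pairs n (near t x)) = (of_bool (near t x (fst p) (snd p)) :: real)" for x
    by (auto simp: rel_pairs_def upairs_def)
  then show "(\<lambda>x. of_bool (p \<in> rel_pairs n (near t x)) :: real) \<in> borel_measurable (sphere_prod n)"
    using p by (auto simp: upairs_def intro!: measurable_near)
qed

lemma measurable_card_isolated: "(\<lambda>x. card (isolated n (near t x))) \<in> sphere_prod n \<rightarrow>\<^sub>M count_space UNIV"
proof (rule measurable_card_pairs)
  show "isolated n (near t x) \<subseteq> upairs n" for x using isolated_subset rel_pairs_subset by blast
  fix p assume p: "p \<in> upairs n"
  obtain i j where ij: "p = (i, j)" by force
  have "of_bool (p \<in> isolated n (near t x)) = of_bool (near t x i j) *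
      (\<Prod>v\<in>{..<n} - {i, j}. (1 - of_bool (near t x i v)) * (1 - of_bool (near t x j v)) :: real)" for x
  proof (cases "p \<in> isolated n (near t x)")
    case True
    then have "(\<Prod>v\<in>{..<n} - {i, j}. (1 - of_bool (near t x i v)) * (1 - of_bool (near t x j v)) :: real) = 1"
      by (intro prod.neutral) (auto simp: isolated_def ij)
    then show ?thesis using True by (auto simp: isolated_def rel_pairs_def ij)
  next
    case F: False
    show ?thesis
    proof (cases "near t x i j")
      case True
      then obtain v where v: "v < n" "v \<noteq> i" "v \<noteq> j" "near t x i v \<or> near t x j v"
        using F p by (auto simp: isolated_def rel_pairs_def ij upairs_def)
      then have "(\<Prod>v\<in>{..<n} - {i, j}. (1 - of_bool (near t x i v)) * (1 - of_bool (near t x j v)) :: real) = 0"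
        by (intro prod_zero bexI[of _ v]) auto
      then show ?thesis using F by simp
    qed (use F in simp)
  qed
  then show "(\<lambda>x. of_bool (p \<in> isolated n (near t x)) :: real) \<in> borel_measurable (sphere_prod n)"
    using p by (auto simp: upairs_def ij intro!: borel_measurable_times borel_measurable_prod borel_measurable_diff measurable_near)
qed

section \<open>Expected numbers of close matchings and of their defects\<close>

definition match_weight :: "real \<Rightarrow> nat \<Rightarrow> (nat \<Rightarrow> real^3) \<Rightarrow> (nat \<times> nat) list \<Rightarrow> real" where
  "match_weight t k x xs = (\<Prod>i<k. of_bool (near t x (verts xs ! (2 * i)) (verts xs ! (2 * i + 1))))"

lemma match_weight_pairing:
  "match_weight t k x xs = pairing t k (\<lambda>i\<in>{..<2 * k}. x (verts xs ! i))"
  unfolding match_weight_def pairing_def of_bool_near by (intro prod.cong) auto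

lemma match_weight_bounds: "0 \<le> match_weight t k x xs" "match_weight t k x xs \<le> 1"
  unfolding match_weight_pairing by (rule pairing_nonneg pairing_le_1)+

lemma verts_inj:
  assumes "xs \<in> matchings n k"
  shows "inj_on (\<lambda>i. verts xs ! i) {..<2 * k}" "(\<lambda>i. verts xs ! i) ` {..<2 * k} \<subseteq> {..<n}"
proof -
  have len: "length (verts xs) = 2 * k" and d: "distinct (verts xs)" using assms by (auto simp: matchings_def)
  show "inj_on (\<lambda>i. verts xs ! i) {..<2 * k}" using d len by (auto simp: inj_on_def nth_eq_iff_index_eq)
  show "(\<lambda>i. verts xs ! i) ` {..<2 * k} \<subseteq> {..<n}"
    using matchings_verts_less[OF assms] len by (metis image_subsetI lessThan_iff nth_mem subsetD)
qed

lemma measurable_sub_match: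
  assumes "xs \<in> matchings n k" "h \<in> borel_measurable (sphere_prod (2 * k))"
  shows "(\<lambda>x. h (\<lambda>i\<in>{..<2 * k}. x (verts xs ! i))) \<in> borel_measurable (sphere_prod n)"
proof (rule measurable_compose[OF _ assms(2)])
  show "(\<lambda>x. \<lambda>i\<in>{..<2 * k}. x (verts xs ! i)) \<in> sphere_prod n \<rightarrow>\<^sub>M sphere_prod (2 * k)"
    using verts_inj(2)[OF assms(1)] by (intro measurable_restrict measurable_component_singleton) auto
qed

lemma integrable_ensembleI:
  fixes f :: "(nat \<Rightarrow> real^3) \<Rightarrow> real"
  assumes "f \<in> borel_measurable (sphere_prod n)" "\<And>x. \<bar>f x\<bar> \<le> B"
  shows "integrable (ensemble n) f"
proof -
  interpret prob_space "ensemble n" by (rule prob_space_ensemble)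
  have "f \<in> borel_measurable (ensemble n)" using assms(1) by (simp cong: measurable_cong_sets)
  then show ?thesis using assms(2) by (intro integrable_const_bound[where B = B]) auto
qed

lemma measurable_match_weight: "xs \<in> matchings n k \<Longrightarrow> (\<lambda>x. match_weight t k x xs) \<in> borel_measurable (sphere_prod n)"
  unfolding match_weight_pairing by (rule measurable_sub_match[OF _ measurable_pairing]) auto

definition pair_corr :: "nat \<Rightarrow> real \<Rightarrow> nat \<Rightarrow> real" where
  "pair_corr n t k = (\<integral>y. pairing t k y * ker_det n (2 * k) y \<partial>sphere_prod (2 * k))"

lemma card_matchings_real:
  "2 * k \<le> n \<Longrightarrow> real (card (matchings n k)) * (fact (n - 2 * k) / fact n) = 1 / 2 ^ k"
proof -
  assume "2 * k \<le> n"
  from arg_cong[OF card_matchings[OF this], of real]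
  have "real (card (matchings n k)) * 2 ^ k * fact (n - 2 * k) = fact n" by simp
  then show ?thesis by (simp add: field_simps)
qed

lemma expectation_match_weight:
  assumes "xs \<in> matchings n k"
  shows "(\<integral>x. match_weight t k x xs \<partial>ensemble n) = fact (n - 2 * k) / fact n * pair_corr n t k"
  unfolding match_weight_pairing pair_corr_def
  by (rule integral_ensemble_subfamily[OF verts_inj[OF assms], where B = 1])
     (auto simp: pairing_nonneg pairing_le_1 measurable_pairing)

text \<open>In the coordinates selected by the matching the event is \<open>cross_close\<close>, so
  the sphere estimate applies.\<close>

lemma expectation_cross:
  assumes xs: "xs \<in> matchings n k" and n: "n \<ge> 1" and t: "0 \<le> t" "3 * t \<le> 2"
  shows "integrable (ensemble n) (\<lambda>x. match_weight t k x xs * of_bool (\<exists>a<2 * k. \<exists>b<2 * k. a div 2 \<noteq> b div 2 \<and> near t x (verts xs ! a) (verts xs ! b)))"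
    and "(\<integral>x. match_weight t k x xs * of_bool (\<exists>a<2 * k. \<exists>b<2 * k. a div 2 \<noteq> b div 2 \<and> near t x (verts xs ! a) (verts xs ! b)) \<partial>ensemble n)
      \<le> fact (n - 2 * k) / fact n * (pmass n t ^ k * ((real k)\<^sup>2 * (3 * t)\<^sup>2 / 4))"
proof -
  let ?y = "\<lambda>x. \<lambda>i\<in>{..<2 * k}. x (verts xs ! i)"
  let ?b = "\<lambda>x. of_bool (\<exists>a<2 * k. \<exists>b<2 * k. a div 2 \<noteq> b div 2 \<and> near t x (verts xs ! a) (verts xs ! b)) :: real"
  have b: "?b x = cross_close t k (?y x)" for x
  proof (cases "\<exists>a<2 * k. \<exists>b<2 * k. a div 2 \<noteq> b div 2 \<and> near t x (verts xs ! a) (verts xs ! b)")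
    case True
    then obtain a b where "a < 2 * k" "b < 2 * k" "a div 2 \<noteq> b div 2" "near t x (verts xs ! a) (verts xs ! b)" by auto
    then have "cross_close t k (?y x) = 1" by (intro cross_close_eq_1[of a k b]) (auto simp: near_def)
    then show ?thesis using True by simp
  next
    case False
    have "cross_close t k (?y x) = 0"
    proof (rule ccontr)
      assume "cross_close t k (?y x) \<noteq> 0"
      then obtain a b where "a < 2 * k" "b < 2 * k" "a div 2 \<noteq> b div 2" "dist (?y x a) (?y x b) \<le> t"
        by (rule cross_closeE)
      then show False using False by (auto simp: near_def)
    qed
    then show ?thesis using False by simp
  qed
  have meas: "(\<lambda>y. pairing t k y * cross_close t k y) \<in> borel_measurable (sphere_prod (2 * k))"
    by (intro borel_measurable_times measurable_pairing measurable_cross_close) auto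
  have bd: "\<bar>pairing t k y * cross_close t k y\<bar> \<le> 1" for y
    by (auto simp: abs_mult pairing_nonneg pairing_le_1 cross_close_nonneg cross_close_le_1 intro!: mult_le_one)
  show "integrable (ensemble n) (\<lambda>x. match_weight t k x xs * ?b x)"
    unfolding b match_weight_pairing by (rule integrable_ensembleI[OF measurable_sub_match[OF xs meas] bd])
  have "(\<integral>x. match_weight t k x xs * ?b x \<partial>ensemble n) =
      fact (n - 2 * k) / fact n * (\<integral>y. pairing t k y * cross_close t k y * ker_det n (2 * k) y \<partial>sphere_prod (2 * k))"
    unfolding b match_weight_pairing
    by (rule integral_ensemble_subfamily[OF verts_inj[OF xs] meas bd])
  also have "\<dots> \<le> fact (n - 2 * k) / fact n * (pmass n t ^ k * ((real k)\<^sup>2 * (3 * t)\<^sup>2 / 4))"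
    by (intro mult_left_mono integral_cross_close_ker_det[OF n t]) auto
  finally show "(\<integral>x. match_weight t k x xs * ?b x \<partial>ensemble n)
      \<le> fact (n - 2 * k) / fact n * (pmass n t ^ k * ((real k)\<^sup>2 * (3 * t)\<^sup>2 / 4))" .
qed

text \<open>The vertex \<open>v\<close> becomes point \<open>2 * k\<close> of the selected
  subfamily; being outside the matching, it keeps the index map injective.\<close>

lemma expectation_extra:
  assumes xs: "xs \<in> matchings n k" and n: "n \<ge> 1" and t: "0 \<le> t" "t \<le> 2"
    and v: "v < n" "v \<notin> set (verts xs)" and a: "a < 2 * k"
  shows "integrable (ensemble n) (\<lambda>x. match_weight t k x xs * of_bool (near t x (verts xs ! a) v))"
    and "(\<integral>x. match_weight t k x xs * of_bool (near t x (verts xs ! a) v) \<partial>ensemble n)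
      \<le> fact (n - Suc (2 * k)) / fact n * (pmass n t ^ k * (n * t\<^sup>2 / 4))"
proof -
  let ?s = "\<lambda>i. if i < 2 * k then verts xs ! i else v"
  let ?y = "\<lambda>x. \<lambda>i\<in>{..<Suc (2 * k)}. x (?s i)"
  let ?h = "\<lambda>y. pairing t k y * close t (y a) (y (2 * k))"
  have eq: "match_weight t k x xs * of_bool (near t x (verts xs ! a) v) = ?h (?y x)" for x
  proof -
    have "match_weight t k x xs = pairing t k (?y x)"
      unfolding match_weight_def pairing_def of_bool_near by (intro prod.cong) auto
    moreover have "?y x a = x (verts xs ! a)" "?y x (2 * k) = x v" using a by auto
    ultimately show ?thesis by (simp only: of_bool_near)
  qed
  have len: "length (verts xs) = 2 * k" using xs by (simp add: matchings_def)
  have vs: "verts xs ! i \<noteq> v" if "i < 2 * k" for i using that v(2) len nth_mem[of i "verts xs"] by auto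
  have "inj_on ?s {..<2 * k}"
    using verts_inj(1)[OF xs] by (rule inj_on_cong[THEN iffD1, rotated]) simp
  moreover have "v \<notin> ?s ` {..<2 * k}" using vs by auto
  ultimately have inj: "inj_on ?s {..<Suc (2 * k)}"
    unfolding lessThan_Suc by (subst inj_on_insert) simp
  have sub: "?s ` {..<Suc (2 * k)} \<subseteq> {..<n}"
  proof (rule image_subsetI)
    fix i assume "i \<in> {..<Suc (2 * k)}"
    show "?s i \<in> {..<n}"
      using subsetD[OF verts_inj(2)[OF xs], OF imageI, of i] v(1) by (cases "i < 2 * k") auto
  qed
  have meas: "?h \<in> borel_measurable (sphere_prod (Suc (2 * k)))"
    using a by (intro borel_measurable_times measurable_pairing measurable_two_components measurable_close) auto
  have bd: "\<bar>?h y\<bar> \<le> 1" for y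
    by (auto simp: abs_mult pairing_nonneg pairing_le_1 close_nonneg close_le_1 intro!: mult_le_one)
  have ym: "?y \<in> sphere_prod n \<rightarrow>\<^sub>M sphere_prod (Suc (2 * k))"
    using sub by (intro measurable_restrict measurable_component_singleton) auto
  show "integrable (ensemble n) (\<lambda>x. match_weight t k x xs * of_bool (near t x (verts xs ! a) v))"
    unfolding eq by (rule integrable_ensembleI[OF measurable_compose[OF ym meas] bd])
  have "(\<integral>x. match_weight t k x xs * of_bool (near t x (verts xs ! a) v) \<partial>ensemble n) =
      fact (n - Suc (2 * k)) / fact n * (\<integral>y. ?h y * ker_det n (Suc (2 * k)) y \<partial>sphere_prod (Suc (2 * k)))"
    unfolding eq by (rule integral_ensemble_subfamily[OF inj sub meas bd])
  also have "\<dots> \<le> fact (n - Suc (2 * k)) / fact n * (pmass n t ^ k * (n * t\<^sup>2 / 4))"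
    by (intro mult_left_mono integral_extra_point_ker_det[OF n t a]) auto
  finally show "(\<integral>x. match_weight t k x xs * of_bool (near t x (verts xs ! a) v) \<partial>ensemble n)
      \<le> fact (n - Suc (2 * k)) / fact n * (pmass n t ^ k * (n * t\<^sup>2 / 4))" .
qed

text \<open>The first summand counts a third point near one of the \<open>2 * k\<close> chosen ones,
  the second a contact between chosen pairs; \<open>2 ^ k\<close> comes from the number of
  matchings.\<close>

definition isolation_error :: "nat \<Rightarrow> real \<Rightarrow> nat \<Rightarrow> real" where
  "isolation_error n t k = pmass n t ^ k * (2 * real k * (n * t\<^sup>2 / 4) + (real k)\<^sup>2 * (3 * t)\<^sup>2 / 4) / 2 ^ k"

lemma card_isolated_le: "card (isolated n R) \<le> card (upairs n)"
  using isolated_subset rel_pairs_subset by (intro card_mono finite_upairs) blast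

lemma integrable_card_isolated: "integrable (ensemble n) (\<lambda>x. f (card (isolated n (near t x))) :: real)"
proof (rule integrable_ensembleI)
  show "(\<lambda>x. f (card (isolated n (near t x)))) \<in> borel_measurable (sphere_prod n)"
    by (rule measurable_compose[OF measurable_card_isolated]) simp
  show "\<bar>f (card (isolated n (near t x)))\<bar> \<le> Max ((\<lambda>j. \<bar>f j\<bar>) ` {..card (upairs n)})" for x
    using card_isolated_le by (intro Max_ge) auto
qed

lemma expectation_isolated:
  assumes n: "n \<ge> Suc (2 * k)" and t: "0 \<le> t" "3 * t \<le> 2"
  shows "integrable (ensemble n) (\<lambda>x. \<Sum>xs\<in>matchings n k. match_weight t k x xs)"
    and "(\<integral>x. (\<Sum>xs\<in>matchings n k. match_weight t k x xs) \<partial>ensemble n) = pair_corr n t k / 2 ^ k"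
    and "pair_corr n t k / 2 ^ k - isolation_error n t k \<le> (\<integral>x. fact k * real (card (isolated n (near t x)) choose k) \<partial>ensemble n)"
    and "(\<integral>x. fact k * real (card (isolated n (near t x)) choose k) \<partial>ensemble n) \<le> pair_corr n t k / 2 ^ k"
proof -
  have n1: "n \<ge> 1" and t2: "t \<le> 2" and kn: "2 * k \<le> n" using n t by auto
  let ?W = "\<lambda>x. \<Sum>xs\<in>matchings n k. match_weight t k x xs"
  let ?I = "\<lambda>x. fact k * real (card (isolated n (near t x)) choose k)"
  let ?X = "\<lambda>x xs v a. match_weight t k x xs * of_bool (near t x (verts xs ! a) v)"
  let ?C = "\<lambda>x xs. match_weight t k x xs * of_bool (\<exists>a<2 * k. \<exists>b<2 * k. a div 2 \<noteq> b div 2 \<and> near t x (verts xs ! a) (verts xs ! b))"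
  have mw: "integrable (ensemble n) (\<lambda>x. match_weight t k x xs)" if "xs \<in> matchings n k" for xs
    using measurable_match_weight[OF that] match_weight_bounds by (intro integrable_ensembleI[where B = 1]) auto
  show W: "integrable (ensemble n) ?W" using mw by (intro Bochner_Integration.integrable_sum)
  have "(\<integral>x. ?W x \<partial>ensemble n) = (\<Sum>xs\<in>matchings n k. \<integral>x. match_weight t k x xs \<partial>ensemble n)"
    using mw by (intro Bochner_Integration.integral_sum)
  also have "\<dots> = real (card (matchings n k)) * (fact (n - 2 * k) / fact n) * pair_corr n t k"
    by (simp add: expectation_match_weight)
  finally show EW: "(\<integral>x. ?W x \<partial>ensemble n) = pair_corr n t k / 2 ^ k"
    unfolding card_matchings_real[OF kn] by simp
  have I: "integrable (ensemble n) ?I" by (rule integrable_card_isolated)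
  note counts = isolated_counts[where R = "near t x" and n = n and k = k for x, OF near_sym, folded match_weight_def]
  have "(\<integral>x. ?I x \<partial>ensemble n) \<le> (\<integral>x. ?W x \<partial>ensemble n)"
    by (rule integral_mono[OF I W]) (rule counts(1))
  then show "(\<integral>x. ?I x \<partial>ensemble n) \<le> pair_corr n t k / 2 ^ k" unfolding EW .
  let ?V = "\<lambda>xs. {..<n} - set (verts xs)"
  let ?e1 = "fact (n - Suc (2 * k)) / fact n * (pmass n t ^ k * (n * t\<^sup>2 / 4))"
  let ?e2 = "fact (n - 2 * k) / fact n * (pmass n t ^ k * ((real k)\<^sup>2 * (3 * t)\<^sup>2 / 4))"
  have iX: "integrable (ensemble n) (\<lambda>x. ?X x xs v a)" if "xs \<in> matchings n k" "v \<in> ?V xs" "a \<in> {..<2 * k}" for xs v a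
    using that by (intro expectation_extra(1)[OF _ n1 t(1) t2]) auto
  have iC: "integrable (ensemble n) (\<lambda>x. ?C x xs)" if "xs \<in> matchings n k" for xs
    by (rule expectation_cross(1)[OF that n1 t])
  have iB: "integrable (ensemble n) (\<lambda>x. (\<Sum>v\<in>?V xs. \<Sum>a<2 * k. ?X x xs v a) + ?C x xs)" if "xs \<in> matchings n k" for xs
    by (intro Bochner_Integration.integrable_add Bochner_Integration.integrable_sum iX iC that)
  have "(\<integral>x. ?W x \<partial>ensemble n) - (\<integral>x. ?I x \<partial>ensemble n) = (\<integral>x. ?W x - ?I x \<partial>ensemble n)"
    using W I by simp
  also have "\<dots> \<le> (\<integral>x. (\<Sum>xs\<in>matchings n k. (\<Sum>v\<in>?V xs. \<Sum>a<2 * k. ?X x xs v a) + ?C x xs) \<partial>ensemble n)"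
    by (rule integral_mono[OF Bochner_Integration.integrable_diff[OF W I] Bochner_Integration.integrable_sum], erule iB, rule counts(2))
  also have "\<dots> = (\<Sum>xs\<in>matchings n k. \<integral>x. (\<Sum>v\<in>?V xs. \<Sum>a<2 * k. ?X x xs v a) + ?C x xs \<partial>ensemble n)"
    by (rule Bochner_Integration.integral_sum[OF iB])
  also have "\<dots> \<le> (\<Sum>xs\<in>matchings n k. real (n - 2 * k) * (2 * k * ?e1) + ?e2)"
  proof (rule sum_mono)
    fix xs assume xs: "xs \<in> matchings n k"
    have "(\<integral>x. (\<Sum>v\<in>?V xs. \<Sum>a<2 * k. ?X x xs v a) + ?C x xs \<partial>ensemble n) =
       (\<integral>x. (\<Sum>v\<in>?V xs. \<Sum>a<2 * k. ?X x xs v a) \<partial>ensemble n) + (\<integral>x. ?C x xs \<partial>ensemble n)"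
      by (intro Bochner_Integration.integral_add Bochner_Integration.integrable_sum iX iC xs)
    also have "(\<integral>x. (\<Sum>v\<in>?V xs. \<Sum>a<2 * k. ?X x xs v a) \<partial>ensemble n) = (\<Sum>v\<in>?V xs. \<integral>x. (\<Sum>a<2 * k. ?X x xs v a) \<partial>ensemble n)"
      by (intro Bochner_Integration.integral_sum Bochner_Integration.integrable_sum iX xs)
    also have "\<dots> = (\<Sum>v\<in>?V xs. \<Sum>a<2 * k. \<integral>x. ?X x xs v a \<partial>ensemble n)"
      by (intro sum.cong refl Bochner_Integration.integral_sum iX xs)
    also have "\<dots> \<le> (\<Sum>v\<in>?V xs. \<Sum>a<2 * k. ?e1)"
      using xs by (intro sum_mono expectation_extra(2)[OF _ n1 t(1) t2]) auto
    also have "\<dots> = real (card (?V xs)) * (2 * k * ?e1)" by simp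
    also have "card (?V xs) = n - 2 * k"
    proof -
      have "card (set (verts xs)) = 2 * k" using xs by (simp add: matchings_def distinct_card)
      then show ?thesis using matchings_verts_less[OF xs] by (simp add: card_Diff_subset)
    qed
    also have "(\<integral>x. ?C x xs \<partial>ensemble n) \<le> ?e2" by (rule expectation_cross(2)[OF xs n1 t])
    finally show "(\<integral>x. (\<Sum>v\<in>?V xs. \<Sum>a<2 * k. ?X x xs v a) + ?C x xs \<partial>ensemble n) \<le> real (n - 2 * k) * (2 * k * ?e1) + ?e2"
      by simp
  qed
  also have "\<dots> = isolation_error n t k"
  proof -
    \<comment> \<open>There are \<open>n - 2 * k\<close> choices of the extra vertex, which raise
      the factorial of one further observed point to that of the matching alone.\<close>
    have "n - 2 * k = Suc (n - Suc (2 * k))" using n by simp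
    then have f: "fact (n - 2 * k) = real (n - 2 * k) * fact (n - Suc (2 * k))" by simp
    let ?M = "pmass n t ^ k"
    have "real (n - 2 * k) * (2 * k * ?e1) = fact (n - 2 * k) / fact n * (?M * (2 * real k * (n * t\<^sup>2 / 4)))"
      unfolding f by (simp add: mult_ac)
    then have "(\<Sum>xs\<in>matchings n k. real (n - 2 * k) * (2 * k * ?e1) + ?e2) =
        real (card (matchings n k)) * (fact (n - 2 * k) / fact n) * (?M * (2 * real k * (n * t\<^sup>2 / 4) + (real k)\<^sup>2 * (3 * t)\<^sup>2 / 4))"
      by (simp only: sum_constant ring_distribs mult.assoc)
    then show ?thesis unfolding card_matchings_real[OF kn] isolation_error_def by simp
  qed
  finally show "pair_corr n t k / 2 ^ k - isolation_error n t k \<le> (\<integral>x. ?I x \<partial>ensemble n)"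
    unfolding EW by simp
qed


section \<open>Limits of the factorial moments\<close>

lemma pair_corr_limit:
  assumes "x > 0"
  shows "(\<lambda>n. pair_corr n (x / real n powr (3/4)) k) \<longlonglongrightarrow> (x ^ 4 / 32) ^ k"
proof -
  define t where "t n = x / real n powr (3/4)" for n
  \<comment> \<open>Any scale tending to 0 would make crossings negligible; this one is still large
    enough for the kernel error to vanish.\<close>
  define d where "d n = real n powr (-1/4)" for n
  have pm: "(\<lambda>n. pmass n (t n) ^ k) \<longlonglongrightarrow> (x ^ 4 / 32) ^ k"
    unfolding t_def by (intro tendsto_power pmass_limit assms)
  have "(\<lambda>n. d n + 2 * t n) \<longlonglongrightarrow> 0" unfolding d_def t_def using assms by real_asymp
  then have "eventually (\<lambda>n. d n + 2 * t n < 2) sequentially" by (rule order_tendstoD) simp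
  then have ev: "eventually (\<lambda>n. n \<ge> 1 \<and> d n + 2 * t n \<le> 2) sequentially"
    using eventually_ge_at_top[of 1] by eventually_elim simp
  have "(\<lambda>n. pmass n (t n) ^ k * ((real k)\<^sup>2 * (d n + 2 * t n)\<^sup>2 / 4) + fact (2 * k) * (real n ^ (2 * k) * sqrt ((1 - (d n)\<^sup>2 / 4) ^ (n - 1))))
      \<longlonglongrightarrow> (x ^ 4 / 32) ^ k * ((real k)\<^sup>2 * 0\<^sup>2 / 4) + fact (2 * k) * 0"
    using \<open>(\<lambda>n. d n + 2 * t n) \<longlonglongrightarrow> 0\<close> power_times_exp_limit[of "2 * k", folded d_def]
    by (intro tendsto_intros pm) auto
  then have "(\<lambda>n. pmass n (t n) ^ k * ((real k)\<^sup>2 * (d n + 2 * t n)\<^sup>2 / 4) + fact (2 * k) * (real n ^ (2 * k) * sqrt ((1 - (d n)\<^sup>2 / 4) ^ (n - 1))))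
      \<longlonglongrightarrow> 0" by simp
  then have "(\<lambda>n. pair_corr n (t n) k - pmass n (t n) ^ k) \<longlonglongrightarrow> 0"
  proof (rule Lim_null_comparison[rotated])
    show "\<forall>\<^sub>F n in sequentially. norm (pair_corr n (t n) k - pmass n (t n) ^ k) \<le>
       pmass n (t n) ^ k * ((real k)\<^sup>2 * (d n + 2 * t n)\<^sup>2 / 4) + fact (2 * k) * (real n ^ (2 * k) * sqrt ((1 - (d n)\<^sup>2 / 4) ^ (n - 1)))"
      using ev
    proof eventually_elim
      case (elim n)
      then show ?case
        using integral_pairing_ker_det[of n "t n" "d n" k] assms by (simp add: pair_corr_def t_def d_def)
    qed
  qed
  from tendsto_add[OF this pm] show ?thesis by (simp add: t_def)
qed

lemma isolation_error_limit:
  assumes "x > 0"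
  shows "(\<lambda>n. isolation_error n (x / real n powr (3/4)) k) \<longlonglongrightarrow> 0"
proof -
  have 1: "(\<lambda>n. real n * (x / real n powr (3/4))\<^sup>2 / 4) \<longlonglongrightarrow> 0" using assms by real_asymp
  have 2: "(\<lambda>n. 3 * (x / real n powr (3/4))) \<longlonglongrightarrow> 0" using assms by real_asymp
  have "(\<lambda>n. isolation_error n (x / real n powr (3/4)) k) \<longlonglongrightarrow>
     (x ^ 4 / 32) ^ k * (2 * real k * 0 + (real k)\<^sup>2 * 0\<^sup>2 / 4) / 2 ^ k"
    unfolding isolation_error_def by (intro tendsto_intros pmass_limit assms 1 2) auto
  then show ?thesis by simp
qed

lemma eventually_radius:
  assumes "x > 0"
  shows "\<forall>\<^sub>F n in sequentially. n \<ge> Suc (2 * k) \<and> 3 * (x / real n powr (3/4)) \<le> 2"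
proof -
  have "(\<lambda>n. 3 * (x / real n powr (3/4))) \<longlonglongrightarrow> 0" using assms by real_asymp
  then have "eventually (\<lambda>n. 3 * (x / real n powr (3/4)) < 2) sequentially" by (rule order_tendstoD) simp
  then show ?thesis using eventually_ge_at_top[of "Suc (2 * k)"] by eventually_elim simp
qed

text \<open>The k pairs are unordered, which divides the limit for ordered pairs by
  \<open>2 ^ k\<close> and turns 32 into 64.\<close>

lemma isolated_factorial_moments:
  assumes "x > 0"
  shows "(\<lambda>n. \<integral>y. real (card (isolated n (near (x / real n powr (3/4)) y)) choose k) \<partial>ensemble n) \<longlonglongrightarrow> (x ^ 4 / 64) ^ k / fact k"
proof -
  define t where "t n = x / real n powr (3/4)" for n
  have "(\<lambda>n. \<integral>y. fact k * real (card (isolated n (near (t n) y)) choose k) \<partial>ensemble n) \<longlonglongrightarrow> (x ^ 4 / 32) ^ k / 2 ^ k"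
  proof (rule tendsto_sandwich)
    have "(\<lambda>n. pair_corr n (t n) k / 2 ^ k - isolation_error n (t n) k) \<longlonglongrightarrow> (x ^ 4 / 32) ^ k / 2 ^ k - 0"
      unfolding t_def by (intro tendsto_intros pair_corr_limit isolation_error_limit assms) auto
    then show "(\<lambda>n. pair_corr n (t n) k / 2 ^ k - isolation_error n (t n) k) \<longlonglongrightarrow> (x ^ 4 / 32) ^ k / 2 ^ k" by simp
    show "(\<lambda>n. pair_corr n (t n) k / 2 ^ k) \<longlonglongrightarrow> (x ^ 4 / 32) ^ k / 2 ^ k"
      unfolding t_def by (intro tendsto_intros pair_corr_limit assms) auto
    show "\<forall>\<^sub>F n in sequentially. pair_corr n (t n) k / 2 ^ k - isolation_error n (t n) k \<le>
        (\<integral>y. fact k * real (card (isolated n (near (t n) y)) choose k) \<partial>ensemble n)"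
      using eventually_radius[OF assms, of k]
    proof eventually_elim
      case (elim n)
      show ?case unfolding t_def by (rule expectation_isolated(3)) (use elim assms in auto)
    qed
    show "\<forall>\<^sub>F n in sequentially. (\<integral>y. fact k * real (card (isolated n (near (t n) y)) choose k) \<partial>ensemble n) \<le>
        pair_corr n (t n) k / 2 ^ k"
      using eventually_radius[OF assms, of k]
    proof eventually_elim
      case (elim n)
      show ?case unfolding t_def by (rule expectation_isolated(4)) (use elim assms in auto)
    qed
  qed
  from tendsto_divide[OF this tendsto_const[of "fact k"]] show ?thesis
    by (simp add: t_def flip: power_divide)
qed

text \<open>For \<open>k = 1\<close> the matching count is the number of close pairs, so the moment
  estimates also control its difference from the isolated count.\<close>

lemma sum_match_weight_1: "(\<Sum>xs\<in>matchings n 1. match_weight t 1 x xs) = real (card (rel_pairs n (near t x)))"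
proof -
  have m: "matchings n 1 = (\<lambda>p. [p]) ` upairs n"
    by (auto simp: matchings_def upairs_def length_Suc_conv image_iff)
  have "(\<Sum>xs\<in>matchings n 1. match_weight t 1 x xs) = (\<Sum>p\<in>upairs n. match_weight t 1 x [p])"
    unfolding m by (subst sum.reindex) (auto simp: inj_on_def)
  also have "\<dots> = (\<Sum>p\<in>upairs n. if p \<in> rel_pairs n (near t x) then 1 else 0)"
    by (intro sum.cong) (auto simp: match_weight_def rel_pairs_def upairs_def)
  also have "\<dots> = (\<Sum>p | p \<in> upairs n \<and> p \<in> rel_pairs n (near t x). 1)"
    by (rule sum.inter_filter[symmetric, OF finite_upairs])
  also have "{p. p \<in> upairs n \<and> p \<in> rel_pairs n (near t x)} = rel_pairs n (near t x)"
    using rel_pairs_subset by blast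
  finally show ?thesis by simp
qed

text \<open>Markov's inequality: the two counts are ordered integers, so where they differ their
  difference is at least 1, and its expectation is at most the isolation error.\<close>

lemma not_isolated_limit:
  assumes "x > 0"
  shows "(\<lambda>n. measure (ensemble n) {y \<in> space (ensemble n). card (rel_pairs n (near (x / real n powr (3/4)) y)) \<noteq>
    card (isolated n (near (x / real n powr (3/4)) y))}) \<longlonglongrightarrow> 0"
proof (rule tendsto_sandwich[OF _ _ tendsto_const isolation_error_limit[OF assms, of 1]])
  show "\<forall>\<^sub>F n in sequentially. measure (ensemble n) {y \<in> space (ensemble n). card (rel_pairs n (near (x / real n powr (3/4)) y)) \<noteq>
    card (isolated n (near (x / real n powr (3/4)) y))} \<le> isolation_error n (x / real n powr (3/4)) 1"
    using eventually_radius[OF assms, of 1]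
  proof eventually_elim
    case (elim n)
    define t where "t = x / real n powr (3/4)"
    interpret prob_space "ensemble n" by (rule prob_space_ensemble)
    let ?G = "\<lambda>y. card (rel_pairs n (near t y))" and ?I = "\<lambda>y. card (isolated n (near t y))"
    have n: "n \<ge> Suc (2 * 1)" and t: "0 \<le> t" "3 * t \<le> 2" using elim assms by (auto simp: t_def)
    note E = expectation_isolated[OF n t, unfolded sum_match_weight_1]
    have iI: "integrable (ensemble n) (\<lambda>y. real (?I y))" by (rule integrable_card_isolated)
    have GI: "?I y \<le> ?G y" for y
      using finite_subset[OF rel_pairs_subset finite_upairs] by (intro card_mono isolated_subset) auto
    have [measurable]: "?G \<in> ensemble n \<rightarrow>\<^sub>M count_space UNIV" "?I \<in> ensemble n \<rightarrow>\<^sub>M count_space UNIV"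
      using measurable_card_rel_pairs measurable_card_isolated by (simp_all cong: measurable_cong_sets)
    have set: "{y \<in> space (ensemble n). ?G y \<noteq> ?I y} \<in> sets (ensemble n)"
      using measurable_compose_countable'[where f = "\<lambda>i y. ?G y \<noteq> i" and g = ?I and M = "ensemble n" and N = "count_space UNIV" and I = UNIV]
      by measurable
    have "measure (ensemble n) {y \<in> space (ensemble n). ?G y \<noteq> ?I y} = (\<integral>y. indicator {y \<in> space (ensemble n). ?G y \<noteq> ?I y} y \<partial>ensemble n)"
      unfolding Bochner_Integration.integral_indicator by (rule arg_cong[where f = prob]) auto
    also have "\<dots> \<le> (\<integral>y. real (?G y) - real (?I y) \<partial>ensemble n)"
    proof (rule integral_mono)
      show "integrable (ensemble n) (indicat_real {y \<in> space (ensemble n). ?G y \<noteq> ?I y})"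
        using set by (intro integrable_const_bound[where B = 1] borel_measurable_indicator) (auto simp: indicator_def)
      show "integrable (ensemble n) (\<lambda>y. real (?G y) - real (?I y))" using E(1) iI by simp
      fix y show "indicat_real {y \<in> space (ensemble n). ?G y \<noteq> ?I y} y \<le> real (?G y) - real (?I y)"
        using GI[of y] by (auto simp: indicator_def)
    qed
    also have "\<dots> = pair_corr n t 1 / 2 - (\<integral>y. real (?I y) \<partial>ensemble n)"
      using E(1,2) iI by simp
    also have "\<dots> \<le> isolation_error n t 1" using E(3) by simp
    finally show ?case unfolding t_def .
  qed
qed (auto simp: measure_nonneg)

section \<open>Convergence in distribution\<close>

lemma poisson_close_pairs:
  assumes "x > 0"
  shows "(\<lambda>n. measure (ensemble n) {y \<in> space (ensemble n). card (rel_pairs n (near (x / real n powr (3/4)) y)) = m})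
    \<longlonglongrightarrow> pmf (poisson_pmf (x ^ 4 / 64)) m"
proof -
  define t where "t n = x / real n powr (3/4)" for n
  define G where "G n y = card (rel_pairs n (near (t n) y))" for n y
  define I where "I n y = card (isolated n (near (t n) y))" for n y
  define p where "p n = measure (ensemble n) {y \<in> space (ensemble n). G n y = m}" for n
  define q where "q n = measure (ensemble n) {y \<in> space (ensemble n). I n y = m}" for n
  define r where "r n = measure (ensemble n) {y \<in> space (ensemble n). G n y \<noteq> I n y}" for n
  have meas: "G n \<in> ensemble n \<rightarrow>\<^sub>M count_space UNIV" "I n \<in> ensemble n \<rightarrow>\<^sub>M count_space UNIV" for n
    using measurable_card_rel_pairs measurable_card_isolated by (simp_all add: G_def[abs_def] I_def[abs_def] cong: measurable_cong_sets)
  have q: "q \<longlonglongrightarrow> (x ^ 4 / 64) ^ m / fact m * exp (- (x ^ 4 / 64))"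
    unfolding q_def
  proof (rule poisson_limit_factorial_moments[OF prob_space_ensemble meas(2)])
    show "I n y \<le> card (upairs n)" for n y unfolding I_def by (rule card_isolated_le)
    show "(\<lambda>n. \<integral>y. real (I n y choose k) \<partial>ensemble n) \<longlonglongrightarrow> (x ^ 4 / 64) ^ k / fact k" for k
      unfolding I_def t_def by (rule isolated_factorial_moments[OF assms])
  qed
  have r: "r \<longlonglongrightarrow> 0" unfolding r_def G_def I_def t_def by (rule not_isolated_limit[OF assms])
  have pq: "\<bar>p n - q n\<bar> \<le> r n" for n
  proof -
    interpret prob_space "ensemble n" by (rule prob_space_ensemble)
    note [measurable] = meas[of n]
    have le: "prob A \<le> prob B + r n" if "A \<subseteq> B \<union> {y \<in> space (ensemble n). G n y \<noteq> I n y}" "A \<in> events" "B \<in> events" for A B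
    proof -
      have R: "{y \<in> space (ensemble n). G n y \<noteq> I n y} \<in> events" by measurable
      have "prob A \<le> prob (B \<union> {y \<in> space (ensemble n). G n y \<noteq> I n y})" using that R by (intro finite_measure_mono) auto
      also have "\<dots> \<le> prob B + r n" unfolding r_def using that R by (intro measure_Un_le) auto
      finally show ?thesis .
    qed
    have "p n \<le> q n + r n" unfolding p_def q_def by (rule le) (auto, measurable)
    moreover have "q n \<le> p n + r n" unfolding p_def q_def by (rule le) (auto, measurable)
    ultimately show ?thesis by linarith
  qed
  have "(\<lambda>n. p n - q n) \<longlonglongrightarrow> 0"
    by (rule Lim_null_comparison[OF _ r]) (use pq in auto)
  from tendsto_add[OF this q] have "p \<longlonglongrightarrow> (x ^ 4 / 64) ^ m / fact m * exp (- (x ^ 4 / 64))" by simp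
  then show ?thesis using assms by (simp add: p_def[abs_def] G_def t_def)
qed

text \<open>Each value of the distribution function is a finite sum of point masses, so convergence
  of the masses gives convergence at every real, jumps included.\<close>

lemma cdf_nat_valued:
  assumes M: "prob_space M" and X: "X \<in> M \<rightarrow>\<^sub>M count_space UNIV"
  shows "cdf (distr M borel (\<lambda>\<omega>. real (X \<omega>))) y = (\<Sum>m | real m \<le> y. measure M {\<omega> \<in> space M. X \<omega> = m})"
proof -
  interpret prob_space M by fact
  have fin: "finite {m. real m \<le> y}"
    by (rule finite_subset[of _ "{..nat \<lfloor>y\<rfloor>}"]) (auto simp: le_nat_floor)
  have meas: "(\<lambda>\<omega>. real (X \<omega>)) \<in> borel_measurable M" by (rule measurable_compose[OF X]) simp
  have sets: "{\<omega> \<in> space M. X \<omega> = m} \<in> events" for m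
    using measurable_sets[OF X, of "{m}"] by (simp add: vimage_def Int_def conj_commute)
  have "cdf (distr M borel (\<lambda>\<omega>. real (X \<omega>))) y = prob ((\<lambda>\<omega>. real (X \<omega>)) -` {..y} \<inter> space M)"
    unfolding cdf_def2 using meas by (intro measure_distr) auto
  also have "(\<lambda>\<omega>. real (X \<omega>)) -` {..y} \<inter> space M = (\<Union>m\<in>{m. real m \<le> y}. {\<omega> \<in> space M. X \<omega> = m})" by auto
  also have "prob \<dots> = (\<Sum>m | real m \<le> y. prob {\<omega> \<in> space M. X \<omega> = m})"
    using fin sets by (intro finite_measure_finite_Union) (auto simp: disjoint_family_on_def)
  finally show ?thesis .
qed

section \<open>Transfer to arbitrary realizations of the ensemble\<close>

lemma double_sum_symmetric:
  fixes f :: "nat \<Rightarrow> nat \<Rightarrow> real"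
  assumes "\<And>i j. f i j = f j i"
  shows "(\<Sum>j<n. \<Sum>i<n. if i = j then 0 else f i j) = 2 * (\<Sum>j<n. \<Sum>i<j. f i j)"
proof (induction n)
  case (Suc n)
  have 1: "(\<Sum>i<n. if i = n then 0 else f i n) = (\<Sum>i<n. f i n)" by (intro sum.cong) auto
  have 2: "(\<Sum>j<n. if n = j then 0 else f n j) = (\<Sum>j<n. f j n)" using assms by (intro sum.cong) auto
  have 3: "sum (f n) {..<n} = (\<Sum>i<n. f i n)" using assms by (intro sum.cong) auto
  show ?case using Suc by (simp add: sum.distrib 1 2 3)
qed simp

text \<open>The triangular sum is not visibly invariant, but twice it is the full sum off the
  diagonal, where both indices can be permuted freely.\<close>

lemma close_pairs_permute:
  assumes \<sigma>: "\<sigma> permutes {..<n}"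
  shows "close_pairs n t (\<lambda>i. P (\<sigma> i)) \<omega> = close_pairs n t P \<omega>"
proof -
  let ?f = "\<lambda>P i j. of_bool (dist (P i \<omega>) (P j \<omega>) \<le> t) :: real"
  have s: "?f P i j = ?f P j i" for P :: "nat \<Rightarrow> 'a \<Rightarrow> real^3" and i j by (simp add: dist_commute)
  have "(\<Sum>j<n. \<Sum>i<n. if i = j then 0 else ?f (\<lambda>i. P (\<sigma> i)) i j) =
      (\<Sum>j<n. \<Sum>i<n. if \<sigma> i = \<sigma> j then 0 else ?f P (\<sigma> i) (\<sigma> j))"
    using permutes_inj[OF \<sigma>] by (simp add: inj_eq)
  also have "\<dots> = (\<Sum>j<n. \<Sum>i<n. if i = \<sigma> j then 0 else ?f P i (\<sigma> j))"
    by (intro sum.cong refl sum.permute[OF \<sigma>, unfolded o_def, symmetric])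
  also have "\<dots> = (\<Sum>j<n. \<Sum>i<n. if i = j then 0 else ?f P i j)"
    using sum.permute[OF \<sigma>, of "\<lambda>j. \<Sum>i<n. if i = j then 0 else ?f P i j"] by (simp add: o_def)
  finally show ?thesis
    unfolding close_pairs_def double_sum_symmetric[of "?f P", OF s[of P]] double_sum_symmetric[of "?f (\<lambda>i. P (\<sigma> i))", OF s[of "\<lambda>i. P (\<sigma> i)"]] by simp
qed

lemma close_pairs_card:
  "close_pairs n t (\<lambda>i y. y i) y = real (card (rel_pairs n (near t y)))"
proof -
  have "rel_pairs n (near t y) = (\<lambda>(j, i). (i, j)) ` (SIGMA j:{..<n}. {i. i < j \<and> near t y i j})"
    by (auto simp: rel_pairs_def image_iff)
  then have "card (rel_pairs n (near t y)) = card (SIGMA j:{..<n}. {i. i < j \<and> near t y i j})"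
    by (simp add: card_image inj_on_def)
  also have "\<dots> = (\<Sum>j<n. card {i. i < j \<and> near t y i j})" by simp
  finally have "real (card (rel_pairs n (near t y))) = (\<Sum>j<n. real (card {i. i < j \<and> near t y i j}))" by simp
  also have "\<dots> = (\<Sum>j<n. \<Sum>i<j. of_bool (dist (y i) (y j) \<le> t))"
  proof (intro sum.cong refl)
    fix j
    have "(\<Sum>i<j. of_bool (dist (y i) (y j) \<le> t)) = (\<Sum>i\<in>{..<j}. if near t y i j then 1 else 0 :: real)"
      by (intro sum.cong) (auto simp: near_def)
    also have "\<dots> = (\<Sum>i\<in>{i \<in> {..<j}. near t y i j}. 1)" by (rule sum.inter_filter[symmetric]) simp
    finally show "real (card {i. i < j \<and> near t y i j}) = (\<Sum>i<j. of_bool (dist (y i) (y j) \<le> t))" by simp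
  qed
  finally show ?thesis by (simp add: close_pairs_def)
qed

text \<open>Both densities are multiples of the same function and have total mass 1, so the
  multiples agree.\<close>

lemma ensemble_unique:
  assumes P: "prob_space (density (sphere_prod n) (\<lambda>p. ennreal (c * vandermonde_sq n p)))" and c: "c > 0"
    and vm: "vandermonde_sq n \<in> borel_measurable (sphere_prod n)"
  shows "density (sphere_prod n) (\<lambda>p. ennreal (c * vandermonde_sq n p)) = ensemble n"
proof -
  define k where "k = c * fact n / vdm_const n"
  have k0: "k > 0" using c vdm_const_pos[of n] by (simp add: k_def)
  have eq: "ennreal (c * vandermonde_sq n y) = ennreal k * ennreal ((cmod (slater n y))\<^sup>2 / fact n)"
    if "y \<in> space (sphere_prod n)" for y
  proof -
    have "(cmod (slater n y))\<^sup>2 = vdm_const n * vandermonde_sq n y"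
      unfolding slater_def using space_sphere_prod_D[OF that] by (intro vandermonde_sq_eq) auto
    then have "c * vandermonde_sq n y = k * ((cmod (slater n y))\<^sup>2 / fact n)"
      using vdm_const_pos[of n] by (simp add: k_def)
    then show ?thesis using k0 by (simp only: ennreal_mult' less_imp_le)
  qed
  have "1 = emeasure (density (sphere_prod n) (\<lambda>p. ennreal (c * vandermonde_sq n p))) (space (sphere_prod n))"
    using prob_space.emeasure_space_1[OF P] by simp
  also have "\<dots> = (\<integral>\<^sup>+y. ennreal (c * vandermonde_sq n y) \<partial>sphere_prod n)"
    using vm by (subst emeasure_density) (auto intro!: nn_integral_cong simp: indicator_def)
  also have "\<dots> = (\<integral>\<^sup>+y. ennreal k * ennreal ((cmod (slater n y))\<^sup>2 / fact n) \<partial>sphere_prod n)"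
    by (rule nn_integral_cong) (rule eq)
  also have "\<dots> = ennreal k * (\<integral>\<^sup>+y. ennreal ((cmod (slater n y))\<^sup>2 / fact n) \<partial>sphere_prod n)"
    by (rule nn_integral_cmult) measurable
  also have "(\<integral>\<^sup>+y. ennreal ((cmod (slater n y))\<^sup>2 / fact n) \<partial>sphere_prod n) = emeasure (ensemble n) (space (sphere_prod n))"
    unfolding ensemble_def by (subst emeasure_density) (auto intro!: nn_integral_cong simp: indicator_def)
  also have "\<dots> = 1" using prob_space.emeasure_space_1[OF prob_space_ensemble[of n]] by simp
  finally have "ennreal k = 1" by simp
  then have "ennreal (c * vandermonde_sq n y) = ennreal ((cmod (slater n y))\<^sup>2 / fact n)" if "y \<in> space (sphere_prod n)" for y
    using eq[OF that] by simp
  then show ?thesis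
    unfolding ensemble_def using vm by (intro density_cong AE_I2) auto
qed

lemma measurable_vandermonde_sq: "vandermonde_sq n \<in> borel_measurable (sphere_prod n)"
  unfolding vandermonde_sq_def[abs_def]
  by (intro borel_measurable_prod borel_measurable_power measurable_two_components[where g = dist]) auto

text \<open>The joint law is known only after a random relabelling. The number of close pairs
  ignores labels, so the permutation can be projected away again.\<close>

lemma distr_close_pairs:
  assumes "spherical_ensemble n M P"
  shows "distr M borel (close_pairs n t P) = distr (ensemble n) borel (\<lambda>y. real (card (rel_pairs n (near t y))))"
proof -
  interpret M: prob_space M using assms by (simp add: spherical_ensemble_def)
  have P: "P i \<in> M \<rightarrow>\<^sub>M restrict_space borel S2" if "i < n" for i using assms that by (simp add: spherical_ensemble_def)
  let ?S = "{\<sigma>. \<sigma> permutes {..<n}}"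
  let ?U = "uniform_count_measure ?S"
  let ?\<Phi> = "\<lambda>(\<omega>, \<sigma>). \<lambda>i\<in>{..<n}. P (\<sigma> i) \<omega>"
  let ?L = "\<Pi>\<^sub>M i\<in>{..<n}. restrict_space borel S2"
  obtain c where c: "c > 0" and D: "distr (M \<Otimes>\<^sub>M ?U) ?L ?\<Phi> = density (sphere_prod n) (\<lambda>p. ennreal (c * vandermonde_sq n p))"
    using assms by (auto simp: spherical_ensemble_def)
  have finS: "finite ?S" by (simp add: finite_permutations)
  have "id \<in> ?S" by (simp add: permutes_id)
  then have neS: "?S \<noteq> {}" by blast
  interpret U: prob_space ?U by (rule prob_space_uniform_count_measure[OF finS neS])
  interpret MU: pair_prob_space M ?U ..
  have setsL: "sets ?L = sets (sphere_prod n)" by (intro sets_PiM_cong) (auto simp: sets_surface_measure)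
  have lt: "\<sigma> i < n" if "\<sigma> \<in> ?S" "i < n" for \<sigma> i using permutes_in_image[of \<sigma> "{..<n}" i] that by simp
  have \<Phi>: "?\<Phi> \<in> M \<Otimes>\<^sub>M ?U \<rightarrow>\<^sub>M ?L"
    unfolding case_prod_beta
  proof (rule measurable_restrict)
    fix i assume i: "i \<in> {..<n}"
    show "(\<lambda>z. P (snd z i) (fst z)) \<in> M \<Otimes>\<^sub>M ?U \<rightarrow>\<^sub>M restrict_space borel S2"
    proof (rule measurable_compose_countable'[where f = "\<lambda>\<sigma> z. P (\<sigma> i) (fst z)" and g = snd and I = ?S])
      show "(\<lambda>z. P (\<sigma> i) (fst z)) \<in> M \<Otimes>\<^sub>M ?U \<rightarrow>\<^sub>M restrict_space borel S2" if "\<sigma> \<in> ?S" for \<sigma>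
        by (rule measurable_compose[OF measurable_fst P[OF lt[OF that]]]) (use i in auto)
      show "snd \<in> M \<Otimes>\<^sub>M ?U \<rightarrow>\<^sub>M count_space ?S"
        using measurable_snd[of M ?U] by (simp cong: measurable_cong_sets add: measurable_cong_sets[OF refl sets_uniform_count_measure_count_space])
      show "countable ?S" by (rule countable_finite[OF finS])
    qed
  qed
  let ?g = "\<lambda>y. real (card (rel_pairs n (near t y)))"
  have g: "?g \<in> borel_measurable (sphere_prod n)"
    by (rule measurable_compose[OF measurable_card_rel_pairs]) simp
  then have gL: "?g \<in> borel_measurable ?L" by (simp only: measurable_cong_sets[OF setsL refl])
  have "prob_space (distr (M \<Otimes>\<^sub>M ?U) ?L ?\<Phi>)" by (rule MU.prob_space_distr[OF \<Phi>])
  then have ens: "distr (M \<Otimes>\<^sub>M ?U) ?L ?\<Phi> = ensemble n"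
    unfolding D by (intro ensemble_unique c measurable_vandermonde_sq)
  have cp: "close_pairs n t P \<in> borel_measurable M"
  proof -
    have PB: "P i \<in> M \<rightarrow>\<^sub>M borel" if "i < n" for i
      using P[OF that] by (simp add: measurable_restrict_space2_iff)
    have "(\<lambda>\<omega>. of_bool (dist (P i \<omega>) (P j \<omega>) \<le> t) :: real) \<in> borel_measurable M" if "i < n" "j < n" for i j
    proof -
      note [measurable] = PB[OF that(1)] PB[OF that(2)]
      show ?thesis by measurable
    qed
    then show ?thesis unfolding close_pairs_def[abs_def] by (intro borel_measurable_sum) auto
  qed
  have "distr (ensemble n) borel ?g = distr (M \<Otimes>\<^sub>M ?U) borel (?g \<circ> ?\<Phi>)"
    unfolding ens[symmetric] by (rule distr_distr[OF gL \<Phi>])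
  also have "\<dots> = distr (M \<Otimes>\<^sub>M ?U) borel (close_pairs n t P \<circ> fst)"
  proof (rule distr_cong[OF refl refl])
    fix z assume "z \<in> space (M \<Otimes>\<^sub>M ?U)"
    then obtain \<omega> \<sigma> where z: "z = (\<omega>, \<sigma>)" and \<sigma>: "\<sigma> \<in> ?S"
      by (auto simp: space_pair_measure space_uniform_count_measure)
    have "(?g \<circ> ?\<Phi>) z = close_pairs n t (\<lambda>i y. y i) (\<lambda>i\<in>{..<n}. P (\<sigma> i) \<omega>)"
      by (simp add: z close_pairs_card)
    also have "\<dots> = close_pairs n t (\<lambda>i. P (\<sigma> i)) \<omega>"
      unfolding close_pairs_def by (intro sum.cong refl) auto
    also have "\<dots> = (close_pairs n t P \<circ> fst) z" using \<sigma> by (simp add: z close_pairs_permute)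
    finally show "(?g \<circ> ?\<Phi>) z = (close_pairs n t P \<circ> fst) z" .
  qed
  also have "\<dots> = distr (distr (M \<Otimes>\<^sub>M ?U) M fst) borel (close_pairs n t P)"
    by (rule distr_distr[OF cp measurable_fst, symmetric])
  also have "distr (M \<Otimes>\<^sub>M ?U) M fst = M" by (rule U.distr_pair_fst)
  finally show ?thesis by simp
qed

theorem theorem1p5:
  fixes x :: real
    and M :: "nat \<Rightarrow> 'a measure"
    and P :: "nat \<Rightarrow> nat \<Rightarrow> 'a \<Rightarrow> real^3"
  assumes "x > 0"
    and "\<And>n. n \<ge> 1 \<Longrightarrow> spherical_ensemble n (M n) (P n)"
  shows "weak_conv_m
           (\<lambda>n. distr (M n) borel (close_pairs n (x / real n powr (3/4)) (P n)))
           (distr (measure_pmf (poisson_pmf (x ^ 4 / 64))) borel real)"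
  unfolding weak_conv_m_def weak_conv_def
proof (intro allI impI)
  fix y :: real
  let ?t = "\<lambda>n. x / real n powr (3/4)"
  let ?p = "\<lambda>n m. measure (ensemble n) {\<omega> \<in> space (ensemble n). card (rel_pairs n (near (?t n) \<omega>)) = m}"
  have meas: "(\<lambda>\<omega>. card (rel_pairs n (near (?t n) \<omega>))) \<in> ensemble n \<rightarrow>\<^sub>M count_space UNIV" for n
    using measurable_card_rel_pairs by (simp cong: measurable_cong_sets)
  have cdf_eq: "cdf (distr (M n) borel (close_pairs n (?t n) (P n))) y = (\<Sum>m | real m \<le> y. ?p n m)" if "n \<ge> 1" for n
    unfolding distr_close_pairs[OF assms(2)[OF that]] by (rule cdf_nat_valued[OF prob_space_ensemble meas])
  \<comment> \<open>The ensemble is assumed only from \<open>n = 1\<close> on, so the identity of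
    distribution functions holds eventually rather than for every n.\<close>
  have ev: "\<forall>\<^sub>F n in sequentially. (\<Sum>m | real m \<le> y. ?p n m) = cdf (distr (M n) borel (close_pairs n (?t n) (P n))) y"
    using eventually_ge_at_top[of 1] by (rule eventually_mono) (simp add: cdf_eq)
  have "cdf (distr (measure_pmf (poisson_pmf (x ^ 4 / 64))) borel (\<lambda>m. real (id m))) y =
     (\<Sum>m | real m \<le> y. measure (measure_pmf (poisson_pmf (x ^ 4 / 64))) {k \<in> space (measure_pmf (poisson_pmf (x ^ 4 / 64))). id k = m})"
    by (intro cdf_nat_valued prob_space_measure_pmf) simp
  then have lim: "cdf (distr (measure_pmf (poisson_pmf (x ^ 4 / 64))) borel real) y = (\<Sum>m | real m \<le> y. pmf (poisson_pmf (x ^ 4 / 64)) m)"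
    by (simp add: measure_pmf_single)
  have "(\<lambda>n. \<Sum>m | real m \<le> y. ?p n m) \<longlonglongrightarrow> (\<Sum>m | real m \<le> y. pmf (poisson_pmf (x ^ 4 / 64)) m)"
    by (intro tendsto_sum poisson_close_pairs assms(1))
  then show "(\<lambda>n. cdf (distr (M n) borel (close_pairs n (?t n) (P n))) y) \<longlonglongrightarrow>
      cdf (distr (measure_pmf (poisson_pmf (x ^ 4 / 64))) borel real) y"
    unfolding lim by (rule Lim_transform_eventually[OF _ ev])
qed

end
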